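(* Let $\mathsf C_r$ be the finite cyclic group of order $r$ with generator $t$, and for $i\geq 1$ let $N(i)=1+t+\cdots+t^{i-1}\in\mathbb Z\mathsf C_r$. A free crossed resolution $F_*$ of $\mathsf C_r$ may be taken to have a single free generator $x_n$ in each dimension $n\ge1$, with $\varphi(x_1)=t$ and $$\delta_n(x_n)=\begin{cases}x_1^r&\text{if } n=2,\\ x_{n-1}\cdot(t-1)&\text{if } n>1,\ n\text{ odd},\\ x_{n-1}\cdot N(r)&\text{if } n>2,\ n\text{ even}.\end{cases}$$ A contracting homotopy on the universal cover $\widetilde F_*$ is given, for $i=0,\ldots,r-1$, by $h_0(t^i)=(t^i,x_1^{-i})$ and for $n\ge1$ $$h_n(t^i,x_n)=\begin{cases}(1,1)&\text{if } n=1,\ i\ne r-1,\\ (1,x_2)&\text{if } n=1,\ i=r-1,\\ (1,0)&\text{if } n\text{ even},\ n\ge2,\ i=0,\\ (1,x_{n+1}\cdot N(r-i))&\text{if } n\text{ even},\ n\ge2,\ 0<i\le r-1,\\ (1,0)&\text{if } n\text{ odd},\ n>1,\ i\ne 1,\\ (1,x_{n+1})&\text{if } n\text{ odd},\ n>1,\ i=1.\end{cases}$$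
   Context: In a groupoid the composite of $a:x\to y$, $b:y\to z$ is $ab:x\to z$. A crossed module over a groupoid $\Phi$ is a family of groups $M=(M(x))_{x\in Ob\,\Phi}$ with a groupoid morphism $\mu:M\to\Phi$, identity on objects, and a right action of $\Phi$ on $M$ ($m^u\in M(y)$ for $m\in M(x)$, $u\in\Phi(x,y)$) with $\mu(m^u)=u^{-1}\mu(m)u$ and $n^{-1}mn=m^{\mu n}$; over a group this is the usual notion. The free crossed module over a group $F$ on a function $w:S\to F$ is the universal crossed module $\mu:M\to F$ with a function $S\to M$ lifting $w$. A free crossed resolution $F_*$ of a group $G$ consists of: a free group $F_1$ with an epimorphism $\varphi:F_1\to G$; a free crossed module $\delta_2:F_2\to F_1$ with $\delta_2(F_2)=\ker\varphi$ (so $\ker\delta_2$ is a right $G$-module); free right $G$-modules $F_n$, $n\ge3$ (written additively, $F_1$ acting via $\varphi$); and $G$-equivariant homomorphisms $\delta_3:F_3\to\ker\delta_2\subseteq F_2$, $\delta_n:F_n\to F_{n-1}$ ($n\ge4$), such that $\ker\delta_n=\operatorname{im}\delta_{n+1}$ for all $n\ge2$. "Free generator in dimension $n$" refers to free group ($n=1$), free crossed $F_1$-module ($n=2$, on $\delta_2$ restricted to the generators), free $G$-module ($n\ge3$). Groups in dimensions 1 and 2 are written multiplicatively; the expression $x_2\cdot(t-1)\in F_2$ means $x_2^{x_1}x_2^{-1}$. The universal cover $\widetilde F$ (for $G=\mathsf C_r$): $\widetilde F_0=G$; $\widetilde F_1$ is the groupoid on $G$ with arrows $(g,u)\in G\times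 F_1$, source $\widetilde\delta^0(g,u)=g$, target $\widetilde\delta^1(g,u)=g(\varphi u)$, composition $(g,u)(g(\varphi u),v)=(g,uv)$; for $n\ge2$, $\widetilde F_n(g)=\{g\}\times F_n$, $\beta(g,c)=g$, $(g,c)^{(g,u)}=(g(\varphi u),c^u)$, $\widetilde\delta_n(g,c)=(g,\delta_nc)$. It is free on the elements $(g,x_n)$, $g\in G$, $n\ge1$. A contracting homotopy of $\widetilde F$ (to the base point $1\in G$) is a family of functions $h_n$ on $\widetilde F_n$, $n\ge0$, such that: $h_0(g)$ is an arrow $g\to1$ of $\widetilde F_1$; $h_1:\widetilde F_1\to\widetilde F_2(1)$ is a groupoid morphism; for $n\ge2$, $h_n:\widetilde F_n\to\widetilde F_{n+1}(1)$ is a morphism (a homomorphism on each $\widetilde F_n(g)$) with $h_n(c^a)=h_n(c)$ whenever $a\in\widetilde F_1$ and $c^a$ is defined; and $\widetilde\delta_2h_1c=(h_0\widetilde\delta^0c)^{-1}c\,(h_0\widetilde\delta^1c)$ for $c\in\widetilde F_1$; $\widetilde\delta_3h_2c=(h_1\widetilde\delta_2c)^{-1}c^{h_0\beta c}$ for $c\in\widetilde F_2$; $\widetilde\delta_{n+1}h_nc=-h_{n-1}\widetilde\delta_nc+c^{h_0\beta c}$ for $c\in\widetilde F_n$, $n\ge3$. For $n\ge1$ the $h_n$ are determined by their values on the free generators $(t^i,x_n)$.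
   Formalization: In the case n odd, n>1, the condition i=1 is read modulo r (i.e. t^i=t); this changes only r=1, where the formula as printed fails because it gives h_3(1,x_3)=0 while the homotopy identity requires δ_4 h_3(1,x_3)=x_3. *)

theory Defs
  imports "HOL-Algebra.Elementary_Groups" "HOL-Algebra.FiniteProduct" "HOL-Library.Poly_Mapping"
begin

section \<open>Subgroups generated by words\<close>

definition word_val :: "'h monoid \<Rightarrow> ('c \<Rightarrow> 'h) \<Rightarrow> 'c list \<Rightarrow> 'h" where
  "word_val H f w = foldr (\<lambda>c y. f c \<otimes>\<^bsub>H\<^esub> y) w \<one>\<^bsub>H\<^esub>"

lemma word_val_simps [simp]:
  "word_val H f [] = \<one>\<^bsub>H\<^esub>"
  "word_val H f (c # w) = f c \<otimes>\<^bsub>H\<^esub> word_val H f w"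
  by (auto simp: word_val_def)

lemma word_val_closed:
  assumes "group H" "f \<in> A \<rightarrow> carrier H" "w \<in> lists A"
  shows "word_val H f w \<in> carrier H"
proof -
  interpret group H by fact
  from assms(3) show ?thesis by (induction w) (use assms(2) in auto)
qed

lemma word_val_append:
  assumes "group H" "f \<in> A \<rightarrow> carrier H" "v \<in> lists A" "w \<in> lists A"
  shows "word_val H f (v @ w) = word_val H f v \<otimes>\<^bsub>H\<^esub> word_val H f w"
proof -
  interpret group H by fact
  note cl = word_val_closed[OF assms(1,2)]
  from assms(3) show ?thesis
  proof (induction v)
    case Nil
    then show ?case using cl[OF assms(4)] by simp
  next
    case (Cons c v)
    then have "f c \<in> carrier H" "word_val H f v \<in> carrier H" "word_val H f w \<in> carrier H"
      using assms(2) cl[OF _] assms(4) by (auto simp: lists_eq_set)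
    then show ?case using Cons by (simp add: m_assoc)
  qed
qed

lemma word_val_subgroup:
  assumes "group H" "f \<in> A \<rightarrow> carrier H" "\<And>c. c \<in> A \<Longrightarrow> inv\<^bsub>H\<^esub> f c \<in> f ` A"
  shows "subgroup (word_val H f ` lists A) H"
proof -
  interpret group H by fact
  note cl = word_val_closed[OF assms(1,2)]
  note ap = word_val_append[OF assms(1,2)]
  have inv: "inv\<^bsub>H\<^esub> word_val H f w \<in> word_val H f ` lists A" if "w \<in> lists A" for w
    using that
  proof (induction w)
    case Nil
    have "word_val H f [] \<in> word_val H f ` lists A" by blast
    then show ?case by simp
  next
    case (Cons c w)
    obtain d where d: "d \<in> A" "inv\<^bsub>H\<^esub> f c = f d" using assms(3)[OF Cons(1)] by blast
    obtain v where v: "v \<in> lists A" "inv\<^bsub>H\<^esub> word_val H f w = word_val H f v"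
      using Cons.IH by blast
    have fc: "f c \<in> carrier H" "f d \<in> carrier H" using assms(2) Cons(1) d(1) by auto
    have "inv\<^bsub>H\<^esub> word_val H f (c # w) = word_val H f v \<otimes>\<^bsub>H\<^esub> word_val H f [d]"
      using fc cl[OF Cons(2)] v(2) d(2) by (simp add: inv_mult_group)
    also have "\<dots> = word_val H f (v @ [d])" using ap[OF v(1), of "[d]"] d(1) by simp
    finally show ?case using v(1) d(1) by (metis append_in_lists_conv image_eqI lists.simps)
  qed
  show ?thesis
  proof
    show "word_val H f ` lists A \<subseteq> carrier H" using cl by blast
    show "\<one>\<^bsub>H\<^esub> \<in> word_val H f ` lists A"
      by (metis image_eqI lists.Nil word_val_simps(1))
    show "x \<otimes>\<^bsub>H\<^esub> y \<in> word_val H f ` lists A"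
      if "x \<in> word_val H f ` lists A" "y \<in> word_val H f ` lists A" for x y
      using that ap by (smt (verit) append_in_lists_conv image_iff)
    show "inv\<^bsub>H\<^esub> x \<in> word_val H f ` lists A" if "x \<in> word_val H f ` lists A" for x
      using that inv by blast
  qed
qed

text \<open>A copy, on the type of words, of the subgroup generated by the values of \<open>f\<close>.\<close>

lemma word_copy:
  fixes H :: "'h monoid" and f :: "'c \<Rightarrow> 'h"
  assumes "group H" "f \<in> A \<rightarrow> carrier H" "\<And>c. c \<in> A \<Longrightarrow> inv\<^bsub>H\<^esub> f c \<in> f ` A"
  obtains H' :: "'c list monoid" and e d where
    "group H'" "e \<in> hom H' H" "\<And>x. x \<in> carrier H' \<Longrightarrow> d (e x) = x"
    "\<And>y. y \<in> word_val H f ` lists A \<Longrightarrow> d y \<in> carrier H'"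
    "\<And>y. y \<in> word_val H f ` lists A \<Longrightarrow> e (d y) = y"
    "e ` carrier H' = word_val H f ` lists A"
    "\<And>y z. y \<in> word_val H f ` lists A \<Longrightarrow> z \<in> word_val H f ` lists A \<Longrightarrow>
       d (y \<otimes>\<^bsub>H\<^esub> z) = d y \<otimes>\<^bsub>H'\<^esub> d z"
proof -
  let ?K = "word_val H f ` lists A"
  define e where "e = word_val H f"
  define d where "d = inv_into (lists A) e"
  interpret K: subgroup ?K H by (rule word_val_subgroup[OF assms])
  interpret group H by fact
  define H' where
    "H' = \<lparr>carrier = d ` ?K, mult = (\<lambda>x y. d (e x \<otimes>\<^bsub>H\<^esub> e y)), one = d \<one>\<^bsub>H\<^esub>\<rparr>"
  have ed: "e (d y) = y" if "y \<in> ?K" for y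
    unfolding d_def using f_inv_into_f[of y e "lists A"] that unfolding e_def by blast
  have eK: "e x \<in> ?K" if "x \<in> carrier H'" for x using that ed by (auto simp: H'_def)
  have de: "d (e x) = x" if "x \<in> carrier H'" for x
    using that ed by (metis (no_types, lifting) H'_def imageE partial_object.select_convs(1))
  have eC: "e x \<in> carrier H" if "x \<in> carrier H'" for x using eK[OF that] K.subset by blast
  have dK: "d y \<in> carrier H'" if "y \<in> ?K" for y using that by (auto simp: H'_def)
  have em: "e (x \<otimes>\<^bsub>H'\<^esub> y) = e x \<otimes>\<^bsub>H\<^esub> e y" if "x \<in> carrier H'" "y \<in> carrier H'" for x y
    using ed[OF K.m_closed[OF eK[OF that(1)] eK[OF that(2)]]] by (simp add: H'_def)
  have mc: "x \<otimes>\<^bsub>H'\<^esub> y \<in> carrier H'" if "x \<in> carrier H'" "y \<in> carrier H'" for x y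
    using dK[OF K.m_closed[OF eK[OF that(1)] eK[OF that(2)]]] by (simp add: H'_def)
  have e1: "e \<one>\<^bsub>H'\<^esub> = \<one>\<^bsub>H\<^esub>" using ed[OF K.one_closed] by (simp add: H'_def)
  have oc: "\<one>\<^bsub>H'\<^esub> \<in> carrier H'" using dK[OF K.one_closed] by (simp add: H'_def)
  have inj: "x = y" if "x \<in> carrier H'" "y \<in> carrier H'" "e x = e y" for x y
    using that de by metis
  have grp: "group H'"
  proof (rule groupI)
    show "x \<otimes>\<^bsub>H'\<^esub> y \<otimes>\<^bsub>H'\<^esub> z = x \<otimes>\<^bsub>H'\<^esub> (y \<otimes>\<^bsub>H'\<^esub> z)"
      if "x \<in> carrier H'" "y \<in> carrier H'" "z \<in> carrier H'" for x y z
      using that by (intro inj) (auto simp: em mc m_assoc eC)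
    show "\<one>\<^bsub>H'\<^esub> \<otimes>\<^bsub>H'\<^esub> x = x" if "x \<in> carrier H'" for x
      using that by (intro inj) (auto simp: em mc oc e1 eC)
    show "\<exists>y\<in>carrier H'. y \<otimes>\<^bsub>H'\<^esub> x = \<one>\<^bsub>H'\<^esub>" if "x \<in> carrier H'" for x
    proof
      have i: "inv\<^bsub>H\<^esub> e x \<in> ?K" using eK[OF that] by (rule K.m_inv_closed)
      show "d (inv\<^bsub>H\<^esub> e x) \<in> carrier H'" by (rule dK[OF i])
      show "d (inv\<^bsub>H\<^esub> e x) \<otimes>\<^bsub>H'\<^esub> x = \<one>\<^bsub>H'\<^esub>"
        using that dK[OF i] ed[OF i] eC[OF that] by (intro inj) (auto simp: em mc oc e1)
    qed
  qed (use mc oc in auto)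
  have ehom: "e \<in> hom H' H" using eC em by (auto simp: hom_def)
  have img: "e ` carrier H' = ?K"
  proof
    show "e ` carrier H' \<subseteq> ?K" using eK by (rule image_subsetI)
    show "?K \<subseteq> e ` carrier H'"
    proof
      fix y assume y: "y \<in> ?K"
      show "y \<in> e ` carrier H'" using ed[OF y] dK[OF y] by (metis image_eqI)
    qed
  qed
  have hd: "d (y \<otimes>\<^bsub>H\<^esub> z) = d y \<otimes>\<^bsub>H'\<^esub> d z" if "y \<in> ?K" "z \<in> ?K" for y z
    using de[OF mc[OF dK[OF that(1)] dK[OF that(2)]]] em[OF dK[OF that(1)] dK[OF that(2)]]
      ed that by simp
  show ?thesis by (rule that[OF grp ehom de dK ed img hd]; assumption)
qed

section \<open>Free groups\<close>

text \<open>
  HOL cannot quantify over all types inside a formula, so the universal property is asserted for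
  the groups carried by the type of words in signed elements of the group itself.  Nothing is
  lost: the lemma \<open>free_group_on_universal\<close> below derives the universal property for groups of
  every type.
\<close>

definition free_group_on :: "'a monoid \<Rightarrow> 'a set \<Rightarrow> bool" where
  "free_group_on F X \<longleftrightarrow>
     group F \<and> X \<subseteq> carrier F \<and>
     (\<forall>(H :: (bool \<times> 'a) list monoid) f. group H \<and> f \<in> X \<rightarrow> carrier H \<longrightarrow>
        (\<exists>!\<theta>. \<theta> \<in> extensional (carrier F) \<and> \<theta> \<in> hom F H \<and> (\<forall>x\<in>X. \<theta> x = f x)))"

lemma word_val_single:
  assumes "group H" "f \<in> A \<rightarrow> carrier H" "c \<in> A"
  shows "f c \<in> word_val H f ` lists A"
proof -
  interpret group H by fact
  have "f c \<in> carrier H" using assms(2,3) by blast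
  then have "f c = word_val H f [c]" by simp
  then show ?thesis using assms(3) by (intro image_eqI[of _ _ "[c]"]) simp_all
qed

lemma free_group_on_universal:
  fixes H :: "'h monoid"
  assumes F: "free_group_on F X" and H: "group H" and f: "f \<in> X \<rightarrow> carrier H"
  shows "\<exists>!\<theta>. \<theta> \<in> extensional (carrier F) \<and> \<theta> \<in> hom F H \<and> (\<forall>x\<in>X. \<theta> x = f x)"
proof -
  interpret H: group H by fact
  interpret F: group F using F by (simp add: free_group_on_def)
  have XF: "X \<subseteq> carrier F" using F by (simp add: free_group_on_def)
  have fc: "f x \<in> carrier H" if "x \<in> X" for x using f that by blast
  have un: "\<exists>!\<theta>. \<theta> \<in> extensional (carrier F) \<and> \<theta> \<in> hom F H' \<and> (\<forall>x\<in>X. \<theta> x = k x)"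
    if "group H'" "k \<in> X \<rightarrow> carrier H'" for H' :: "(bool \<times> 'a) list monoid" and k
    using F that unfolding free_group_on_def by blast
  show ?thesis
  proof (rule ex_ex1I)
    define A where "A = (UNIV :: bool set) \<times> X"
    define j where "j = (\<lambda>(b, x). if b then f x else inv\<^bsub>H\<^esub> f x)"
    have j: "j \<in> A \<rightarrow> carrier H" using fc by (auto simp: A_def j_def)
    have ji: "inv\<^bsub>H\<^esub> j c \<in> j ` A" if "c \<in> A" for c
    proof -
      obtain b x where c: "c = (b, x)" "x \<in> X" using \<open>c \<in> A\<close> by (auto simp: A_def)
      have "inv\<^bsub>H\<^esub> j c = j (\<not> b, x)" using c fc by (auto simp: j_def)
      then show ?thesis using c by (auto simp: A_def)
    qed
    obtain H' :: "(bool \<times> 'a) list monoid" and e d where copy: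
      "group H'"
      "e \<in> hom H' H"
      "\<And>x. x \<in> carrier H' \<Longrightarrow> d (e x) = x"
      "\<And>y. y \<in> word_val H j ` lists A \<Longrightarrow> d y \<in> carrier H'"
      "\<And>y. y \<in> word_val H j ` lists A \<Longrightarrow> e (d y) = y"
      "e ` carrier H' = word_val H j ` lists A"
      "\<And>y z. y \<in> word_val H j ` lists A \<Longrightarrow> z \<in> word_val H j ` lists A \<Longrightarrow>
         d (y \<otimes>\<^bsub>H\<^esub> z) = d y \<otimes>\<^bsub>H'\<^esub> d z"
      by (rule word_copy[OF H j ji]; (assumption | (rule that; assumption)))
    have fK: "f x \<in> word_val H j ` lists A" if "x \<in> X" for x
      using word_val_single[OF H j, of "(True, x)"] that by (simp add: A_def j_def)
    obtain \<theta> where \<theta>: "\<theta> \<in> hom F H'" "\<forall>x\<in>X. \<theta> x = d (f x)"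
      using un[OF copy(1), of "\<lambda>x. d (f x)"] copy(4) fK by auto
    have "e \<circ> \<theta> \<in> hom F H" using hom_compose[OF \<theta>(1) copy(2)] .
    then have "restrict (e \<circ> \<theta>) (carrier F) \<in> hom F H"
      by (auto simp: hom_def Pi_iff)
    moreover have "\<forall>x\<in>X. restrict (e \<circ> \<theta>) (carrier F) x = f x"
      using \<theta>(2) copy(5) fK XF by auto
    ultimately show "\<exists>\<theta>. \<theta> \<in> extensional (carrier F) \<and> \<theta> \<in> hom F H \<and> (\<forall>x\<in>X. \<theta> x = f x)"
      by (intro exI[of _ "restrict (e \<circ> \<theta>) (carrier F)"] conjI restrict_extensional)
  next
    fix \<theta>1 \<theta>2
    assume 1: "\<theta>1 \<in> extensional (carrier F) \<and> \<theta>1 \<in> hom F H \<and> (\<forall>x\<in>X. \<theta>1 x = f x)"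
      and 2: "\<theta>2 \<in> extensional (carrier F) \<and> \<theta>2 \<in> hom F H \<and> (\<forall>x\<in>X. \<theta>2 x = f x)"
    define A where "A = (UNIV :: bool set) \<times> carrier F"
    define j where "j = (\<lambda>(b, m). if b then \<theta>1 m else \<theta>2 m)"
    interpret h1: group_hom F H \<theta>1 by unfold_locales (use 1 in auto)
    interpret h2: group_hom F H \<theta>2 by unfold_locales (use 2 in auto)
    have j: "j \<in> A \<rightarrow> carrier H" by (auto simp: A_def j_def)
    have ji: "inv\<^bsub>H\<^esub> j c \<in> j ` A" if "c \<in> A" for c
    proof -
      obtain b m where c: "c = (b, m)" "m \<in> carrier F" using \<open>c \<in> A\<close> by (auto simp: A_def)
      have "inv\<^bsub>H\<^esub> j c = j (b, inv\<^bsub>F\<^esub> m)" using c by (auto simp: j_def)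
      then show ?thesis using c by (auto simp: A_def)
    qed
    obtain H' :: "(bool \<times> 'a) list monoid" and e d where copy:
      "group H'"
      "e \<in> hom H' H"
      "\<And>x. x \<in> carrier H' \<Longrightarrow> d (e x) = x"
      "\<And>y. y \<in> word_val H j ` lists A \<Longrightarrow> d y \<in> carrier H'"
      "\<And>y. y \<in> word_val H j ` lists A \<Longrightarrow> e (d y) = y"
      "e ` carrier H' = word_val H j ` lists A"
      "\<And>y z. y \<in> word_val H j ` lists A \<Longrightarrow> z \<in> word_val H j ` lists A \<Longrightarrow>
         d (y \<otimes>\<^bsub>H\<^esub> z) = d y \<otimes>\<^bsub>H'\<^esub> d z"
      by (rule word_copy[OF H j ji]; (assumption | (rule that; assumption)))
    have K: "\<theta>1 m \<in> word_val H j ` lists A" "\<theta>2 m \<in> word_val H j ` lists A"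
      if "m \<in> carrier F" for m
      using word_val_single[OF H j, of "(True, m)"] word_val_single[OF H j, of "(False, m)"] that
      by (simp_all add: A_def j_def)
    have fK: "f x \<in> word_val H j ` lists A" if "x \<in> X" for x
      using K(1)[of x] 1 XF that by auto
    have R1: "restrict (d \<circ> \<theta>) (carrier F) \<in> hom F H'" if "\<theta> \<in> {\<theta>1, \<theta>2}" for \<theta>
      using K copy(4,7) that by (auto simp: hom_def)
    have R2: "\<forall>x\<in>X. restrict (d \<circ> \<theta>) (carrier F) x = d (f x)" if "\<theta> \<in> {\<theta>1, \<theta>2}" for \<theta>
      using 1 2 XF that by auto
    have R3: "(\<lambda>x. d (f x)) \<in> X \<rightarrow> carrier H'"
      using fK copy(4) by auto
    have ex1_eq: "a = b" if "\<exists>!\<theta>. Q \<theta>" "Q a" "Q b"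
      for Q and a b :: "'a \<Rightarrow> (bool \<times> 'a) list"
      using that by blast
    have eq: "restrict (d \<circ> \<theta>1) (carrier F) = restrict (d \<circ> \<theta>2) (carrier F)"
      by (rule ex1_eq[OF un[OF copy(1) R3]]) (intro conjI restrict_extensional R1 R2; simp)+
    show "\<theta>1 = \<theta>2"
    proof (rule extensionalityI[of _ "carrier F"])
      fix m assume m: "m \<in> carrier F"
      then have "d (\<theta>1 m) = d (\<theta>2 m)" using fun_cong[OF eq, of m] by simp
      then show "\<theta>1 m = \<theta>2 m" using copy(5) K[OF m] by metis
    qed (use 1 2 in auto)
  qed
qed

section \<open>Free crossed modules\<close>

definition right_action :: "'m monoid \<Rightarrow> 'p monoid \<Rightarrow> ('m \<Rightarrow> 'p \<Rightarrow> 'm) \<Rightarrow> bool" where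
  "right_action M P act \<longleftrightarrow>
     (\<forall>m\<in>carrier M. \<forall>u\<in>carrier P. act m u \<in> carrier M) \<and>
     (\<forall>m\<in>carrier M. \<forall>n\<in>carrier M. \<forall>u\<in>carrier P.
        act (m \<otimes>\<^bsub>M\<^esub> n) u = act m u \<otimes>\<^bsub>M\<^esub> act n u) \<and>
     (\<forall>m\<in>carrier M. act m \<one>\<^bsub>P\<^esub> = m) \<and>
     (\<forall>m\<in>carrier M. \<forall>u\<in>carrier P. \<forall>v\<in>carrier P.
        act m (u \<otimes>\<^bsub>P\<^esub> v) = act (act m u) v)"

definition crossed_module ::
  "'m monoid \<Rightarrow> 'p monoid \<Rightarrow> ('m \<Rightarrow> 'p) \<Rightarrow> ('m \<Rightarrow> 'p \<Rightarrow> 'm) \<Rightarrow> bool" where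
  "crossed_module M P \<mu> act \<longleftrightarrow>
     group M \<and> group P \<and> \<mu> \<in> hom M P \<and> right_action M P act \<and>
     (\<forall>m\<in>carrier M. \<forall>u\<in>carrier P. \<mu> (act m u) = inv\<^bsub>P\<^esub> u \<otimes>\<^bsub>P\<^esub> \<mu> m \<otimes>\<^bsub>P\<^esub> u) \<and>
     (\<forall>m\<in>carrier M. \<forall>n\<in>carrier M. inv\<^bsub>M\<^esub> n \<otimes>\<^bsub>M\<^esub> m \<otimes>\<^bsub>M\<^esub> n = act m (\<mu> n))"

definition crossed_module_hom where
  "crossed_module_hom P M \<mu> act N \<nu> act' =
     {\<theta> \<in> hom M N. (\<forall>m\<in>carrier M. \<nu> (\<theta> m) = \<mu> m) \<and>
        (\<forall>m\<in>carrier M. \<forall>u\<in>carrier P. \<theta> (act m u) = act' (\<theta> m) u)}"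

text \<open>
  The free crossed \<open>P\<close>-module on \<open>\<mu>\<close> restricted to \<open>X\<close>.  As above, the test objects live on a type
  of words, and \<open>free_crossed_module_on_universal\<close> extends the universal property to every type.
\<close>

definition free_crossed_module_on ::
  "'m monoid \<Rightarrow> 'p monoid \<Rightarrow> ('m \<Rightarrow> 'p) \<Rightarrow> ('m \<Rightarrow> 'p \<Rightarrow> 'm) \<Rightarrow> 'm set \<Rightarrow> bool" where
  "free_crossed_module_on M P \<mu> act X \<longleftrightarrow>
     crossed_module M P \<mu> act \<and> X \<subseteq> carrier M \<and>
     (\<forall>(N :: (bool \<times> 'm \<times> 'p) list monoid) \<nu> act' f.
        crossed_module N P \<nu> act' \<and> f \<in> X \<rightarrow> carrier N \<and> (\<forall>x\<in>X. \<nu> (f x) = \<mu> x) \<longrightarrow>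
        (\<exists>!\<theta>. \<theta> \<in> extensional (carrier M) \<and>
              \<theta> \<in> crossed_module_hom P M \<mu> act N \<nu> act' \<and> (\<forall>x\<in>X. \<theta> x = f x)))"

lemma crossed_word_copy:
  fixes N :: "'n monoid" and j :: "'c \<Rightarrow> 'n"
  assumes N: "crossed_module N P \<nu> act'" and j: "j \<in> A \<rightarrow> carrier N"
    and ji: "\<And>c. c \<in> A \<Longrightarrow> inv\<^bsub>N\<^esub> j c \<in> j ` A"
    and ja: "\<And>c u. c \<in> A \<Longrightarrow> u \<in> carrier P \<Longrightarrow> act' (j c) u \<in> j ` A"
  obtains N' :: "'c list monoid" and e d where
    "e \<in> hom N' N"
    "\<And>y. y \<in> word_val N j ` lists A \<Longrightarrow> d y \<in> carrier N'"
    "\<And>y. y \<in> word_val N j ` lists A \<Longrightarrow> e (d y) = y"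
    "\<And>y z. y \<in> word_val N j ` lists A \<Longrightarrow> z \<in> word_val N j ` lists A \<Longrightarrow>
       d (y \<otimes>\<^bsub>N\<^esub> z) = d y \<otimes>\<^bsub>N'\<^esub> d z"
    "crossed_module N' P (\<nu> \<circ> e) (\<lambda>n u. d (act' (e n) u))"
    "\<And>n u. n \<in> carrier N' \<Longrightarrow> u \<in> carrier P \<Longrightarrow> e (d (act' (e n) u)) = act' (e n) u"
proof -
  have gN: "group N" and gP: "group P" and \<nu>: "\<nu> \<in> hom N P" and ra: "right_action N P act'"
    and pr: "\<And>n u. n \<in> carrier N \<Longrightarrow> u \<in> carrier P \<Longrightarrow>
      \<nu> (act' n u) = inv\<^bsub>P\<^esub> u \<otimes>\<^bsub>P\<^esub> \<nu> n \<otimes>\<^bsub>P\<^esub> u"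
    and pe: "\<And>m n. m \<in> carrier N \<Longrightarrow> n \<in> carrier N \<Longrightarrow>
      inv\<^bsub>N\<^esub> n \<otimes>\<^bsub>N\<^esub> m \<otimes>\<^bsub>N\<^esub> n = act' m (\<nu> n)"
    using N by (auto simp: crossed_module_def)
  interpret N: group N by fact
  interpret P: group P by fact
  let ?K = "word_val N j ` lists A"
  interpret K: subgroup ?K N by (rule word_val_subgroup[OF gN j ji])
  have actc: "act' n u \<in> carrier N" if "n \<in> carrier N" "u \<in> carrier P" for n u
    using ra that by (simp add: right_action_def)
  have actm: "act' (m \<otimes>\<^bsub>N\<^esub> n) u = act' m u \<otimes>\<^bsub>N\<^esub> act' n u"
    if "m \<in> carrier N" "n \<in> carrier N" "u \<in> carrier P" for m n u
    using ra that by (simp add: right_action_def)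
  have act1: "act' \<one>\<^bsub>N\<^esub> u = \<one>\<^bsub>N\<^esub>" if "u \<in> carrier P" for u
    using actm[of "\<one>\<^bsub>N\<^esub>" "\<one>\<^bsub>N\<^esub>" u] actc[of "\<one>\<^bsub>N\<^esub>" u] that by simp
  have Ka: "act' (word_val N j w) u \<in> ?K" if "w \<in> lists A" "u \<in> carrier P" for w u
    using that(1)
  proof (induction w)
    case Nil
    then show ?case using act1[OF that(2)] K.one_closed by simp
  next
    case (Cons c w)
    have "act' (j c) u \<in> ?K"
      using ja[OF Cons(1) that(2)] word_val_single[OF gN j] by auto
    moreover have "act' (word_val N j (c # w)) u = act' (j c) u \<otimes>\<^bsub>N\<^esub> act' (word_val N j w) u"
      using actm[of "j c" "word_val N j w" u] j Cons(1) word_val_closed[OF gN j Cons(2)] that(2)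
      by auto
    ultimately show ?case using Cons.IH K.m_closed by metis
  qed
  obtain N' :: "'c list monoid" and e d where copy:
      "group N'"
      "e \<in> hom N' N"
      "\<And>x. x \<in> carrier N' \<Longrightarrow> d (e x) = x"
      "\<And>y. y \<in> word_val N j ` lists A \<Longrightarrow> d y \<in> carrier N'"
      "\<And>y. y \<in> word_val N j ` lists A \<Longrightarrow> e (d y) = y"
      "e ` carrier N' = word_val N j ` lists A"
      "\<And>y z. y \<in> word_val N j ` lists A \<Longrightarrow> z \<in> word_val N j ` lists A \<Longrightarrow>
         d (y \<otimes>\<^bsub>N\<^esub> z) = d y \<otimes>\<^bsub>N'\<^esub> d z"
      by (rule word_copy[OF gN j ji]; (assumption | (rule that; assumption)))
  interpret e: group_hom N' N e
    using copy(1,2) gN by (simp add: group_hom_def group_hom_axioms_def)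
  have eK: "e n \<in> ?K" if "n \<in> carrier N'" for n using copy(6) that by blast
  have aK: "act' (e n) u \<in> ?K" if "n \<in> carrier N'" "u \<in> carrier P" for n u
    using eK[OF that(1)] Ka[OF _ that(2)] by (metis (no_types, lifting) imageE)
  note [simp] = copy(3) copy(4)[OF aK] copy(5)[OF aK]
  have "right_action N' P (\<lambda>n u. d (act' (e n) u))"
    unfolding right_action_def
  proof (intro conjI ballI)
    fix m n u assume "m \<in> carrier N'" "n \<in> carrier N'" "u \<in> carrier P"
    then show "d (act' (e (m \<otimes>\<^bsub>N'\<^esub> n)) u) = d (act' (e m) u) \<otimes>\<^bsub>N'\<^esub> d (act' (e n) u)"
      by (simp add: actm copy(7)[OF aK aK])
  next
    fix m assume "m \<in> carrier N'"
    then show "d (act' (e m) \<one>\<^bsub>P\<^esub>) = m" using ra by (simp add: right_action_def)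
  next
    fix m u v assume "m \<in> carrier N'" "u \<in> carrier P" "v \<in> carrier P"
    then show "d (act' (e m) (u \<otimes>\<^bsub>P\<^esub> v)) = d (act' (e (d (act' (e m) u))) v)"
      using ra by (simp add: right_action_def)
  qed simp
  moreover have "\<nu> \<circ> e \<in> hom N' P" using hom_compose[OF copy(2) \<nu>] .
  moreover have "inv\<^bsub>N'\<^esub> n \<otimes>\<^bsub>N'\<^esub> m \<otimes>\<^bsub>N'\<^esub> n = d (act' (e m) ((\<nu> \<circ> e) n))"
    if mn: "m \<in> carrier N'" "n \<in> carrier N'" for m n
  proof -
    have "d (e (inv\<^bsub>N'\<^esub> n \<otimes>\<^bsub>N'\<^esub> m \<otimes>\<^bsub>N'\<^esub> n)) = d (act' (e m) (\<nu> (e n)))"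
      using mn pe[of "e m" "e n"] by simp
    moreover have "inv\<^bsub>N'\<^esub> n \<otimes>\<^bsub>N'\<^esub> m \<otimes>\<^bsub>N'\<^esub> n \<in> carrier N'" using mn by simp
    ultimately show ?thesis using copy(3) by (metis comp_apply)
  qed
  ultimately have "crossed_module N' P (\<nu> \<circ> e) (\<lambda>n u. d (act' (e n) u))"
    using copy(1) gP pr unfolding crossed_module_def by simp
  then show ?thesis using that[OF copy(2,4,5,7)] by simp
qed

lemma free_crossed_module_on_universal:
  fixes N :: "'n monoid"
  assumes M: "free_crossed_module_on M P \<mu> act X" and N: "crossed_module N P \<nu> act'"
    and f: "f \<in> X \<rightarrow> carrier N" "\<forall>x\<in>X. \<nu> (f x) = \<mu> x"
  shows "\<exists>!\<theta>. \<theta> \<in> extensional (carrier M) \<and>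
           \<theta> \<in> crossed_module_hom P M \<mu> act N \<nu> act' \<and> (\<forall>x\<in>X. \<theta> x = f x)"
proof -
  have cM: "crossed_module M P \<mu> act" and XM: "X \<subseteq> carrier M"
    using M by (auto simp: free_crossed_module_on_def)
  have un: "\<exists>!\<theta>. \<theta> \<in> extensional (carrier M) \<and>
      \<theta> \<in> crossed_module_hom P M \<mu> act N' \<nu>' act'' \<and> (\<forall>x\<in>X. \<theta> x = k x)"
    if "crossed_module N' P \<nu>' act''" "k \<in> X \<rightarrow> carrier N'" "\<forall>x\<in>X. \<nu>' (k x) = \<mu> x"
    for N' :: "(bool \<times> 'a \<times> 'b) list monoid" and \<nu>' act'' k
    using M that unfolding free_crossed_module_on_def by blast
  interpret M: group M using cM by (simp add: crossed_module_def)
  interpret N: group N using N by (simp add: crossed_module_def)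
  interpret P: group P using N by (simp add: crossed_module_def)
  note gN = N.is_group
  have fc: "f x \<in> carrier N" if "x \<in> X" for x using f(1) that by blast
  have ra: "right_action N P act'" "right_action M P act"
    using N cM by (simp_all add: crossed_module_def)
  have actc: "act' n u \<in> carrier N" if "n \<in> carrier N" "u \<in> carrier P" for n u
    using ra(1) that by (simp add: right_action_def)
  have Mactc: "act n u \<in> carrier M" if "n \<in> carrier M" "u \<in> carrier P" for n u
    using ra(2) that by (simp add: right_action_def)
  have actm: "act' (m \<otimes>\<^bsub>N\<^esub> n) u = act' m u \<otimes>\<^bsub>N\<^esub> act' n u"
    if "m \<in> carrier N" "n \<in> carrier N" "u \<in> carrier P" for m n u
    using ra(1) that by (simp add: right_action_def)
  have actinv: "act' (inv\<^bsub>N\<^esub> n) u = inv\<^bsub>N\<^esub> (act' n u)" if "n \<in> carrier N" "u \<in> carrier P" for n u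
  proof (rule N.inv_equality[symmetric])
    have "act' \<one>\<^bsub>N\<^esub> u = \<one>\<^bsub>N\<^esub>"
      using actm[of "\<one>\<^bsub>N\<^esub>" "\<one>\<^bsub>N\<^esub>" u] actc[of "\<one>\<^bsub>N\<^esub>" u] that by simp
    then show "act' (inv\<^bsub>N\<^esub> n) u \<otimes>\<^bsub>N\<^esub> act' n u = \<one>\<^bsub>N\<^esub>"
      using actm[of "inv\<^bsub>N\<^esub> n" n u] that by simp
  qed (use that actc in auto)
  have act2: "act' (act' n u) v = act' n (u \<otimes>\<^bsub>P\<^esub> v)" "act' n \<one>\<^bsub>P\<^esub> = n"
    if "n \<in> carrier N" "u \<in> carrier P" "v \<in> carrier P" for n u v
    using ra(1) that by (simp_all add: right_action_def)
  show ?thesis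
  proof (rule ex_ex1I)
    define A where "A = (UNIV :: bool set) \<times> X \<times> carrier P"
    define j where "j = (\<lambda>(b, x, u). act' (if b then f x else inv\<^bsub>N\<^esub> f x) u)"
    have j: "j \<in> A \<rightarrow> carrier N" using fc actc by (auto simp: A_def j_def)
    have ji: "inv\<^bsub>N\<^esub> j c \<in> j ` A" if "c \<in> A" for c
    proof -
      obtain b x u where c: "c = (b, x, u)" "x \<in> X" "u \<in> carrier P"
        using \<open>c \<in> A\<close> by (auto simp: A_def)
      have "f x \<in> carrier N" using fc c by auto
      then have "inv\<^bsub>N\<^esub> j c = j (\<not> b, x, u)" using c actinv actc by (auto simp: j_def)
      then show ?thesis using c by (auto simp: A_def)
    qed
    have ja: "act' (j c) v \<in> j ` A" if "c \<in> A" "v \<in> carrier P" for c v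
    proof -
      obtain b x u where c: "c = (b, x, u)" "x \<in> X" "u \<in> carrier P"
        using \<open>c \<in> A\<close> by (auto simp: A_def)
      have "f x \<in> carrier N" using fc c by auto
      then have "act' (j c) v = j (b, x, u \<otimes>\<^bsub>P\<^esub> v)"
        using c that(2) act2 by (auto simp: j_def)
      then show ?thesis using c that(2) by (auto simp: A_def)
    qed
    obtain N' :: "(bool \<times> 'a \<times> 'b) list monoid" and e d where copy:
      "e \<in> hom N' N"
      "\<And>y. y \<in> word_val N j ` lists A \<Longrightarrow> d y \<in> carrier N'"
      "\<And>y. y \<in> word_val N j ` lists A \<Longrightarrow> e (d y) = y"
      "\<And>y z. y \<in> word_val N j ` lists A \<Longrightarrow> z \<in> word_val N j ` lists A \<Longrightarrow>
         d (y \<otimes>\<^bsub>N\<^esub> z) = d y \<otimes>\<^bsub>N'\<^esub> d z"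
      "crossed_module N' P (\<nu> \<circ> e) (\<lambda>n u. d (act' (e n) u))"
      "\<And>n u. n \<in> carrier N' \<Longrightarrow> u \<in> carrier P \<Longrightarrow> e (d (act' (e n) u)) = act' (e n) u"
      by (rule crossed_word_copy[OF N j ji ja]; (assumption | (rule that; assumption)))
    have fK: "f x \<in> word_val N j ` lists A" if "x \<in> X" for x
    proof -
      have "(True, x, \<one>\<^bsub>P\<^esub>) \<in> A" using that by (simp add: A_def)
      then have "j (True, x, \<one>\<^bsub>P\<^esub>) \<in> word_val N j ` lists A" by (rule word_val_single[OF gN j])
      moreover have "j (True, x, \<one>\<^bsub>P\<^esub>) = f x"
        using act2(2)[OF fc[OF that] P.one_closed P.one_closed] by (simp add: j_def)
      ultimately show ?thesis by simp
    qed
    obtain \<theta> where \<theta>: "\<theta> \<in> crossed_module_hom P M \<mu> act N' (\<nu> \<circ> e) (\<lambda>n u. d (act' (e n) u))"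
      "\<forall>x\<in>X. \<theta> x = d (f x)"
      using un[OF copy(5), of "\<lambda>x. d (f x)"] copy(2,3) fK f(2) by auto
    have \<theta>h: "\<theta> \<in> hom M N'" using \<theta> by (simp add: crossed_module_hom_def)
    have \<theta>c: "\<theta> m \<in> carrier N'" if "m \<in> carrier M" for m
      using \<theta>h that by (auto simp: hom_def)
    have "e \<circ> \<theta> \<in> hom M N" using hom_compose[OF \<theta>h copy(1)] .
    then have "restrict (e \<circ> \<theta>) (carrier M) \<in> hom M N"
      by (auto simp: hom_def Pi_iff)
    then have "restrict (e \<circ> \<theta>) (carrier M) \<in> crossed_module_hom P M \<mu> act N \<nu> act'"
      using \<theta>(1) \<theta>c copy(6) Mactc by (auto simp: crossed_module_hom_def)
    moreover have "\<forall>x\<in>X. restrict (e \<circ> \<theta>) (carrier M) x = f x"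
      using \<theta>(2) copy(3) fK XM by auto
    ultimately show "\<exists>\<theta>. \<theta> \<in> extensional (carrier M) \<and>
        \<theta> \<in> crossed_module_hom P M \<mu> act N \<nu> act' \<and> (\<forall>x\<in>X. \<theta> x = f x)"
      by (intro exI[of _ "restrict (e \<circ> \<theta>) (carrier M)"] conjI restrict_extensional)
  next
    fix \<theta>1 \<theta>2
    assume 1: "\<theta>1 \<in> extensional (carrier M) \<and>
        \<theta>1 \<in> crossed_module_hom P M \<mu> act N \<nu> act' \<and> (\<forall>x\<in>X. \<theta>1 x = f x)"
      and 2: "\<theta>2 \<in> extensional (carrier M) \<and>
        \<theta>2 \<in> crossed_module_hom P M \<mu> act N \<nu> act' \<and> (\<forall>x\<in>X. \<theta>2 x = f x)"
    define A where "A = (UNIV :: bool set) \<times> carrier M \<times> carrier P"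
    define j where "j = (\<lambda>(b, m, u :: 'b). if b then \<theta>1 m else \<theta>2 m)"
    interpret h1: group_hom M N \<theta>1
      by unfold_locales (use 1 in \<open>auto simp: crossed_module_hom_def\<close>)
    interpret h2: group_hom M N \<theta>2
      by unfold_locales (use 2 in \<open>auto simp: crossed_module_hom_def\<close>)
    have eqv: "\<theta>1 (act m u) = act' (\<theta>1 m) u" "\<theta>2 (act m u) = act' (\<theta>2 m) u"
      "\<nu> (\<theta>1 m) = \<mu> m" "\<nu> (\<theta>2 m) = \<mu> m"
      if "m \<in> carrier M" "u \<in> carrier P" for m u
      using 1 2 that by (auto simp: crossed_module_hom_def)
    have j: "j \<in> A \<rightarrow> carrier N" by (auto simp: A_def j_def)
    have ji: "inv\<^bsub>N\<^esub> j c \<in> j ` A" if "c \<in> A" for c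
    proof -
      obtain b m u where c: "c = (b, m, u)" "m \<in> carrier M" "u \<in> carrier P"
        using \<open>c \<in> A\<close> by (auto simp: A_def)
      have "inv\<^bsub>N\<^esub> j c = j (b, inv\<^bsub>M\<^esub> m, u)" using c by (auto simp: j_def)
      then show ?thesis using c by (auto simp: A_def)
    qed
    have ja: "act' (j c) v \<in> j ` A" if "c \<in> A" "v \<in> carrier P" for c v
    proof -
      obtain b m u where c: "c = (b, m, u)" "m \<in> carrier M" "u \<in> carrier P"
        using \<open>c \<in> A\<close> by (auto simp: A_def)
      have "act' (j c) v = j (b, act m v, u)" using c that(2) eqv by (auto simp: j_def)
      then show ?thesis using c that(2) Mactc by (auto simp: A_def)
    qed
    obtain N' :: "(bool \<times> 'a \<times> 'b) list monoid" and e d where copy: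
      "e \<in> hom N' N"
      "\<And>y. y \<in> word_val N j ` lists A \<Longrightarrow> d y \<in> carrier N'"
      "\<And>y. y \<in> word_val N j ` lists A \<Longrightarrow> e (d y) = y"
      "\<And>y z. y \<in> word_val N j ` lists A \<Longrightarrow> z \<in> word_val N j ` lists A \<Longrightarrow>
         d (y \<otimes>\<^bsub>N\<^esub> z) = d y \<otimes>\<^bsub>N'\<^esub> d z"
      "crossed_module N' P (\<nu> \<circ> e) (\<lambda>n u. d (act' (e n) u))"
      "\<And>n u. n \<in> carrier N' \<Longrightarrow> u \<in> carrier P \<Longrightarrow> e (d (act' (e n) u)) = act' (e n) u"
      by (rule crossed_word_copy[OF N j ji ja]; (assumption | (rule that; assumption)))
    have K: "\<theta>1 m \<in> word_val N j ` lists A" "\<theta>2 m \<in> word_val N j ` lists A"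
      if "m \<in> carrier M" for m
      using word_val_single[OF gN j, of "(True, m, \<one>\<^bsub>P\<^esub>)"]
        word_val_single[OF gN j, of "(False, m, \<one>\<^bsub>P\<^esub>)"] that
      by (simp_all add: A_def j_def)
    have fK: "f x \<in> word_val N j ` lists A" if "x \<in> X" for x
      using K(1)[of x] 1 XM that by auto
    have R1: "restrict (d \<circ> \<theta>) (carrier M) \<in>
        crossed_module_hom P M \<mu> act N' (\<nu> \<circ> e) (\<lambda>n u. d (act' (e n) u))"
      if "\<theta> \<in> {\<theta>1, \<theta>2}" for \<theta>
      using K copy(2,3,4) Mactc eqv eqv(3,4)[OF _ P.one_closed] that
      by (auto simp: hom_def crossed_module_hom_def)
    have R2: "\<forall>x\<in>X. restrict (d \<circ> \<theta>) (carrier M) x = d (f x)" if "\<theta> \<in> {\<theta>1, \<theta>2}" for \<theta>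
      using 1 2 XM that by auto
    have R3: "(\<lambda>x. d (f x)) \<in> X \<rightarrow> carrier N'" "\<forall>x\<in>X. (\<nu> \<circ> e) (d (f x)) = \<mu> x"
      using fK copy(2,3) f(2) by auto
    have ex1_eq: "a = b" if "\<exists>!\<theta>. Q \<theta>" "Q a" "Q b"
      for Q and a b :: "'a \<Rightarrow> (bool \<times> 'a \<times> 'b) list"
      using that by blast
    have eq: "restrict (d \<circ> \<theta>1) (carrier M) = restrict (d \<circ> \<theta>2) (carrier M)"
      by (rule ex1_eq[OF un[OF copy(5) R3]]) (intro conjI restrict_extensional R1 R2; simp)+
    show "\<theta>1 = \<theta>2"
    proof (rule extensionalityI[of _ "carrier M"])
      fix m assume m: "m \<in> carrier M"
      then have "d (\<theta>1 m) = d (\<theta>2 m)" using fun_cong[OF eq, of m] by simp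
      then show "\<theta>1 m = \<theta>2 m" using copy(3) K[OF m] by metis
    qed (use 1 2 in auto)
  qed
qed

section \<open>Free modules over the integral group ring\<close>

text \<open>
  An element of the group ring of \<open>G\<close> is a finitely supported function to \<open>int\<close> with support
  inside \<open>carrier G\<close>.  Modules are commutative groups in the multiplicative notation of
  HOL-Algebra: their sum is \<open>\<otimes>\<close> and their zero is \<open>\<one>\<close>.
\<close>

definition G_module :: "'g monoid \<Rightarrow> 'm monoid \<Rightarrow> ('m \<Rightarrow> 'g \<Rightarrow> 'm) \<Rightarrow> bool" where
  "G_module G M act \<longleftrightarrow> group G \<and> comm_group M \<and> right_action M G act"

definition ring_act :: "'m monoid \<Rightarrow> ('m \<Rightarrow> 'g \<Rightarrow> 'm) \<Rightarrow> 'm \<Rightarrow> ('g \<Rightarrow>\<^sub>0 int) \<Rightarrow> 'm" where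
  "ring_act M act m a =
     finprod M (\<lambda>g. act m g [^]\<^bsub>M\<^esub> (Poly_Mapping.lookup a g)) (Poly_Mapping.keys a)"

definition free_G_module_on ::
  "'g monoid \<Rightarrow> 'm monoid \<Rightarrow> ('m \<Rightarrow> 'g \<Rightarrow> 'm) \<Rightarrow> 'm set \<Rightarrow> bool" where
  "free_G_module_on G M act X \<longleftrightarrow>
     G_module G M act \<and> X \<subseteq> carrier M \<and>
     (\<forall>m\<in>carrier M. \<exists>!a :: 'm \<Rightarrow>\<^sub>0 ('g \<Rightarrow>\<^sub>0 int).
        Poly_Mapping.keys a \<subseteq> X \<and>
        (\<forall>x. Poly_Mapping.keys (Poly_Mapping.lookup a x) \<subseteq> carrier G) \<and>
        m = finprod M (\<lambda>x. ring_act M act x (Poly_Mapping.lookup a x)) (Poly_Mapping.keys a))"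

section \<open>Free crossed resolutions\<close>

text \<open>
  Only \<open>grp F n\<close> for \<open>n \<ge> 1\<close>, \<open>bd F n\<close> for \<open>n \<ge> 2\<close> and \<open>mact F n\<close> for \<open>n \<ge> 3\<close> are meaningful;
  \<open>cact\<close> is the action of the group in dimension 1 on the one in dimension 2.
\<close>

record ('g, 'a) crossed_data =
  grp :: "nat \<Rightarrow> 'a monoid"
  phi :: "'a \<Rightarrow> 'g"
  bd :: "nat \<Rightarrow> 'a \<Rightarrow> 'a"
  cact :: "'a \<Rightarrow> 'a \<Rightarrow> 'a"
  mact :: "nat \<Rightarrow> 'a \<Rightarrow> 'g \<Rightarrow> 'a"

definition act1 :: "('g, 'a) crossed_data \<Rightarrow> nat \<Rightarrow> 'a \<Rightarrow> 'a \<Rightarrow> 'a" where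
  "act1 F n c u = (if n = 2 then cact F c u else mact F n c (phi F u))"

text \<open>
  The family \<open>X\<close> gives the free generators in each dimension.  Since \<open>phi F\<close> is onto, equivariance
  under the group in dimension 1 is the same as \<open>G\<close>-equivariance; for \<open>n = 3\<close> it refers to the
  \<open>G\<close>-module structure induced on the kernel of \<open>bd F 2\<close>, in which \<open>bd F 3\<close> lands by exactness.
\<close>

definition free_crossed_resolution ::
  "'g monoid \<Rightarrow> ('g, 'a) crossed_data \<Rightarrow> (nat \<Rightarrow> 'a set) \<Rightarrow> bool" where
  "free_crossed_resolution G F X \<longleftrightarrow>
     free_group_on (grp F 1) (X 1) \<and>
     phi F \<in> epi (grp F 1) G \<and>
     free_crossed_module_on (grp F 2) (grp F 1) (bd F 2) (cact F) (X 2) \<and>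
     bd F 2 ` carrier (grp F 2) = kernel (grp F 1) G (phi F) \<and>
     (\<forall>n\<ge>3. free_G_module_on G (grp F n) (mact F n) (X n)) \<and>
     (\<forall>n\<ge>3. bd F n \<in> hom (grp F n) (grp F (n - 1))) \<and>
     (\<forall>n\<ge>3. \<forall>c\<in>carrier (grp F n). \<forall>u\<in>carrier (grp F 1).
        bd F n (act1 F n c u) = act1 F (n - 1) (bd F n c) u) \<and>
     (\<forall>n\<ge>2. kernel (grp F n) (grp F (n - 1)) (bd F n) =
        bd F (n + 1) ` carrier (grp F (n + 1)))"

section \<open>The universal cover and its contracting homotopies\<close>

text \<open>
  An element of the universal cover in any dimension \<open>n \<ge> 1\<close> is a pair \<open>(g, c)\<close> with \<open>g\<close> in \<open>G\<close>
  and \<open>c\<close> in \<open>grp F n\<close>; in dimension 1 it is the arrow with source \<open>g\<close> and label \<open>c\<close>.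
\<close>

definition cov_arrows :: "'g monoid \<Rightarrow> ('g, 'a) crossed_data \<Rightarrow> ('g \<times> 'a) set" where
  "cov_arrows G F = carrier G \<times> carrier (grp F 1)"

definition cov_src :: "'g \<times> 'a \<Rightarrow> 'g" where
  "cov_src a = fst a"

definition cov_tgt :: "'g monoid \<Rightarrow> ('g, 'a) crossed_data \<Rightarrow> 'g \<times> 'a \<Rightarrow> 'g" where
  "cov_tgt G F a = fst a \<otimes>\<^bsub>G\<^esub> phi F (snd a)"

text \<open>Meaningful only when the target of \<open>a\<close> is the source of \<open>b\<close>.\<close>

definition cov_comp :: "('g, 'a) crossed_data \<Rightarrow> 'g \<times> 'a \<Rightarrow> 'g \<times> 'a \<Rightarrow> 'g \<times> 'a" where
  "cov_comp F a b = (fst a, snd a \<otimes>\<^bsub>grp F 1\<^esub> snd b)"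

definition cov_inv :: "'g monoid \<Rightarrow> ('g, 'a) crossed_data \<Rightarrow> 'g \<times> 'a \<Rightarrow> 'g \<times> 'a" where
  "cov_inv G F a = (cov_tgt G F a, inv\<^bsub>grp F 1\<^esub> (snd a))"

definition cov_grp :: "('g, 'a) crossed_data \<Rightarrow> nat \<Rightarrow> 'g \<Rightarrow> ('g \<times> 'a) monoid" where
  "cov_grp F n g =
     \<lparr>carrier = {g} \<times> carrier (grp F n),
      mult = (\<lambda>c d. (g, snd c \<otimes>\<^bsub>grp F n\<^esub> snd d)),
      one = (g, \<one>\<^bsub>grp F n\<^esub>)\<rparr>"

text \<open>Meaningful only when \<open>c\<close> lies over the source of \<open>a\<close>.\<close>

definition cov_act ::
  "'g monoid \<Rightarrow> ('g, 'a) crossed_data \<Rightarrow> nat \<Rightarrow> 'g \<times> 'a \<Rightarrow> 'g \<times> 'a \<Rightarrow> 'g \<times> 'a" where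
  "cov_act G F n c a = (fst c \<otimes>\<^bsub>G\<^esub> phi F (snd a), act1 F n (snd c) (snd a))"

definition cov_bd :: "('g, 'a) crossed_data \<Rightarrow> nat \<Rightarrow> 'g \<times> 'a \<Rightarrow> 'g \<times> 'a" where
  "cov_bd F n c = (fst c, bd F n (snd c))"

text \<open>
  The last clause covers both the case \<open>n = 2\<close> and the additive case \<open>n \<ge> 3\<close>, because
  the modules are written multiplicatively.
\<close>

definition contracting_homotopy ::
  "'g monoid \<Rightarrow> ('g, 'a) crossed_data \<Rightarrow>
     ('g \<Rightarrow> 'g \<times> 'a) \<Rightarrow> (nat \<Rightarrow> 'g \<times> 'a \<Rightarrow> 'g \<times> 'a) \<Rightarrow> bool" where
  "contracting_homotopy G F h0 h \<longleftrightarrow>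
     (\<forall>g\<in>carrier G. h0 g \<in> cov_arrows G F \<and> cov_src (h0 g) = g \<and> cov_tgt G F (h0 g) = \<one>\<^bsub>G\<^esub>) \<and>
     (\<forall>a\<in>cov_arrows G F. h 1 a \<in> carrier (cov_grp F 2 \<one>\<^bsub>G\<^esub>)) \<and>
     (\<forall>a\<in>cov_arrows G F. \<forall>b\<in>cov_arrows G F. cov_tgt G F a = cov_src b \<longrightarrow>
        h 1 (cov_comp F a b) = h 1 a \<otimes>\<^bsub>cov_grp F 2 \<one>\<^bsub>G\<^esub>\<^esub> h 1 b) \<and>
     (\<forall>n\<ge>2. \<forall>g\<in>carrier G. h n \<in> hom (cov_grp F n g) (cov_grp F (n + 1) \<one>\<^bsub>G\<^esub>)) \<and>
     (\<forall>n\<ge>2. \<forall>a\<in>cov_arrows G F. \<forall>c\<in>carrier (cov_grp F n (cov_src a)).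
        h n (cov_act G F n c a) = h n c) \<and>
     (\<forall>a\<in>cov_arrows G F.
        cov_bd F 2 (h 1 a) =
        cov_comp F (cov_comp F (cov_inv G F (h0 (cov_src a))) a) (h0 (cov_tgt G F a))) \<and>
     (\<forall>n\<ge>2. \<forall>g\<in>carrier G. \<forall>c\<in>carrier (cov_grp F n g).
        cov_bd F (n + 1) (h n c) =
        inv\<^bsub>cov_grp F n \<one>\<^bsub>G\<^esub>\<^esub> (h (n - 1) (cov_bd F n c))
          \<otimes>\<^bsub>cov_grp F n \<one>\<^bsub>G\<^esub>\<^esub> cov_act G F n c (h0 g))"

section \<open>The resolution of a finite cyclic group\<close>

definition norm_elt :: "'g monoid \<Rightarrow> 'g \<Rightarrow> nat \<Rightarrow> 'g \<Rightarrow>\<^sub>0 int" where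
  "norm_elt G t i = (\<Sum>k<i. Poly_Mapping.single (t [^]\<^bsub>G\<^esub> k) 1)"

abbreviation dot :: "('g, 'a) crossed_data \<Rightarrow> nat \<Rightarrow> 'a \<Rightarrow> ('g \<Rightarrow>\<^sub>0 int) \<Rightarrow> 'a" where
  "dot F n \<equiv> ring_act (grp F n) (mact F n)"

definition cyclic_resolution ::
  "'g monoid \<Rightarrow> 'g \<Rightarrow> nat \<Rightarrow> ('g, 'a) crossed_data \<Rightarrow> (nat \<Rightarrow> 'a) \<Rightarrow> bool" where
  "cyclic_resolution G t r F x \<longleftrightarrow>
     free_crossed_resolution G F (\<lambda>n. {x n}) \<and>
     phi F (x 1) = t \<and>
     (\<forall>n\<ge>2. bd F n (x n) =
        (if n = 2 then x 1 [^]\<^bsub>grp F 1\<^esub> r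
         else if n = 3 then cact F (x 2) (x 1) \<otimes>\<^bsub>grp F 2\<^esub> inv\<^bsub>grp F 2\<^esub> (x 2)
         else if odd n then
           dot F (n - 1) (x (n - 1)) (Poly_Mapping.single t 1 - Poly_Mapping.single \<one>\<^bsub>G\<^esub> 1)
         else dot F (n - 1) (x (n - 1)) (norm_elt G t r)))"

text \<open>
  In odd dimensions above 1 the exceptional value is the one at \<open>t\<close>.  Hence the condition on \<open>i\<close>
  is read modulo \<open>r\<close>, which matters only for \<open>r = 1\<close>, where \<open>t\<close> is the identity.
\<close>

definition cyclic_homotopy_values ::
  "'g monoid \<Rightarrow> 'g \<Rightarrow> nat \<Rightarrow> ('g, 'a) crossed_data \<Rightarrow> (nat \<Rightarrow> 'a) \<Rightarrow>
     ('g \<Rightarrow> 'g \<times> 'a) \<Rightarrow> (nat \<Rightarrow> 'g \<times> 'a \<Rightarrow> 'g \<times> 'a) \<Rightarrow> bool" where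
  "cyclic_homotopy_values G t r F x h0 h \<longleftrightarrow>
     (\<forall>i<r. h0 (t [^]\<^bsub>G\<^esub> i) = (t [^]\<^bsub>G\<^esub> i, x 1 [^]\<^bsub>grp F 1\<^esub> (- int i))) \<and>
     (\<forall>n\<ge>1. \<forall>i<r. h n (t [^]\<^bsub>G\<^esub> i, x n) =
        (\<one>\<^bsub>G\<^esub>,
         if n = 1 then (if i = r - 1 then x 2 else \<one>\<^bsub>grp F 2\<^esub>)
         else if even n then
           (if i = 0 then \<one>\<^bsub>grp F (n + 1)\<^esub>
            else dot F (n + 1) (x (n + 1)) (norm_elt G t (r - i)))
         else (if i mod r = 1 mod r then x (n + 1) else \<one>\<^bsub>grp F (n + 1)\<^esub>)))"

end

theory Submission
  imports Defs "HOL-Algebra.Multiplicative_Group"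
begin

text \<open>
  Since \<open>x\<^sub>1\<^sup>r\<close> is fixed by \<open>x\<^sub>1\<close>, the Peiffer identity makes the free crossed module on it
  commutative and lets \<open>F\<^sub>1\<close> act through \<open>\<phi>\<close>; it is the group ring of the cyclic group, with
  boundary the \<open>r\<close>-fold augmentation.  Hence every \<open>F\<^sub>n\<close> with \<open>n \<ge> 2\<close> is a free abelian group on
  the translates of \<open>x\<^sub>n\<close>, and the model resolution is exact because the multiples of \<open>t - 1\<close> are
  the elements of augmentation \<open>0\<close>, and those of \<open>N(r)\<close> are the invariant ones.

  In dimension 1 the homotopy counts full turns, \<open>h\<^sub>1(t\<^sup>i, x\<^sub>1\<^sup>k) = x\<^sub>2\<^sup>q\<close> with \<open>q\<close> the integer part of
  \<open>(i + k) / r\<close> for \<open>0 \<le> i < r\<close>.  In higher dimensions, invariance forces the value of \<open>h\<^sub>n\<close> on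
  \<open>(g, x\<^sub>n \<cdot> g')\<close> to be that on \<open>(g g'\<^sup>-\<^sup>1, x\<^sub>n)\<close>, and a homomorphism with these values exists by freeness.  Both sides of the
  homotopy identity are invariant homomorphisms, so it suffices to compare them on \<open>(t\<^sup>i, x\<^sub>n)\<close>, where
  it becomes \<open>(t - 1) N(i) = t\<^sup>i - 1\<close>.
\<close>

section \<open>Infinite cyclic groups\<close>

text \<open>Discrete logarithm, serving two groups: over an infinite cyclic group the exponent is
  unique, over \<open>G\<close> it is determined only modulo \<open>r\<close>, which is why
  \<open>idx\<close> below reduces it.\<close>

definition dlog :: "'a monoid \<Rightarrow> 'a \<Rightarrow> 'a \<Rightarrow> int" where
  "dlog P z u = (SOME k. u = z [^]\<^bsub>P\<^esub> k)"

locale infinite_cyclic = group P for P :: "'p monoid" (structure) +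
  fixes z :: 'p
  assumes z_closed [simp]: "z \<in> carrier P"
    and pow_inj: "z [^] (k :: int) = z [^] (l :: int) \<Longrightarrow> k = l"
    and pow_surj: "carrier P \<subseteq> range (\<lambda>k :: int. z [^] k)"
begin

lemma dlog_pow [simp]: "dlog P z (z [^] (k :: int)) = k"
  unfolding dlog_def by (rule some_equality) (auto dest: pow_inj)

lemma powE:
  assumes "u \<in> carrier P" obtains k :: int where "u = z [^] k"
  using pow_surj assms by blast

lemma comm: "comm_group P"
proof (rule group_comm_groupI)
  fix u v assume "u \<in> carrier P" "v \<in> carrier P"
  then show "u \<otimes> v = v \<otimes> u"
    by (elim powE) (simp add: int_pow_mult[symmetric] add.commute)
qed

lemma free: "free_group_on P {z}"
  unfolding free_group_on_def
proof (intro conjI allI impI)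
  fix H :: "(bool \<times> 'p) list monoid" and f
  assume "group H \<and> f \<in> {z} \<rightarrow> carrier H"
  then interpret H: group H by simp
  have f: "f z \<in> carrier H" using \<open>group H \<and> _\<close> by blast
  show "\<exists>!\<theta>. \<theta> \<in> extensional (carrier P) \<and> \<theta> \<in> hom P H \<and> (\<forall>x\<in>{z}. \<theta> x = f x)"
  proof (rule ex1I)
    let ?h = "\<lambda>u\<in>carrier P. f z [^]\<^bsub>H\<^esub> dlog P z u"
    have "?h \<in> hom P H"
    proof (rule homI)
      fix u v assume "u \<in> carrier P" "v \<in> carrier P"
      then show "?h (u \<otimes> v) = ?h u \<otimes>\<^bsub>H\<^esub> ?h v"
        using f by (elim powE) (simp add: int_pow_mult[symmetric] H.int_pow_mult)
    qed (use f in simp)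
    moreover have "?h z = f z" using f dlog_pow[of 1] by simp
    ultimately show "?h \<in> extensional (carrier P) \<and> ?h \<in> hom P H \<and> (\<forall>x\<in>{z}. ?h x = f x)"
      by simp
    fix \<theta> assume \<theta>: "\<theta> \<in> extensional (carrier P) \<and> \<theta> \<in> hom P H \<and> (\<forall>x\<in>{z}. \<theta> x = f x)"
    then interpret h: group_hom P H \<theta> by unfold_locales simp
    show "\<theta> = ?h"
    proof (rule extensionalityI[of _ "carrier P"])
      fix u assume "u \<in> carrier P"
      then show "\<theta> u = ?h u" using \<theta> by (elim powE) (simp add: h.hom_int_pow)
    qed (use \<theta> in auto)
  qed
qed (simp_all add: is_group)

end

text \<open>Two uses of the universal property. The map to the subgroup generated by
  \<open>x\<close>, followed by the inclusion, must be the identity, so \<open>x\<close> generates;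
  the map to the integers with \<open>x\<close> going to 1 recovers exponents, so the powers of
  \<open>x\<close> are distinct.\<close>

lemma infinite_cyclic_of_free:
  assumes F: "free_group_on F {x}"
  shows "infinite_cyclic F x"
proof -
  interpret group F using F by (simp add: free_group_on_def)
  have x: "x \<in> carrier F" using F by (simp add: free_group_on_def)
  let ?K = "F\<lparr>carrier := generate F {x}\<rparr>"
  have sub: "subgroup (generate F {x}) F" using x by (simp add: generate_is_subgroup)
  have gK: "group ?K" by (rule subgroup_imp_group[OF sub])
  have "(\<lambda>_. x) \<in> {x} \<rightarrow> carrier ?K" by (simp add: generate.incl)
  from ex1_implies_ex[OF free_group_on_universal[OF F gK this]]
  obtain \<theta> where \<theta>: "\<theta> \<in> extensional (carrier F)" "\<theta> \<in> hom F ?K" "\<theta> x = x" by auto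
  have "\<theta> \<in> hom F F" using \<theta>(2) generate_incl[of "{x}"] x by (auto simp: hom_def)
  moreover have "restrict id (carrier F) \<in> hom F F" by (auto simp: hom_def)
  moreover have "\<exists>!\<theta>. \<theta> \<in> extensional (carrier F) \<and> \<theta> \<in> hom F F \<and> (\<forall>y\<in>{x}. \<theta> y = id y)"
    by (rule free_group_on_universal[OF F is_group]) (use x in auto)
  ultimately have "\<theta> = restrict id (carrier F)"
    using \<theta>(1,3) x by (elim ex1E) (metis (mono_tags, lifting) id_apply restrict_apply' restrict_extensional singletonD)
  then have "u \<in> generate F {x}" if "u \<in> carrier F" for u
    using \<theta>(2) that by (auto simp: hom_def Pi_iff)
  then have surj: "carrier F \<subseteq> range (\<lambda>k :: int. x [^]\<^bsub>F\<^esub> k)"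
    by (auto simp: generate_pow[OF x])
  have "(\<lambda>_. 1 :: int) \<in> {x} \<rightarrow> carrier integer_group" by simp
  from ex1_implies_ex[OF free_group_on_universal[OF F group_integer_group this]]
  obtain \<eta> where \<eta>: "\<eta> \<in> hom F integer_group" "\<eta> x = 1" by auto
  have "\<eta> (x [^]\<^bsub>F\<^esub> (k :: int)) = k" for k
    using hom_int_pow[OF \<eta>(1) x is_group group_integer_group] \<eta>(2) by simp
  then show ?thesis
    by unfold_locales (use x surj in \<open>auto, metis\<close>)
qed

section \<open>The integral group ring\<close>

text \<open>Only the additive group of the group ring, in multiplicative notation; its ring product
  enters through \<open>shift\<close> and \<open>ring_act\<close>.\<close>

definition gring :: "'g monoid \<Rightarrow> ('g \<Rightarrow>\<^sub>0 int) monoid" where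
  "gring G = \<lparr>carrier = {p. Poly_Mapping.keys p \<subseteq> carrier G}, mult = (+), one = 0\<rparr>"

text \<open>Right multiplication by \<open>g\<close>. The guard keeps the support inside
  \<open>carrier G\<close>, hence finite when \<open>G\<close> is finite.\<close>

definition shift :: "'g monoid \<Rightarrow> ('g \<Rightarrow>\<^sub>0 int) \<Rightarrow> 'g \<Rightarrow> ('g \<Rightarrow>\<^sub>0 int)" where
  "shift G p g = Abs_poly_mapping
     (\<lambda>h. if h \<in> carrier G then Poly_Mapping.lookup p (h \<otimes>\<^bsub>G\<^esub> inv\<^bsub>G\<^esub> g) else 0)"

definition aug :: "'g monoid \<Rightarrow> ('g \<Rightarrow>\<^sub>0 int) \<Rightarrow> int" where
  "aug G p = (\<Sum>g\<in>carrier G. Poly_Mapping.lookup p g)"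

text \<open>Linear extension of \<open>b\<close> over the integers. The product runs over the whole
  (finite) carrier, so that all \<open>p\<close> share one index set.\<close>

definition lin :: "'g monoid \<Rightarrow> 'm monoid \<Rightarrow> ('g \<Rightarrow> 'm) \<Rightarrow> ('g \<Rightarrow>\<^sub>0 int) \<Rightarrow> 'm" where
  "lin G M b p = finprod M (\<lambda>g. b g [^]\<^bsub>M\<^esub> Poly_Mapping.lookup p g) (carrier G)"

text \<open>Freeness as an abelian group, on a family indexed by \<open>G\<close>. No action
  appears, so that dimension 2 and the modules above it can be treated alike.\<close>

definition G_basis :: "'g monoid \<Rightarrow> 'm monoid \<Rightarrow> ('g \<Rightarrow> 'm) \<Rightarrow> bool" where
  "G_basis G M b \<longleftrightarrow> comm_group M \<and> (\<forall>g\<in>carrier G. b g \<in> carrier M) \<and>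
     bij_betw (lin G M b) (carrier (gring G)) (carrier M)"

lemma gring_simps [simp]:
  "p \<otimes>\<^bsub>gring G\<^esub> q = p + q" "\<one>\<^bsub>gring G\<^esub> = 0"
  by (simp_all add: gring_def)

lemma carrier_gring_iff: "p \<in> carrier (gring G) \<longleftrightarrow> (\<forall>h. h \<notin> carrier G \<longrightarrow> Poly_Mapping.lookup p h = 0)"
  by (auto simp: gring_def in_keys_iff subset_iff)

lemma gring_eqI:
  assumes "p \<in> carrier (gring G)" "q \<in> carrier (gring G)"
    and "\<And>h. h \<in> carrier G \<Longrightarrow> Poly_Mapping.lookup p h = Poly_Mapping.lookup q h"
  shows "p = q"
  using assms by (intro poly_mapping_eqI) (metis carrier_gring_iff)

lemma gring_closed [simp]:
  "0 \<in> carrier (gring G)"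
  "p \<in> carrier (gring G) \<Longrightarrow> q \<in> carrier (gring G) \<Longrightarrow> p + q \<in> carrier (gring G)"
  "p \<in> carrier (gring G) \<Longrightarrow> q \<in> carrier (gring G) \<Longrightarrow> p - q \<in> carrier (gring G)"
  "p \<in> carrier (gring G) \<Longrightarrow> - p \<in> carrier (gring G)"
  "g \<in> carrier G \<Longrightarrow> Poly_Mapping.single g k \<in> carrier (gring G)"
  by (auto simp: carrier_gring_iff lookup_add lookup_minus lookup_single when_def)

lemma comm_group_gring: "comm_group (gring G)"
proof (rule comm_groupI)
  fix p assume "p \<in> carrier (gring G)"
  then show "\<exists>q\<in>carrier (gring G). q \<otimes>\<^bsub>gring G\<^esub> p = \<one>\<^bsub>gring G\<^esub>"
    by (intro bexI[of _ "- p"]) simp_all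
qed (simp_all add: ac_simps)

interpretation gring: comm_group "gring G" for G :: "'g monoid" by (rule comm_group_gring)

lemma inv_gring [simp]: "p \<in> carrier (gring G) \<Longrightarrow> inv\<^bsub>gring G\<^esub> p = - p"
  by (rule gring.inv_equality) simp_all

lemma lookup_gring_pow:
  assumes "p \<in> carrier (gring G)"
  shows "Poly_Mapping.lookup (p [^]\<^bsub>gring G\<^esub> (k :: int)) h = k * Poly_Mapping.lookup p h"
proof -
  have nat: "Poly_Mapping.lookup (p [^]\<^bsub>gring G\<^esub> (n :: nat)) h = int n * Poly_Mapping.lookup p h" for n
    by (induction n) (simp_all add: lookup_add algebra_simps)
  show ?thesis
  proof (cases k)
    case (nonneg n)
    then show ?thesis by (simp add: int_pow_int nat)
  next
    case (neg n)
    then have "p [^]\<^bsub>gring G\<^esub> k = - (p [^]\<^bsub>gring G\<^esub> Suc n)"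
      using assms gring.int_pow_neg_int[of p G "Suc n"] by (simp only: inv_gring gring.nat_pow_closed)
    then show ?thesis using neg nat[of "Suc n"] by (simp only: lookup_uminus)
  qed
qed

lemma single_pow [simp]:
  assumes "g \<in> carrier G"
  shows "Poly_Mapping.single g (1 :: int) [^]\<^bsub>gring G\<^esub> (k :: int) = Poly_Mapping.single g k"
  by (rule poly_mapping_eqI) (use assms in \<open>simp add: lookup_gring_pow lookup_single when_def\<close>)

text \<open>The elements \<open>single g 1\<close> generate the additive group: one coefficient at a
  time is split off along a finite set containing the support. The target is an arbitrary group
  because crossed modules occur as targets.\<close>

lemma gring_hom_ext:
  assumes H: "group H" and h: "h1 \<in> hom (gring G) H" "h2 \<in> hom (gring G) H"
    and eq: "\<And>g. g \<in> carrier G \<Longrightarrow> h1 (Poly_Mapping.single g 1) = h2 (Poly_Mapping.single g 1)"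
    and p: "p \<in> carrier (gring G)"
  shows "h1 p = h2 p"
proof -
  interpret H: group H by fact
  interpret h1: group_hom "gring G" H h1 by unfold_locales (use h in auto)
  interpret h2: group_hom "gring G" H h2 by unfold_locales (use h in auto)
  have "\<lbrakk>Poly_Mapping.keys p \<subseteq> S; S \<subseteq> carrier G\<rbrakk> \<Longrightarrow> h1 p = h2 p" if "finite S" for S p
    using that
  proof (induction S arbitrary: p)
    case empty
    then show ?case using h1.hom_one h2.hom_one by simp
  next
    case (insert g S)
    let ?s = "Poly_Mapping.single g (Poly_Mapping.lookup p g)"
    have g: "g \<in> carrier G" and p: "p \<in> carrier (gring G)"
      using insert.prems by (auto simp: gring_def)
    have "Poly_Mapping.keys (p - ?s) \<subseteq> S"
      using insert.prems(1) by (auto simp: in_keys_iff lookup_minus lookup_single when_def subset_iff split: if_splits)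
    then have "h1 (p - ?s) = h2 (p - ?s)" using insert by auto
    moreover have "h1 ?s = h2 ?s"
      using eq[OF g] h1.hom_int_pow[of "Poly_Mapping.single g 1"] h2.hom_int_pow[of "Poly_Mapping.single g 1"] g
      by (metis gring_closed(5) single_pow)
    ultimately have "h1 ((p - ?s) \<otimes>\<^bsub>gring G\<^esub> ?s) = h2 ((p - ?s) \<otimes>\<^bsub>gring G\<^esub> ?s)"
      using p g by (simp only: h1.hom_mult h2.hom_mult gring_closed)
    then show ?case by simp
  qed
  from this[of "Poly_Mapping.keys p" p] show ?thesis using p by (simp add: gring_def)
qed

lemma aug_add: "aug G (p + q) = aug G p + aug G q"
  by (simp add: aug_def lookup_add sum.distrib)

lemma aug_single [simp]: "finite (carrier G) \<Longrightarrow> g \<in> carrier G \<Longrightarrow> aug G (Poly_Mapping.single g k) = k"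
  by (simp add: aug_def lookup_single when_def)

lemma lin_hom:
  assumes "comm_group M" and "\<And>g. g \<in> carrier G \<Longrightarrow> b g \<in> carrier M"
  shows "lin G M b \<in> hom (gring G) M"
proof -
  interpret comm_group M by fact
  show ?thesis
  proof (rule homI)
    fix p q :: "'b \<Rightarrow>\<^sub>0 int"
    have "lin G M b (p + q) = finprod M (\<lambda>g. b g [^]\<^bsub>M\<^esub> Poly_Mapping.lookup p g \<otimes>\<^bsub>M\<^esub>
        b g [^]\<^bsub>M\<^esub> Poly_Mapping.lookup q g) (carrier G)"
      unfolding lin_def
      by (rule finprod_cong') (use assms(2) in \<open>auto simp: lookup_add int_pow_mult\<close>)
    also have "\<dots> = lin G M b p \<otimes>\<^bsub>M\<^esub> lin G M b q"
      unfolding lin_def by (rule finprod_multf) (use assms(2) in auto)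
    finally show "lin G M b (p \<otimes>\<^bsub>gring G\<^esub> q) = lin G M b p \<otimes>\<^bsub>M\<^esub> lin G M b q" by simp
  qed (use assms(2) in \<open>auto simp: lin_def\<close>)
qed

lemma lin_single [simp]:
  assumes "comm_group M" "finite (carrier G)" and "\<And>g. g \<in> carrier G \<Longrightarrow> b g \<in> carrier M"
    and g: "g \<in> carrier G"
  shows "lin G M b (Poly_Mapping.single g 1) = b g"
proof -
  interpret comm_group M by fact
  have "lin G M b (Poly_Mapping.single g 1) = finprod M (\<lambda>h. if g = h then b h else \<one>\<^bsub>M\<^esub>) (carrier G)"
    unfolding lin_def
    by (rule finprod_cong') (use assms in \<open>auto simp: lookup_single when_def\<close>)
  also have "\<dots> = b g" by (rule finprod_singleton) (use assms in auto)
  finally show ?thesis .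
qed

lemma basis_hom_ext:
  assumes B: "G_basis G M b" and fin: "finite (carrier G)" and H: "group H"
    and h: "h1 \<in> hom M H" "h2 \<in> hom M H"
    and eq: "\<And>g. g \<in> carrier G \<Longrightarrow> h1 (b g) = h2 (b g)" and m: "m \<in> carrier M"
  shows "h1 m = h2 m"
proof -
  have M: "comm_group M" and b: "\<And>g. g \<in> carrier G \<Longrightarrow> b g \<in> carrier M"
    using B by (auto simp: G_basis_def)
  obtain p where p: "p \<in> carrier (gring G)" "m = lin G M b p"
    using B m by (auto simp: G_basis_def bij_betw_def)
  have "(h1 \<circ> lin G M b) p = (h2 \<circ> lin G M b) p"
    by (rule gring_hom_ext[OF H hom_compose[OF lin_hom h(1)] hom_compose[OF lin_hom h(2)]])
      (use M b p eq lin_single[OF M fin b] in auto)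
  then show ?thesis using p by simp
qed

text \<open>Pass to coordinates by the inverse of \<open>lin G M b\<close>, then extend
  \<open>f\<close> linearly.\<close>

lemma basis_hom_exists:
  fixes H :: "'h monoid"
  assumes B: "G_basis G M b" and fin: "finite (carrier G)" and H: "comm_group H"
    and f: "\<And>g. g \<in> carrier G \<Longrightarrow> f g \<in> carrier H"
  shows "\<exists>h\<in>hom M H. \<forall>g\<in>carrier G. h (b g) = f g"
proof -
  have M: "comm_group M" and b: "\<And>g. g \<in> carrier G \<Longrightarrow> b g \<in> carrier M"
    using B by (auto simp: G_basis_def)
  have "lin G M b \<in> iso (gring G) M"
    using B lin_hom[OF M b] by (auto simp: iso_def G_basis_def)
  then have "inv_into (carrier (gring G)) (lin G M b) \<in> hom M (gring G)"
    using group.iso_set_sym[of "gring G"] by (auto simp: iso_def)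
  then have "lin G H f \<circ> inv_into (carrier (gring G)) (lin G M b) \<in> hom M H"
    by (rule hom_compose) (rule lin_hom[OF H f])
  moreover have "inv_into (carrier (gring G)) (lin G M b) (b g) = Poly_Mapping.single g 1"
    if "g \<in> carrier G" for g
    using B that inv_into_f_f[of "lin G M b" "carrier (gring G)" "Poly_Mapping.single g 1"]
    by (auto simp: G_basis_def bij_betw_def lin_single[OF M fin b])
  ultimately show ?thesis using lin_single[OF H fin f] by (intro bexI) auto
qed

text \<open>Outside the support all factors are trivial, so the product over the support extends to
  the carrier.\<close>

lemma ring_act_eq_lin:
  assumes "comm_group M" "finite (carrier G)" "\<And>g. g \<in> carrier G \<Longrightarrow> act m g \<in> carrier M"
    and "p \<in> carrier (gring G)"
  shows "ring_act M act m p = lin G M (act m) p"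
proof -
  interpret comm_group M by fact
  show ?thesis unfolding ring_act_def lin_def
    by (rule finprod_mono_neutral_cong_left)
      (use assms in \<open>auto simp: gring_def in_keys_iff subset_iff\<close>)
qed

text \<open>With a single generator, a coefficient family supported on \<open>{x}\<close> is
  \<open>single x p\<close> for one \<open>p\<close> in the group ring. Unique expansion therefore
  says that \<open>p\<close> going to \<open>x\<close> times \<open>p\<close> is bijective, and this
  map is \<open>lin G M (act x)\<close>.\<close>

lemma free_module_basis:
  assumes F: "free_G_module_on G M act {x}" and fin: "finite (carrier G)"
  shows "G_basis G M (act x)"
proof -
  have x: "x \<in> carrier M" and M: "comm_group M" and b: "\<And>g. g \<in> carrier G \<Longrightarrow> act x g \<in> carrier M"
    using F by (auto simp: free_G_module_on_def G_module_def right_action_def)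
  interpret comm_group M by fact
  have hom: "lin G M (act x) \<in> hom (gring G) M" by (rule lin_hom[OF M b])
  define Q where "Q = (\<lambda>m (a :: 'b \<Rightarrow>\<^sub>0 ('a \<Rightarrow>\<^sub>0 int)). Poly_Mapping.keys a \<subseteq> {x} \<and>
        (\<forall>x. Poly_Mapping.keys (Poly_Mapping.lookup a x) \<subseteq> carrier G) \<and>
        m = finprod M (\<lambda>x. ring_act M act x (Poly_Mapping.lookup a x)) (Poly_Mapping.keys a))"
  have uniq: "\<exists>!a. Q m a" if "m \<in> carrier M" for m
    using F that by (simp add: free_G_module_on_def Q_def)
  have Q1: "Q (lin G M (act x) p) (Poly_Mapping.single x p)" if p: "p \<in> carrier (gring G)" for p
  \<comment> \<open>\<open>single x 0\<close> has empty support, so the defining product is then the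
    empty one.\<close>
  proof (cases "p = 0")
    case True
    have "lin G M (act x) 0 = \<one>\<^bsub>M\<^esub>" by (simp add: lin_def)
    then show ?thesis using True by (simp add: Q_def)
  next
    case False
    then show ?thesis
      using p hom ring_act_eq_lin[of M G act x p, OF M fin b p]
      by (auto simp: Q_def lookup_single when_def gring_def hom_def Pi_iff)
  qed
  have Q2: "\<exists>p\<in>carrier (gring G). a = Poly_Mapping.single x p \<and> m = lin G M (act x) p"
    if m: "m \<in> carrier M" and Q: "Q m a" for m a
  proof -
    let ?p = "Poly_Mapping.lookup a x"
    have p: "?p \<in> carrier (gring G)" using Q by (simp add: Q_def gring_def)
    have a: "a = Poly_Mapping.single x ?p"
    proof (rule poly_mapping_eqI)
      fix y
      show "Poly_Mapping.lookup a y = Poly_Mapping.lookup (Poly_Mapping.single x ?p) y"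
      proof (cases "y = x")
        case False
        then have "y \<notin> Poly_Mapping.keys a" using Q by (auto simp: Q_def)
        then show ?thesis using False by (simp add: in_keys_iff lookup_single)
      qed simp
    qed
    have "m = lin G M (act x) ?p"
    proof (cases "?p = 0")
      case True
      then have "a = 0" using a by simp
      then have "m = \<one>\<^bsub>M\<^esub>" using Q by (simp add: Q_def)
      then show ?thesis using True by (simp add: lin_def)
    next
      case False
      then have "Poly_Mapping.keys a = {x}" using Q by (auto simp: Q_def in_keys_iff)
      then have "m = finprod M (\<lambda>x. ring_act M act x (Poly_Mapping.lookup a x)) {x}"
        using Q unfolding Q_def by metis
      moreover have "ring_act M act x ?p \<in> carrier M"
        using ring_act_eq_lin[of M G act x ?p, OF M fin b p] hom p by (auto simp: hom_def Pi_iff)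
      ultimately show ?thesis
        using ring_act_eq_lin[of M G act x ?p, OF M fin b p] by simp
    qed
    then show ?thesis using p a by blast
  qed
  have "inj_on (lin G M (act x)) (carrier (gring G))"
  proof (rule inj_onI)
    fix p q assume pq: "p \<in> carrier (gring G)" "q \<in> carrier (gring G)"
      "lin G M (act x) p = lin G M (act x) q"
    have "lin G M (act x) p \<in> carrier M" using hom pq by (auto simp: hom_def)
    then have "Poly_Mapping.single x p = Poly_Mapping.single x q"
      using uniq Q1[OF pq(1)] Q1[OF pq(2)] pq(3) by metis
    then show "p = q" by (metis lookup_single_eq)
  qed
  moreover have "lin G M (act x) ` carrier (gring G) = carrier M"
  proof
    show "lin G M (act x) ` carrier (gring G) \<subseteq> carrier M" using hom by (auto simp: hom_def)
    show "carrier M \<subseteq> lin G M (act x) ` carrier (gring G)" using uniq Q2 by blast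
  qed
  ultimately show ?thesis using M b by (simp add: G_basis_def bij_betw_def)
qed

section \<open>Finite cyclic groups\<close>

locale finite_cyclic = group G for G :: "'g monoid" (structure) +
  fixes t :: 'g and r :: nat
  assumes fin [simp]: "finite (carrier G)"
    and t_closed [simp]: "t \<in> carrier G"
    and gen: "generate G {t} = carrier G"
    and ord_G: "order G = r"
begin

lemma r_pos [simp]: "0 < r"
  using ord_G order_gt_0_iff_finite by auto

lemma pow_eq_iff: "t [^] (k :: int) = t [^] (l :: int) \<longleftrightarrow> k mod int r = l mod int r"
proof -
  have "ord t = r" using generate_pow_card[OF t_closed] gen ord_G by (simp add: order_def)
  then show ?thesis using int_pow_eq[OF t_closed, of k l] by (metis mod_eq_dvd_iff)
qed

lemma powE:
  assumes "g \<in> carrier G" obtains k :: int where "g = t [^] k"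
  using assms gen generate_pow[OF t_closed] by auto

definition idx :: "'g \<Rightarrow> int" where "idx g = dlog G t g mod int r"

lemma idx_pow [simp]: "idx (t [^] (k :: int)) = k mod int r"
proof -
  have "t [^] (k :: int) = t [^] dlog G t (t [^] k)" unfolding dlog_def by (rule someI) (rule refl)
  then show ?thesis by (simp add: idx_def pow_eq_iff)
qed

lemma pow_idx [simp]: "g \<in> carrier G \<Longrightarrow> t [^] idx g = g"
  by (elim powE) (simp add: pow_eq_iff)

lemma idx_bounds [simp]: "0 \<le> idx g" "idx g < int r"
  by (simp_all add: idx_def)

lemma pow_natE:
  assumes "g \<in> carrier G" obtains i where "i < r" "g = t [^] i"
proof
  show "nat (idx g) < r" by (simp add: nat_less_iff)
  show "g = t [^] nat (idx g)" using pow_idx[OF assms] int_pow_int[of G t "nat (idx g)"] by simp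
qed

lemma comm: "g \<in> carrier G \<Longrightarrow> h \<in> carrier G \<Longrightarrow> g \<otimes> h = h \<otimes> g"
  by (elim powE) (simp add: int_pow_mult[symmetric] add.commute)

abbreviation e :: "'g \<Rightarrow>\<^sub>0 int" where "e \<equiv> Poly_Mapping.single \<one> 1"

lemma lookup_shift:
  "Poly_Mapping.lookup (shift G p g) h = (if h \<in> carrier G then Poly_Mapping.lookup p (h \<otimes> inv g) else 0)"
proof -
  have "finite {h. (if h \<in> carrier G then Poly_Mapping.lookup p (h \<otimes> inv g) else 0) \<noteq> 0}"
    by (rule finite_subset[OF _ fin]) auto
  then show ?thesis by (simp add: shift_def)
qed

lemma shift_closed [simp]: "shift G p g \<in> carrier (gring G)"
  by (simp add: carrier_gring_iff lookup_shift)

lemma shift_add: "shift G (p + q) g = shift G p g + shift G q g"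
  by (rule poly_mapping_eqI) (simp add: lookup_shift lookup_add)

lemma shift_one: "p \<in> carrier (gring G) \<Longrightarrow> shift G p \<one> = p"
  by (rule gring_eqI[of _ G]) (simp_all add: lookup_shift)

lemma shift_shift:
  "u \<in> carrier G \<Longrightarrow> v \<in> carrier G \<Longrightarrow> shift G (shift G p u) v = shift G p (u \<otimes> v)"
  by (rule poly_mapping_eqI) (simp add: lookup_shift inv_mult_group m_assoc)

lemma shift_single [simp]:
  assumes "g \<in> carrier G" "u \<in> carrier G"
  shows "shift G (Poly_Mapping.single g k) u = Poly_Mapping.single (g \<otimes> u) k"
proof (rule gring_eqI[of _ G])
  fix h assume "h \<in> carrier G"
  then have "g = h \<otimes> inv u \<longleftrightarrow> g \<otimes> u = h" using assms by (metis inv_solve_right)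
  then show "Poly_Mapping.lookup (shift G (Poly_Mapping.single g k) u) h =
      Poly_Mapping.lookup (Poly_Mapping.single (g \<otimes> u) k) h"
    using \<open>h \<in> carrier G\<close> by (simp add: lookup_shift lookup_single)
qed (use assms in simp_all)

lemma aug_shift [simp]:
  assumes "u \<in> carrier G" shows "aug G (shift G p u) = aug G p"
  unfolding aug_def
  by (rule sum.reindex_bij_witness[of _ "\<lambda>h. h \<otimes> u" "\<lambda>h. h \<otimes> inv u"])
    (use assms in \<open>auto simp: lookup_shift m_assoc\<close>)

end

section \<open>The free crossed module on one generator over an infinite cyclic group\<close>

lemma crossed_moduleD:
  assumes "crossed_module N P \<nu> act"
  shows "group N" "group P" "\<nu> \<in> hom N P"
    and "n \<in> carrier N \<Longrightarrow> u \<in> carrier P \<Longrightarrow> act n u \<in> carrier N"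
    and "m \<in> carrier N \<Longrightarrow> n \<in> carrier N \<Longrightarrow> u \<in> carrier P \<Longrightarrow> act (m \<otimes>\<^bsub>N\<^esub> n) u = act m u \<otimes>\<^bsub>N\<^esub> act n u"
    and "n \<in> carrier N \<Longrightarrow> act n \<one>\<^bsub>P\<^esub> = n"
    and "n \<in> carrier N \<Longrightarrow> u \<in> carrier P \<Longrightarrow> v \<in> carrier P \<Longrightarrow> act n (u \<otimes>\<^bsub>P\<^esub> v) = act (act n u) v"
    and "n \<in> carrier N \<Longrightarrow> u \<in> carrier P \<Longrightarrow> \<nu> (act n u) = inv\<^bsub>P\<^esub> u \<otimes>\<^bsub>P\<^esub> \<nu> n \<otimes>\<^bsub>P\<^esub> u"
    and "m \<in> carrier N \<Longrightarrow> n \<in> carrier N \<Longrightarrow> inv\<^bsub>N\<^esub> n \<otimes>\<^bsub>N\<^esub> m \<otimes>\<^bsub>N\<^esub> n = act m (\<nu> n)"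
  using assms by (simp_all add: crossed_module_def right_action_def)

lemma crossed_act_hom:
  assumes "crossed_module N P \<nu> act" "u \<in> carrier P"
  shows "(\<lambda>n. act n u) \<in> hom N N"
  using crossed_moduleD(4,5)[OF assms(1)] assms(2) by (auto simp: hom_def)

lemma crossed_hom_compose:
  assumes "\<theta> \<in> crossed_module_hom P L \<kappa> act N \<nu> act'" "\<theta>' \<in> crossed_module_hom P N \<nu> act' M \<mu> act''"
  shows "\<theta>' \<circ> \<theta> \<in> crossed_module_hom P L \<kappa> act M \<mu> act''"
  using assms hom_compose[of \<theta> L N \<theta>' M] by (auto simp: crossed_module_hom_def hom_def Pi_iff)

text \<open>Dimensions 0 and 1 only, so that an arbitrary resolution and the model constructed at
  the end can both instantiate it.\<close>

locale cyclic_presentation = finite_cyclic G t r + P: infinite_cyclic P z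
  for G :: "'g monoid" (structure) and t r and P :: "'p monoid" and z +
  fixes \<phi> :: "'p \<Rightarrow> 'g"
  assumes \<phi>_hom: "\<phi> \<in> hom P G" and \<phi>_z: "\<phi> z = t"
begin

sublocale \<phi>: group_hom P G \<phi> by unfold_locales (rule \<phi>_hom)

lemma \<phi>_pow [simp]: "\<phi> (z [^]\<^bsub>P\<^esub> (k :: int)) = t [^] k"
  using \<phi>.hom_int_pow[OF P.z_closed] by (simp add: \<phi>_z)

definition mu :: "('g \<Rightarrow>\<^sub>0 int) \<Rightarrow> 'p" where
  "mu p = z [^]\<^bsub>P\<^esub> (int r * aug G p)"

definition gact :: "('g \<Rightarrow>\<^sub>0 int) \<Rightarrow> 'p \<Rightarrow> ('g \<Rightarrow>\<^sub>0 int)" where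
  "gact p u = shift G p (\<phi> u)"

text \<open>Conjugation is trivial in both groups, so the axioms reduce to two facts: translation
  preserves the augmentation, and \<open>mu q\<close> acts trivially since \<open>\<phi>\<close>
  kills powers of \<open>z\<close> with exponent divisible by \<open>r\<close>.\<close>

lemma crossed: "crossed_module (gring G) P mu gact"
proof -
  interpret Pc: comm_group P by (rule P.comm)
  have "mu \<in> hom (gring G) P"
    by (rule homI) (simp_all add: mu_def aug_add P.int_pow_mult distrib_left)
  moreover have "right_action (gring G) P gact"
    by (auto simp: right_action_def gact_def shift_add shift_one shift_shift)
  moreover have "mu (gact p u) = inv\<^bsub>P\<^esub> u \<otimes>\<^bsub>P\<^esub> mu p \<otimes>\<^bsub>P\<^esub> u" if "u \<in> carrier P" for p u
  proof -
    have c: "mu p \<in> carrier P" by (simp add: mu_def)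
    have "mu (gact p u) = mu p" using that by (simp add: mu_def gact_def)
    then show ?thesis using that c by (metis P.inv_solve_left Pc.m_comm P.inv_closed P.m_closed)
  qed
  moreover have "gact p (mu q) = p" if "p \<in> carrier (gring G)" for p q
  proof -
    have "t [^] (int r * aug G q) = t [^] (0 :: int)" by (simp only: pow_eq_iff) simp
    then show ?thesis using that by (simp add: mu_def gact_def shift_one)
  qed
  ultimately show ?thesis
    by (simp add: crossed_module_def P.is_group gring.is_group)
qed

text \<open>
  As \<open>P\<close> is commutative, all translates of \<open>y\<close> lie over \<open>z\<^sup>r\<close>, so by the Peiffer identity \<open>z\<^sup>r\<close> acts on
  one translate as conjugation by any other.  Acting on \<open>y\<close> by conjugation with \<open>y\<close> itself, \<open>z\<^sup>r\<close>
  fixes \<open>y\<close> and all its translates; hence these commute and depend on the exponent modulo \<open>r\<close> only.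
\<close>

lemma free_existence:
  fixes N :: "'n monoid"
  assumes N: "crossed_module N P \<nu> act" and y: "y \<in> carrier N" and \<nu>y: "\<nu> y = z [^]\<^bsub>P\<^esub> int r"
  shows "\<exists>\<theta>\<in>crossed_module_hom P (gring G) mu gact N \<nu> act. \<theta> e = y"
proof -
  note D = crossed_moduleD[OF N]
  interpret Pc: comm_group P by (rule P.comm)
  interpret N: group N by (rule D(1))
  interpret \<nu>: group_hom N P \<nu> by unfold_locales (rule D(3))
  define c where "c k = act y (z [^]\<^bsub>P\<^esub> (k :: int))" for k
  have c: "c k \<in> carrier N" for k using D(4) y by (simp add: c_def)
  have c0: "c 0 = y" using D(6)[OF y] by (simp add: c_def)
  have cact: "act (c k) (z [^]\<^bsub>P\<^esub> l) = c (k + l)" for k l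
    using D(7)[OF y, of "z [^]\<^bsub>P\<^esub> k" "z [^]\<^bsub>P\<^esub> l"] by (simp add: c_def P.int_pow_mult)
  have \<nu>c: "\<nu> (c k) = z [^]\<^bsub>P\<^esub> int r" for k
    using D(8)[OF y, of "z [^]\<^bsub>P\<^esub> k"] \<nu>y
    by (simp add: c_def P.int_pow_neg[symmetric] P.int_pow_mult[symmetric])
  have "act y (z [^]\<^bsub>P\<^esub> int r) = y" using D(9)[OF y y] y \<nu>y by simp
  then have yr: "c (int r) = y" by (simp add: c_def)
  \<comment> \<open>\<open>N\<close> itself may fail to be commutative, so the linear extension is
    formed inside a commutative subgroup containing all the translates \<open>c k\<close>: elements
    fixed by \<open>z^r\<close> whose boundary is a power of \<open>z^r\<close>.\<close>
  define T where "T = {n \<in> carrier N. act n (z [^]\<^bsub>P\<^esub> int r) = n \<and> \<nu> n \<in> generate P {z [^]\<^bsub>P\<^esub> int r}}"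
  have act_gen: "act n u = n" if "u \<in> generate P {z [^]\<^bsub>P\<^esub> int r}" "n \<in> T" for n u
    using that(1)
  proof (induction rule: generate.induct)
    case one
    then show ?case using that(2) D(6) by (simp add: T_def)
  next
    case (incl h)
    then show ?case using that(2) by (simp add: T_def)
  next
    case (inv h)
    then have h: "h \<in> carrier P" "act n h = n" "n \<in> carrier N" using that(2) by (simp_all add: T_def)
    then show ?case using D(6)[OF h(3)] D(7)[OF h(3) h(1), of "inv\<^bsub>P\<^esub> h"] by simp
  next
    case (eng g h)
    moreover have "g \<in> carrier P" "h \<in> carrier P"
      using eng P.generate_in_carrier[of "{z [^]\<^bsub>P\<^esub> int r}"] by auto
    ultimately show ?case using D(7)[of n g h] that(2) by (simp add: T_def)
  qed
  have subT: "subgroup T N"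
  proof (rule N.subgroupI)
    show "T \<noteq> {}"
    proof -
      have "act \<one>\<^bsub>N\<^esub> (z [^]\<^bsub>P\<^esub> int r) = \<one>\<^bsub>N\<^esub>"
        using hom_one[OF crossed_act_hom[OF N] D(1) D(1)] by simp
      then have "\<one>\<^bsub>N\<^esub> \<in> T" by (simp add: T_def generate.one)
      then show ?thesis by blast
    qed
  next
    fix n assume n: "n \<in> T"
    interpret a: group_hom N N "\<lambda>n. act n (z [^]\<^bsub>P\<^esub> int r)"
      by unfold_locales (rule crossed_act_hom[OF N], simp)
    show "inv\<^bsub>N\<^esub> n \<in> T"
      using n a.hom_inv[of n] P.generate_m_inv_closed[of "{z [^]\<^bsub>P\<^esub> int r}"] by (auto simp: T_def)
  next
    fix m n assume "m \<in> T" "n \<in> T"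
    then show "m \<otimes>\<^bsub>N\<^esub> n \<in> T" using D(5) by (auto simp: T_def intro: generate.eng)
  qed (auto simp: T_def)
  interpret T: group "N\<lparr>carrier := T\<rparr>" by (rule N.subgroup_imp_group[OF subT])
  \<comment> \<open>By the Peiffer identity, conjugation by \<open>n\<close> is the action of
    \<open>\<nu> n\<close>, a power of \<open>z^r\<close>, and such powers fix every element of
    \<open>T\<close>.\<close>
  have Tc: "comm_group (N\<lparr>carrier := T\<rparr>)"
  proof (rule T.group_comm_groupI)
    fix m n assume "m \<in> carrier (N\<lparr>carrier := T\<rparr>)" "n \<in> carrier (N\<lparr>carrier := T\<rparr>)"
    then have mn: "m \<in> T" "n \<in> T" by auto
    then have N: "m \<in> carrier N" "n \<in> carrier N" by (auto simp: T_def)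
    have "inv\<^bsub>N\<^esub> n \<otimes>\<^bsub>N\<^esub> m \<otimes>\<^bsub>N\<^esub> n = m" using D(9)[OF N] act_gen[of "\<nu> n" m] mn by (simp add: T_def)
    then show "m \<otimes>\<^bsub>N\<lparr>carrier := T\<rparr>\<^esub> n = n \<otimes>\<^bsub>N\<lparr>carrier := T\<rparr>\<^esub> m"
      using N N.inv_solve_left[of "m" n "m \<otimes>\<^bsub>N\<^esub> n"] by (simp add: N.m_assoc)
  qed
  have cT: "c k \<in> T" for k
  proof -
    have "act (c k) (z [^]\<^bsub>P\<^esub> int r) = c k"
      using cact[of k "int r"] cact[of "int r" k] cact[of 0 k] c0 yr by (simp add: add.commute)
    then show ?thesis using c by (simp add: T_def \<nu>c generate.incl)
  qed
  have cper: "c (k + int r * l) = c k" for k l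
    using act_gen[OF _ cT, of "z [^]\<^bsub>P\<^esub> (int r * l)" k] cact[of k "int r * l"]
      P.generate_pow[of "z [^]\<^bsub>P\<^esub> int r"] by (auto simp: P.int_pow_pow)
  have cmod: "c (k mod int r) = c k" for k
    using cper[of "k mod int r" "k div int r"] by simp
  define \<theta> where "\<theta> = lin G (N\<lparr>carrier := T\<rparr>) (\<lambda>g. c (idx g))"
  have \<theta>T: "\<theta> \<in> hom (gring G) (N\<lparr>carrier := T\<rparr>)"
    unfolding \<theta>_def by (rule lin_hom[OF Tc]) (simp add: cT)
  then have \<theta>: "\<theta> \<in> hom (gring G) N" by (auto simp: hom_def Pi_iff T_def)
  have \<theta>s: "\<theta> (Poly_Mapping.single (t [^] k) 1) = c k" for k :: int
    unfolding \<theta>_def using lin_single[OF Tc fin, of "\<lambda>g. c (idx g)" "t [^] k"] cT cmod by simp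
  have "\<nu> (\<theta> p) = mu p" if "p \<in> carrier (gring G)" for p
  proof -
    have "(\<nu> \<circ> \<theta>) p = mu p"
    proof (rule gring_hom_ext[OF P.is_group Group.hom_compose[OF \<theta> D(3)] crossed_moduleD(3)[OF crossed] _ that])
      fix g assume "g \<in> carrier G"
      then show "(\<nu> \<circ> \<theta>) (Poly_Mapping.single g 1) = mu (Poly_Mapping.single g 1)"
        by (elim powE) (simp add: \<theta>s \<nu>c mu_def)
    qed
    then show ?thesis by simp
  qed
  moreover have "\<theta> (gact p u) = act (\<theta> p) u" if "p \<in> carrier (gring G)" "u \<in> carrier P" for p u
  proof -
    have "(\<theta> \<circ> (\<lambda>p. gact p u)) p = ((\<lambda>n. act n u) \<circ> \<theta>) p"
    proof (rule gring_hom_ext[OF D(1) Group.hom_compose[OF crossed_act_hom[OF crossed that(2)] \<theta>]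
          Group.hom_compose[OF \<theta> crossed_act_hom[OF N that(2)]] _ that(1)])
      fix g assume "g \<in> carrier G"
      then show "(\<theta> \<circ> (\<lambda>p. gact p u)) (Poly_Mapping.single g 1) = ((\<lambda>n. act n u) \<circ> \<theta>) (Poly_Mapping.single g 1)"
        using that(2) by (elim powE P.powE) (simp add: \<theta>s gact_def cact int_pow_mult[symmetric])
    qed
    then show ?thesis by simp
  qed
  moreover have "\<theta> e = y" using \<theta>s[of 0] c0 by simp
  ultimately show ?thesis using \<theta> by (auto simp: crossed_module_hom_def)
qed

text \<open>Every \<open>single g 1\<close> is the translate of \<open>e\<close> by
  \<open>z^(idx g)\<close>, so equivariance propagates agreement from \<open>e\<close> to a
  generating set.\<close>

lemma free_uniqueness:
  fixes N :: "'n monoid"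
  assumes N: "crossed_module N P \<nu> act"
    and \<theta>: "\<theta>1 \<in> crossed_module_hom P (gring G) mu gact N \<nu> act"
      "\<theta>2 \<in> crossed_module_hom P (gring G) mu gact N \<nu> act"
    and eq: "\<theta>1 e = \<theta>2 e" and p: "p \<in> carrier (gring G)"
  shows "\<theta>1 p = \<theta>2 p"
proof (rule gring_hom_ext[OF crossed_moduleD(1)[OF N] _ _ _ p])
  show "\<theta>1 \<in> hom (gring G) N" "\<theta>2 \<in> hom (gring G) N"
    using \<theta> by (simp_all add: crossed_module_hom_def)
  fix g assume "g \<in> carrier G"
  then have "Poly_Mapping.single g (1 :: int) = gact e (z [^]\<^bsub>P\<^esub> idx g)" by (simp add: gact_def)
  then show "\<theta>1 (Poly_Mapping.single g 1) = \<theta>2 (Poly_Mapping.single g 1)"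
    using \<theta> eq by (simp add: crossed_module_hom_def)
qed

lemma gring_free_crossed: "free_crossed_module_on (gring G) P mu gact {e}"
  unfolding free_crossed_module_on_def
proof (intro conjI allI impI)
  fix N :: "(bool \<times> ('g \<Rightarrow>\<^sub>0 int) \<times> 'p) list monoid" and \<nu> act f
  assume "crossed_module N P \<nu> act \<and> f \<in> {e} \<rightarrow> carrier N \<and> (\<forall>x\<in>{e}. \<nu> (f x) = mu x)"
  then have N: "crossed_module N P \<nu> act" and f: "f e \<in> carrier N" "\<nu> (f e) = z [^]\<^bsub>P\<^esub> int r"
    by (auto simp: mu_def)
  obtain \<theta> where \<theta>: "\<theta> \<in> crossed_module_hom P (gring G) mu gact N \<nu> act" "\<theta> e = f e"
    using free_existence[OF N f] by blast
  show "\<exists>!\<theta>. \<theta> \<in> extensional (carrier (gring G)) \<and>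
      \<theta> \<in> crossed_module_hom P (gring G) mu gact N \<nu> act \<and> (\<forall>x\<in>{e}. \<theta> x = f x)"
  \<comment> \<open>Restriction makes the map extensional, as the uniqueness clause compares
    extensional functions only.\<close>
  proof (rule ex1I[of _ "restrict \<theta> (carrier (gring G))"])
    have "restrict \<theta> (carrier (gring G)) \<in> crossed_module_hom P (gring G) mu gact N \<nu> act"
      using \<theta>(1) crossed_moduleD(4)[OF crossed] by (auto simp: crossed_module_hom_def hom_def Pi_iff)
    then show "restrict \<theta> (carrier (gring G)) \<in> extensional (carrier (gring G)) \<and>
      restrict \<theta> (carrier (gring G)) \<in> crossed_module_hom P (gring G) mu gact N \<nu> act \<and>
      (\<forall>x\<in>{e}. restrict \<theta> (carrier (gring G)) x = f x)"
      using \<theta>(2) by simp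
    fix \<theta>' assume \<theta>': "\<theta>' \<in> extensional (carrier (gring G)) \<and>
      \<theta>' \<in> crossed_module_hom P (gring G) mu gact N \<nu> act \<and> (\<forall>x\<in>{e}. \<theta>' x = f x)"
    show "\<theta>' = restrict \<theta> (carrier (gring G))"
      by (rule extensionalityI[of _ "carrier (gring G)"])
        (use \<theta>' \<theta> free_uniqueness[OF N, of \<theta>' \<theta>] in auto)
  qed
qed (use crossed in auto)

text \<open>\<open>M\<close> and the group ring are both free on one generator over
  \<open>z^r\<close>. The comparison maps \<open>\<sigma>\<close> and \<open>\<theta>\<close> are
  mutually inverse, one composite being the identity by \<open>free_uniqueness\<close>, the other by
  the universal property of \<open>M\<close>. Commutativity and the basis of translates are carried
  over along this isomorphism.\<close>

lemma free_crossed_basis: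
  assumes M: "free_crossed_module_on M P \<mu> act {x}" and \<mu>x: "\<mu> x = z [^]\<^bsub>P\<^esub> int r"
  shows "G_basis G M (\<lambda>g. act x (z [^]\<^bsub>P\<^esub> idx g))"
proof -
  have cM: "crossed_module M P \<mu> act" and x: "x \<in> carrier M"
    using M by (auto simp: free_crossed_module_on_def)
  note D = crossed_moduleD[OF cM]
  interpret M: group M by (rule D(1))
  obtain \<sigma> where \<sigma>: "\<sigma> \<in> crossed_module_hom P (gring G) mu gact M \<mu> act" "\<sigma> e = x"
    using free_existence[OF cM x \<mu>x] by blast
  have "(\<lambda>_. e) \<in> {x} \<rightarrow> carrier (gring G)" "\<forall>y\<in>{x}. mu e = \<mu> y" by (simp_all add: mu_def \<mu>x)
  from ex1_implies_ex[OF free_crossed_module_on_universal[OF M crossed this]]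
  obtain \<theta> where \<theta>: "\<theta> \<in> crossed_module_hom P M \<mu> act (gring G) mu gact" "\<theta> x = e" by auto
  have \<theta>\<sigma>: "\<theta> (\<sigma> p) = p" if "p \<in> carrier (gring G)" for p
  proof -
    have "(\<theta> \<circ> \<sigma>) p = id p"
      by (rule free_uniqueness[OF crossed crossed_hom_compose[OF \<sigma>(1) \<theta>(1)] _ _ that])
        (simp_all add: crossed_module_hom_def \<sigma> \<theta> hom_def)
    then show ?thesis by simp
  qed
  have \<sigma>\<theta>: "\<sigma> (\<theta> m) = m" if "m \<in> carrier M" for m
  proof -
    have "\<exists>!\<eta>. \<eta> \<in> extensional (carrier M) \<and>
        \<eta> \<in> crossed_module_hom P M \<mu> act M \<mu> act \<and> (\<forall>y\<in>{x}. \<eta> y = id y)"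
      by (rule free_crossed_module_on_universal[OF M cM]) (use x in auto)
    moreover have "restrict (\<sigma> \<circ> \<theta>) (carrier M) \<in> crossed_module_hom P M \<mu> act M \<mu> act"
      using crossed_hom_compose[OF \<theta>(1) \<sigma>(1)] D(4)
      by (auto simp: crossed_module_hom_def hom_def Pi_iff)
    moreover have "restrict id (carrier M) \<in> crossed_module_hom P M \<mu> act M \<mu> act"
      using D(4) by (auto simp: crossed_module_hom_def hom_def)
    moreover have "restrict (\<sigma> \<circ> \<theta>) (carrier M) x = id x" "restrict id (carrier M) x = id x"
      using x \<sigma>(2) \<theta>(2) by simp_all
    ultimately have "restrict (\<sigma> \<circ> \<theta>) (carrier M) = restrict id (carrier M)"
      by (blast intro: restrict_extensional)
    then show ?thesis using that by (metis comp_apply id_apply restrict_apply')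
  qed
  have \<sigma>h: "\<sigma> \<in> hom (gring G) M" and \<theta>h: "\<theta> \<in> hom M (gring G)"
    using \<sigma> \<theta> by (simp_all add: crossed_module_hom_def)
  have Mc: "comm_group M"
  proof (rule M.group_comm_groupI)
    fix m n assume mn: "m \<in> carrier M" "n \<in> carrier M"
    then have "\<theta> (m \<otimes>\<^bsub>M\<^esub> n) = \<theta> (n \<otimes>\<^bsub>M\<^esub> m)"
      using hom_mult[OF \<theta>h] by (simp add: add.commute)
    then show "m \<otimes>\<^bsub>M\<^esub> n = n \<otimes>\<^bsub>M\<^esub> m" using \<sigma>\<theta> mn by (metis M.m_closed)
  qed
  have b: "act x (z [^]\<^bsub>P\<^esub> idx g) \<in> carrier M" for g using D(4) x by simp
  have \<sigma>_lin: "\<sigma> p = lin G M (\<lambda>g. act x (z [^]\<^bsub>P\<^esub> idx g)) p" if "p \<in> carrier (gring G)" for p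
  proof (rule gring_hom_ext[OF D(1) \<sigma>h lin_hom[OF Mc b] _ that])
    fix g assume g: "g \<in> carrier G"
    then have "Poly_Mapping.single g (1 :: int) = gact e (z [^]\<^bsub>P\<^esub> idx g)" by (simp add: gact_def)
    then have "\<sigma> (Poly_Mapping.single g 1) = act x (z [^]\<^bsub>P\<^esub> idx g)"
      using \<sigma> by (simp add: crossed_module_hom_def)
    then show "\<sigma> (Poly_Mapping.single g 1) = lin G M (\<lambda>g. act x (z [^]\<^bsub>P\<^esub> idx g)) (Poly_Mapping.single g 1)"
      using lin_single[OF Mc fin b g] by simp
  qed
  have "bij_betw \<sigma> (carrier (gring G)) (carrier M)"
    by (rule bij_betw_byWitness[of _ \<theta>]) (use \<sigma>\<theta> \<theta>\<sigma> \<sigma>h \<theta>h in \<open>auto simp: hom_def\<close>)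
  then have "bij_betw (lin G M (\<lambda>g. act x (z [^]\<^bsub>P\<^esub> idx g))) (carrier (gring G)) (carrier M)"
    using \<sigma>_lin by (subst bij_betw_cong[of _ _ \<sigma>]) auto
  then show ?thesis using Mc b by (simp add: G_basis_def)
qed

end

section \<open>The contracting homotopy\<close>

declare One_nat_def [simp del]

lemma G_basis_cong:
  assumes "G_basis G M b" "\<And>g. g \<in> carrier G \<Longrightarrow> b' g = b g"
  shows "G_basis G M b'"
proof -
  interpret comm_group M using assms(1) by (simp add: G_basis_def)
  have "lin G M b' = lin G M b"
    unfolding lin_def using assms by (intro ext finprod_cong') (auto simp: G_basis_def)
  then show ?thesis using assms by (simp add: G_basis_def)
qed

lemma norm_elt_0 [simp]: "norm_elt G t 0 = 0"
  by (simp add: norm_elt_def)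

lemma norm_elt_Suc: "norm_elt G t (Suc m) = norm_elt G t m + Poly_Mapping.single (t [^]\<^bsub>G\<^esub> m) 1"
  by (simp add: norm_elt_def)

lemma (in finite_cyclic) norm_elt_closed [simp]: "norm_elt G t m \<in> carrier (gring G)"
  by (induction m) (simp_all add: norm_elt_Suc)

locale cyclic_crossed_resolution = finite_cyclic G t r
  for G :: "'g monoid" (structure) and t r +
  fixes F :: "('g, 'a) crossed_data" and x :: "nat \<Rightarrow> 'a"
  assumes res: "cyclic_resolution G t r F x"
begin

abbreviation "P \<equiv> grp F 1"
abbreviation "z \<equiv> x 1"

lemma fcr: "free_crossed_resolution G F (\<lambda>n. {x n})"
  using res by (simp add: cyclic_resolution_def)

sublocale pres: cyclic_presentation G t r P z "phi F"
proof -
  interpret P: infinite_cyclic P z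
    by (rule infinite_cyclic_of_free) (use fcr in \<open>simp add: free_crossed_resolution_def\<close>)
  show "cyclic_presentation G t r P z (phi F)"
    by unfold_locales (use res in \<open>auto simp: cyclic_resolution_def free_crossed_resolution_def epi_def\<close>)
qed

lemma crossed2: "crossed_module (grp F 2) P (bd F 2) (cact F)"
  using fcr by (simp add: free_crossed_resolution_def free_crossed_module_on_def)

lemma modn: "3 \<le> n \<Longrightarrow> free_G_module_on G (grp F n) (mact F n) {x n}"
  using fcr by (simp add: free_crossed_resolution_def)

lemma x_closed [simp]: "1 \<le> n \<Longrightarrow> x n \<in> carrier (grp F n)"
proof -
  assume "1 \<le> n"
  then consider "n = 1" | "n = 2" | "3 \<le> n" by linarith
  then show ?thesis
    using fcr modn[of n] by cases
      (auto simp: free_crossed_resolution_def free_crossed_module_on_def free_G_module_on_def)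
qed

section \<open>The translates of the generators as additive bases\<close>

lemma right_action_act1:
  assumes "2 \<le> n" shows "right_action (grp F n) P (act1 F n)"
proof (cases "n = 2")
  case True
  then show ?thesis using crossed2 by (simp add: crossed_module_def right_action_def act1_def)
next
  case False
  then have "right_action (grp F n) G (mact F n)"
    using modn[of n] assms by (simp add: free_G_module_on_def G_module_def)
  then show ?thesis using False by (simp add: right_action_def act1_def)
qed

lemma act1_closed [simp]:
  "2 \<le> n \<Longrightarrow> c \<in> carrier (grp F n) \<Longrightarrow> u \<in> carrier P \<Longrightarrow> act1 F n c u \<in> carrier (grp F n)"
  using right_action_act1 by (simp add: right_action_def)

lemma act1_hom: "2 \<le> n \<Longrightarrow> u \<in> carrier P \<Longrightarrow> (\<lambda>c. act1 F n c u) \<in> hom (grp F n) (grp F n)"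
  using right_action_act1[of n] by (auto simp: hom_def right_action_def)

lemma act1_act1:
  "2 \<le> n \<Longrightarrow> c \<in> carrier (grp F n) \<Longrightarrow> u \<in> carrier P \<Longrightarrow> v \<in> carrier P \<Longrightarrow>
    act1 F n (act1 F n c u) v = act1 F n c (u \<otimes>\<^bsub>P\<^esub> v)"
  using right_action_act1[of n] by (simp add: right_action_def)

lemma act1_one: "2 \<le> n \<Longrightarrow> c \<in> carrier (grp F n) \<Longrightarrow> act1 F n c \<one>\<^bsub>P\<^esub> = c"
  using right_action_act1[of n] by (simp add: right_action_def)

text \<open>The translate of \<open>x n\<close> by \<open>g\<close>, formed with the lift
  \<open>z^(idx g)\<close> of \<open>g\<close> because dimension 2 carries only an action of
  \<open>P\<close>. That the choice of lift does not matter is \<open>act1_phi\<close>.\<close>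

definition bas :: "nat \<Rightarrow> 'g \<Rightarrow> 'a" where
  "bas n g = act1 F n (x n) (z [^]\<^bsub>P\<^esub> idx g)"

lemma bd_x2: "bd F 2 (x 2) = z [^]\<^bsub>P\<^esub> int r"
  using res by (simp add: cyclic_resolution_def int_pow_int)

lemma basis:
  assumes "2 \<le> n" shows "G_basis G (grp F n) (bas n)"
proof (cases "n = 2")
  case True
  have "G_basis G (grp F 2) (\<lambda>g. cact F (x 2) (z [^]\<^bsub>P\<^esub> idx g))"
    by (rule pres.free_crossed_basis[where \<mu> = "bd F 2" and x = "x 2", OF _ bd_x2])
      (use fcr in \<open>simp add: free_crossed_resolution_def\<close>)
  then show ?thesis unfolding True by (rule G_basis_cong) (simp add: bas_def act1_def)
next
  case False
  then have "G_basis G (grp F n) (mact F n (x n))" using free_module_basis[OF modn fin] assms by simp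
  then show ?thesis by (rule G_basis_cong) (use False in \<open>simp add: bas_def act1_def\<close>)
qed

lemma comm_group_grp: "2 \<le> n \<Longrightarrow> comm_group (grp F n)"
  using basis by (simp add: G_basis_def)

lemma group_grp: "1 \<le> n \<Longrightarrow> group (grp F n)"
  using comm_group_grp[of n] pres.P.is_group by (cases "n = 1") (auto simp: comm_group_def)

lemma bas_closed [simp]: "2 \<le> n \<Longrightarrow> bas n g \<in> carrier (grp F n)"
  by (simp add: bas_def)

lemma bas_one: "2 \<le> n \<Longrightarrow> bas n \<one> = x n"
  using idx_pow[of 0] by (simp add: bas_def act1_one)

lemma lin_bas_hom: "2 \<le> n \<Longrightarrow> lin G (grp F n) (bas n) \<in> hom (gring G) (grp F n)"
  by (rule lin_hom[OF comm_group_grp]) simp_all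

lemma lin_bas_single [simp]:
  "2 \<le> n \<Longrightarrow> g \<in> carrier G \<Longrightarrow> lin G (grp F n) (bas n) (Poly_Mapping.single g 1) = bas n g"
  by (rule lin_single[OF comm_group_grp fin]) simp_all

text \<open>In dimension 2, two lifts differ by an element of the kernel of \<open>phi F\<close>,
  which is a boundary by exactness. By the Peiffer identity a boundary acts by conjugation, which is
  trivial because \<open>grp F 2\<close> is commutative.\<close>

lemma act1_phi:
  assumes n: "2 \<le> n" and c: "c \<in> carrier (grp F n)" and uv: "u \<in> carrier P" "v \<in> carrier P"
    and eq: "phi F u = phi F v"
  shows "act1 F n c u = act1 F n c v"
proof (cases "n = 2")
  case False
  then show ?thesis by (simp add: act1_def eq)
next
  case n2: True
  interpret M: comm_group "grp F 2" by (rule comm_group_grp) simp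
  have c2: "c \<in> carrier (grp F 2)" using c n2 by simp
  define k where "k = inv\<^bsub>P\<^esub> v \<otimes>\<^bsub>P\<^esub> u"
  have "phi F k = \<one>" using uv eq by (simp add: k_def)
  then have "k \<in> kernel P G (phi F)" using uv by (simp add: kernel_def k_def)
  moreover have "kernel P G (phi F) = bd F 2 ` carrier (grp F 2)"
    using fcr by (simp add: free_crossed_resolution_def)
  ultimately obtain d where d: "d \<in> carrier (grp F 2)" "k = bd F 2 d" by blast
  let ?w = "act1 F 2 c v"
  have w: "?w \<in> carrier (grp F 2)" using c2 uv by simp
  have "act1 F 2 ?w k = inv\<^bsub>grp F 2\<^esub> d \<otimes>\<^bsub>grp F 2\<^esub> ?w \<otimes>\<^bsub>grp F 2\<^esub> d"
    using crossed_moduleD(9)[OF crossed2 w d(1)] d(2) by (simp add: act1_def)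
  also have "\<dots> = ?w" using d w by (simp add: M.m_comm[of "inv\<^bsub>grp F 2\<^esub> d" ?w] M.m_assoc)
  finally have "act1 F 2 c (v \<otimes>\<^bsub>P\<^esub> k) = ?w" using act1_act1[of 2 c v k] c2 uv by (simp add: k_def)
  moreover have "v \<otimes>\<^bsub>P\<^esub> k = u" using uv by (simp add: k_def pres.P.m_assoc[symmetric])
  ultimately show ?thesis by (simp add: n2)
qed

text \<open>\<open>z^(idx g)\<close> times \<open>u\<close> and the lift chosen for
  \<open>g \<otimes> phi F u\<close> have the same image in \<open>G\<close>.\<close>

lemma act1_bas:
  assumes "2 \<le> n" "g \<in> carrier G" "u \<in> carrier P"
  shows "act1 F n (bas n g) u = bas n (g \<otimes> phi F u)"
proof -
  have "act1 F n (bas n g) u = act1 F n (x n) (z [^]\<^bsub>P\<^esub> idx g \<otimes>\<^bsub>P\<^esub> u)"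
    using assms by (simp add: bas_def act1_act1)
  also have "\<dots> = bas n (g \<otimes> phi F u)"
    unfolding bas_def by (rule act1_phi) (use assms in simp_all)
  finally show ?thesis .
qed

section \<open>Boundary maps in terms of the translates\<close>

lemma bd_hom: "3 \<le> n \<Longrightarrow> bd F n \<in> hom (grp F n) (grp F (n - 1))"
  using fcr by (simp add: free_crossed_resolution_def)

lemma bd_act:
  "3 \<le> n \<Longrightarrow> c \<in> carrier (grp F n) \<Longrightarrow> u \<in> carrier P \<Longrightarrow>
    bd F n (act1 F n c u) = act1 F (n - 1) (bd F n c) u"
  using fcr by (simp add: free_crossed_resolution_def)

text \<open>The boundary is conjugated by \<open>u\<close>, which changes nothing in the commutative
  group \<open>P\<close>.\<close>

lemma bd2_act:
  assumes "c \<in> carrier (grp F 2)" "u \<in> carrier P"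
  shows "bd F 2 (act1 F 2 c u) = bd F 2 c"
proof -
  interpret P: comm_group P by (rule pres.P.comm)
  have "bd F 2 c \<in> carrier P"
    using crossed_moduleD(3)[OF crossed2] assms(1) by (auto simp: hom_def)
  then have "inv\<^bsub>P\<^esub> u \<otimes>\<^bsub>P\<^esub> bd F 2 c \<otimes>\<^bsub>P\<^esub> u = bd F 2 c"
    using assms(2) by (simp add: P.m_comm[of "inv\<^bsub>P\<^esub> u"] pres.P.m_assoc)
  then show ?thesis using crossed_moduleD(8)[OF crossed2 assms] by (simp add: act1_def)
qed

text \<open>A boundary lies in the kernel of \<open>phi F\<close>, and \<open>t^k\<close> is trivial
  only when \<open>r\<close> divides \<open>k\<close>.\<close>

lemma bd2_pow:
  assumes "c \<in> carrier (grp F 2)"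
  obtains m :: int where "bd F 2 c = z [^]\<^bsub>P\<^esub> (int r * m)"
proof -
  have "bd F 2 c \<in> kernel P G (phi F)"
    using fcr assms by (auto simp: free_crossed_resolution_def)
  then have c: "bd F 2 c \<in> carrier P" "phi F (bd F 2 c) = \<one>" by (auto simp: kernel_def)
  obtain k :: int where k: "bd F 2 c = z [^]\<^bsub>P\<^esub> k" using c(1) by (rule pres.P.powE)
  then have "t [^] k = t [^] (0 :: int)" using c(2) by simp
  then have "int r dvd k" by (simp only: pow_eq_iff) (simp add: dvd_eq_mod_eq_0)
  then show ?thesis using that k by (elim dvdE) simp
qed

lemma dot_eq_lin:
  assumes "3 \<le> n" "p \<in> carrier (gring G)"
  shows "dot F n (x n) p = lin G (grp F n) (bas n) p"
proof -
  interpret M: comm_group "grp F n" by (rule comm_group_grp) (use assms in simp)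
  have b: "mact F n (x n) g = bas n g" if "g \<in> carrier G" for g
    using that assms by (simp add: bas_def act1_def)
  then have "mact F n (x n) g \<in> carrier (grp F n)" if "g \<in> carrier G" for g
    using that assms by simp
  then have "dot F n (x n) p = lin G (grp F n) (mact F n (x n)) p"
    using ring_act_eq_lin[of "grp F n" G "mact F n" "x n" p] M.comm_group_axioms assms(2) by simp
  also have "\<dots> = lin G (grp F n) (bas n) p"
    unfolding lin_def using assms by (intro M.finprod_cong') (auto simp: b)
  finally show ?thesis .
qed

text \<open>Brings the multiplicative formula for dimension 3 and the group ring formula for higher
  odd dimensions to one shape, indexed by the target dimension.\<close>

lemma bd_x_odd:
  assumes "2 \<le> n" "even n"
  shows "bd F (n + 1) (x (n + 1)) = bas n t \<otimes>\<^bsub>grp F n\<^esub> inv\<^bsub>grp F n\<^esub> (x n)"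
proof (cases "n = 2")
  case True
  \<comment> \<open>The lift of \<open>t\<close> used in \<open>bas\<close> is
    \<open>z^(1 mod r)\<close>, which differs from \<open>z\<close> when \<open>r = 1\<close>; both
    lifts act alike.\<close>
  have "bas 2 t = cact F (x 2) (x 1)"
    unfolding bas_def using act1_phi[of 2 "x 2" "z [^]\<^bsub>P\<^esub> idx t" z]
    by (simp add: act1_def pres.\<phi>_z)
  moreover have "bd F 3 (x 3) = cact F (x 2) (x 1) \<otimes>\<^bsub>grp F 2\<^esub> inv\<^bsub>grp F 2\<^esub> (x 2)"
    using res by (simp add: cyclic_resolution_def)
  ultimately show ?thesis by (simp add: True)
next
  case False
  then have n: "4 \<le> n" using assms by presburger
  let ?L = "lin G (grp F n) (bas n)"
  interpret L: group_hom "gring G" "grp F n" ?L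
    using group_grp[of n] lin_bas_hom[of n] assms gring.is_group
    by (simp add: group_hom_def group_hom_axioms_def)
  have "bd F (n + 1) (x (n + 1)) = dot F n (x n) (Poly_Mapping.single t 1 - Poly_Mapping.single \<one> 1)"
    using res assms n by (auto simp: cyclic_resolution_def)
  also have "\<dots> = ?L (Poly_Mapping.single t 1 - Poly_Mapping.single \<one> 1)"
    using n by (simp add: dot_eq_lin)
  also have "\<dots> = ?L (Poly_Mapping.single t 1 \<otimes>\<^bsub>gring G\<^esub> inv\<^bsub>gring G\<^esub> (Poly_Mapping.single \<one> 1))"
    by simp
  also have "\<dots> = bas n t \<otimes>\<^bsub>grp F n\<^esub> inv\<^bsub>grp F n\<^esub> (bas n \<one>)"
    using assms by (simp only: L.hom_mult L.hom_inv gring.inv_closed gring_closed one_closed t_closed lin_bas_single)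
  finally show ?thesis using assms by (simp add: bas_one)
qed

lemma bd_x_even:
  assumes "3 \<le> n" "odd n"
  shows "bd F (n + 1) (x (n + 1)) = lin G (grp F n) (bas n) (norm_elt G t r)"
proof -
  have "bd F (n + 1) (x (n + 1)) = dot F n (x n) (norm_elt G t r)"
    using res assms by (simp add: cyclic_resolution_def)
  then show ?thesis using assms by (simp add: dot_eq_lin)
qed

lemma bd_bas:
  assumes n: "2 \<le> n" "even n" and g: "g \<in> carrier G"
  shows "bd F (n + 1) (bas (n + 1) g) = bas n (t \<otimes> g) \<otimes>\<^bsub>grp F n\<^esub> inv\<^bsub>grp F n\<^esub> (bas n g)"
proof -
  let ?u = "z [^]\<^bsub>P\<^esub> idx g"
  interpret a: group_hom "grp F n" "grp F n" "\<lambda>c. act1 F n c ?u"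
    using group_grp[of n] act1_hom[of n ?u] n by (simp add: group_hom_def group_hom_axioms_def)
  have "bd F (n + 1) (bas (n + 1) g) = act1 F n (bas n t \<otimes>\<^bsub>grp F n\<^esub> inv\<^bsub>grp F n\<^esub> (bas n \<one>)) ?u"
    unfolding bas_def[of "n + 1"] using n by (simp add: bd_act bd_x_odd bas_one)
  also have "\<dots> = bas n (t \<otimes> g) \<otimes>\<^bsub>grp F n\<^esub> inv\<^bsub>grp F n\<^esub> (bas n g)"
    using n g by (simp add: act1_bas)
  finally show ?thesis .
qed

lemma lin_bas_norm_Suc:
  assumes "2 \<le> n"
  shows "lin G (grp F n) (bas n) (norm_elt G t (Suc m)) =
    lin G (grp F n) (bas n) (norm_elt G t m) \<otimes>\<^bsub>grp F n\<^esub> bas n (t [^] int m)"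
  using hom_mult[OF lin_bas_hom[OF assms], of "norm_elt G t m" "Poly_Mapping.single (t [^] m) 1"] assms
  by (simp add: norm_elt_Suc int_pow_int)

lemma lin_bas_closed [simp]: "2 \<le> n \<Longrightarrow> p \<in> carrier (gring G) \<Longrightarrow> lin G (grp F n) (bas n) p \<in> carrier (grp F n)"
  using lin_bas_hom[of n] by (auto simp: hom_def)

lemma lin_bas_norm_0: "2 \<le> n \<Longrightarrow> lin G (grp F n) (bas n) 0 = \<one>\<^bsub>grp F n\<^esub>"
  using hom_one[OF lin_bas_hom gring.is_group group_grp, of n] by simp

text \<open>This is the telescoping identity \<open>(t - 1) N(m) = t\<^sup>m - 1\<close>.\<close>

lemma bd_norm:
  assumes n: "2 \<le> n" "even n"
  shows "bd F (n + 1) (lin G (grp F (n + 1)) (bas (n + 1)) (norm_elt G t m)) =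
    bas n (t [^] int m) \<otimes>\<^bsub>grp F n\<^esub> inv\<^bsub>grp F n\<^esub> (x n)"
proof -
  interpret M: comm_group "grp F n" by (rule comm_group_grp[OF n(1)])
  have h: "bd F (n + 1) \<in> hom (grp F (n + 1)) (grp F n)" using bd_hom[of "n + 1"] n by simp
  show ?thesis
  proof (induction m)
    case 0
    have "bd F (n + 1) \<one>\<^bsub>grp F (n + 1)\<^esub> = \<one>\<^bsub>grp F n\<^esub>"
      by (rule hom_one[OF h group_grp M.is_group]) simp
    then show ?case using n by (simp add: lin_bas_norm_0 bas_one)
  next
    case (Suc m)
    have "t \<otimes> t [^] int m = t [^] (1 + int m)"
      using int_pow_mult[OF t_closed, of 1 "int m"] by simp
    then have "t \<otimes> t [^] int m = t [^] int (Suc m)" by simp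
    \<comment> \<open>The telescoping cancellation, with \<open>a\<close> the translate by
      \<open>t^m\<close>, \<open>b = x n\<close>, and \<open>c\<close> the translate by
      \<open>t^(m+1)\<close>.\<close>
    moreover have "a \<otimes>\<^bsub>grp F n\<^esub> inv\<^bsub>grp F n\<^esub> b \<otimes>\<^bsub>grp F n\<^esub> (c \<otimes>\<^bsub>grp F n\<^esub> inv\<^bsub>grp F n\<^esub> a) = c \<otimes>\<^bsub>grp F n\<^esub> inv\<^bsub>grp F n\<^esub> b"
      if "a \<in> carrier (grp F n)" "b \<in> carrier (grp F n)" "c \<in> carrier (grp F n)" for a b c
      using that by (smt (verit) M.inv_closed M.m_assoc M.m_closed M.m_comm M.r_inv M.r_one)
    ultimately show ?case
      using n hom_mult[OF h, of "lin G (grp F (n + 1)) (bas (n + 1)) (norm_elt G t m)" "bas (n + 1) (t [^] int m)"] Suc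
      by (simp add: lin_bas_norm_Suc bd_bas)
  qed
qed

section \<open>Construction of the homotopy on labels\<close>

text \<open>The exponent \<open>(- i) mod r\<close> is \<open>r - i\<close> for \<open>0 < i < r\<close>, and \<open>0\<close> for \<open>i = 0\<close>.\<close>

definition val :: "nat \<Rightarrow> 'g \<Rightarrow> 'a" where
  "val n g =
     (if even n then lin G (grp F (n + 1)) (bas (n + 1)) (norm_elt G t (nat ((- idx g) mod int r)))
      else if g = t then x (n + 1) else \<one>\<^bsub>grp F (n + 1)\<^esub>)"

text \<open>Second component of \<open>h_n\<close> on the fibre over \<open>g\<close>. In dimension
  1 it counts the multiples of \<open>r\<close> passed on the way from \<open>idx g\<close> to
  \<open>idx g + k\<close>. For \<open>n \<ge> 2\<close> the choice is justified in
  \<open>lbl_spec\<close> by the basis of translates.\<close>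

definition lbl :: "nat \<Rightarrow> 'g \<Rightarrow> 'a \<Rightarrow> 'a" where
  "lbl n g =
     (if n = 1 then \<lambda>u. x 2 [^]\<^bsub>grp F 2\<^esub> ((idx g + dlog P z u) div int r)
      else SOME h. h \<in> hom (grp F n) (grp F (n + 1)) \<and> (\<forall>g'\<in>carrier G. h (bas n g') = val n (g \<otimes> inv g')))"

lemma val_closed [simp]: "2 \<le> n \<Longrightarrow> val n g \<in> carrier (grp F (n + 1))"
  using group.is_monoid[OF group_grp[of "n + 1"]] by (auto simp: val_def intro: monoid.one_closed)

lemma lbl_spec:
  assumes n: "2 \<le> n" and g: "g \<in> carrier G"
  shows "lbl n g \<in> hom (grp F n) (grp F (n + 1))"
    and "g' \<in> carrier G \<Longrightarrow> lbl n g (bas n g') = val n (g \<otimes> inv g')"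
proof -
  let ?Q = "\<lambda>h. h \<in> hom (grp F n) (grp F (n + 1)) \<and> (\<forall>g'\<in>carrier G. h (bas n g') = val n (g \<otimes> inv g'))"
  have "\<exists>h\<in>hom (grp F n) (grp F (n + 1)). \<forall>g'\<in>carrier G. h (bas n g') = val n (g \<otimes> inv g')"
    by (rule basis_hom_exists[OF basis[OF n] fin comm_group_grp]) (use n in simp_all)
  then have "?Q (SOME h. ?Q h)" by (intro someI_ex[of ?Q]) blast
  moreover have "lbl n g = (SOME h. ?Q h)" using n by (simp add: lbl_def)
  ultimately show "lbl n g \<in> hom (grp F n) (grp F (n + 1))"
    and "g' \<in> carrier G \<Longrightarrow> lbl n g (bas n g') = val n (g \<otimes> inv g')" by simp_all
qed

lemma lbl_closed [simp]:
  "2 \<le> n \<Longrightarrow> g \<in> carrier G \<Longrightarrow> c \<in> carrier (grp F n) \<Longrightarrow> lbl n g c \<in> carrier (grp F (n + 1))"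
  using lbl_spec(1)[of n g] by (auto simp: hom_def)

text \<open>On the basis element at \<open>g'\<close>, both sides are \<open>val n\<close> at the
  same point, since \<open>phi F u\<close> cancels in
  \<open>g \<otimes> phi F u \<otimes> inv (g' \<otimes> phi F u)\<close>.\<close>

lemma lbl_act:
  assumes n: "2 \<le> n" and g: "g \<in> carrier G" and c: "c \<in> carrier (grp F n)" and u: "u \<in> carrier P"
  shows "lbl n (g \<otimes> phi F u) (act1 F n c u) = lbl n g c"
proof -
  have gu: "g \<otimes> phi F u \<in> carrier G" using g u by simp
  have "(lbl n (g \<otimes> phi F u) \<circ> (\<lambda>c. act1 F n c u)) c = lbl n g c"
  proof (rule basis_hom_ext[OF basis[OF n] fin group_grp _ lbl_spec(1)[OF n g] _ c])
    show "lbl n (g \<otimes> phi F u) \<circ> (\<lambda>c. act1 F n c u) \<in> hom (grp F n) (grp F (n + 1))"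
      using Group.hom_compose[OF act1_hom[OF n u] lbl_spec(1)[OF n gu]] .
    fix g' assume g': "g' \<in> carrier G"
    have "g \<otimes> phi F u \<otimes> inv (g' \<otimes> phi F u) = g \<otimes> inv g'"
    proof -
      have "phi F u \<otimes> (inv (phi F u) \<otimes> inv g') = inv g'" using g' u by (simp add: m_assoc[symmetric])
      then show ?thesis using g g' u by (simp add: inv_mult_group m_assoc)
    qed
    then show "(lbl n (g \<otimes> phi F u) \<circ> (\<lambda>c. act1 F n c u)) (bas n g') = lbl n g (bas n g')"
      using g' gu g u n by (simp add: act1_bas lbl_spec)
  qed simp
  then show ?thesis by simp
qed

lemma lbl1_pow: "lbl 1 g (z [^]\<^bsub>P\<^esub> (k :: int)) = x 2 [^]\<^bsub>grp F 2\<^esub> ((idx g + k) div int r)"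
  by (simp add: lbl_def)

text \<open>Since \<open>0 \<le> idx g < r\<close>, the starting vertex does not affect the number
  of turns of a closed loop.\<close>

lemma lbl1_pow_mult: "lbl 1 g (z [^]\<^bsub>P\<^esub> (int r * m)) = x 2 [^]\<^bsub>grp F 2\<^esub> m"
  using r_pos by (simp add: lbl1_pow)

text \<open>Division with carry: for \<open>s = idx g + k\<close>, the quotient of
  \<open>s + l\<close> by \<open>r\<close> is that of \<open>s\<close> plus that of
  \<open>s mod r + l\<close>, and \<open>s mod r\<close> is the index of the intermediate
  vertex.\<close>

lemma lbl1_mult:
  assumes g: "g \<in> carrier G" and "u \<in> carrier P" "v \<in> carrier P"
  shows "lbl 1 g (u \<otimes>\<^bsub>P\<^esub> v) = lbl 1 g u \<otimes>\<^bsub>grp F 2\<^esub> lbl 1 (g \<otimes> phi F u) v"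
proof -
  interpret M: group "grp F 2" by (rule group_grp) simp
  obtain j where j: "g = t [^] (j :: int)" using g by (rule powE)
  obtain k l where kl: "u = z [^]\<^bsub>P\<^esub> (k :: int)" "v = z [^]\<^bsub>P\<^esub> (l :: int)"
    using assms by (elim pres.P.powE)
  let ?s = "j mod int r + k"
  have "?s + l = (?s mod int r + l) + ?s div int r * int r" by simp
  then have "(?s + l) div int r = ?s div int r + (?s mod int r + l) div int r"
    using r_pos by (metis add.commute div_mult_self1 int_ops(1) less_irrefl of_nat_eq_iff)
  moreover have "idx (g \<otimes> phi F u) = ?s mod int r"
    by (simp add: j kl int_pow_mult[symmetric] mod_simps)
  ultimately show ?thesis
    by (simp add: kl j lbl1_pow pres.P.int_pow_mult[symmetric] M.int_pow_mult[symmetric] add.assoc)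
qed

lemma lbl1_closed [simp]: "lbl 1 g u \<in> carrier (grp F 2)"
proof -
  interpret M: group "grp F 2" by (rule group_grp) simp
  show ?thesis by (simp add: lbl_def)
qed

section \<open>The homotopy identity on labels\<close>

lemma bd_lbl1:
  assumes "u \<in> carrier P"
  shows "bd F 2 (lbl 1 g u) = z [^]\<^bsub>P\<^esub> (int r * ((idx g + dlog P z u) div int r))"
proof -
  have "bd F 2 (lbl 1 g u) = (z [^]\<^bsub>P\<^esub> int r) [^]\<^bsub>P\<^esub> ((idx g + dlog P z u) div int r)"
    using hom_int_pow[OF crossed_moduleD(3)[OF crossed2] _ group_grp pres.P.is_group, of "x 2"]
    by (simp add: lbl_def bd_x2)
  then show ?thesis by (simp add: pres.P.int_pow_pow)
qed

text \<open>The case \<open>n = 2\<close> needs care: \<open>lbl 1 g\<close> is in general no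
  homomorphism on \<open>P\<close>, but boundaries are powers of \<open>z^r\<close>, and on these it
  is additive.\<close>

lemma lbl_bd_hom:
  assumes n: "2 \<le> n" and g: "g \<in> carrier G"
  shows "(\<lambda>c. lbl (n - 1) g (bd F n c)) \<in> hom (grp F n) (grp F n)"
proof (cases "n = 2")
  case True
  interpret M: group "grp F 2" by (rule group_grp) simp
  show ?thesis unfolding True
  proof (rule homI)
    fix c d assume cd: "c \<in> carrier (grp F 2)" "d \<in> carrier (grp F 2)"
    obtain k l where "bd F 2 c = z [^]\<^bsub>P\<^esub> (int r * k)" "bd F 2 d = z [^]\<^bsub>P\<^esub> (int r * l)"
      using cd by (elim bd2_pow)
    moreover from this have "bd F 2 (c \<otimes>\<^bsub>grp F 2\<^esub> d) = z [^]\<^bsub>P\<^esub> (int r * (k + l))"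
      using hom_mult[OF crossed_moduleD(3)[OF crossed2] cd] by (simp add: pres.P.int_pow_mult distrib_left)
    ultimately show "lbl (2 - 1) g (bd F 2 (c \<otimes>\<^bsub>grp F 2\<^esub> d)) =
        lbl (2 - 1) g (bd F 2 c) \<otimes>\<^bsub>grp F 2\<^esub> lbl (2 - 1) g (bd F 2 d)"
      by (simp add: lbl1_pow_mult M.int_pow_mult One_nat_def[symmetric])
  qed (simp add: One_nat_def[symmetric])
next
  case False
  then show ?thesis
    using Group.hom_compose[OF bd_hom lbl_spec(1)[of "n - 1" g]] n g by (simp add: comp_def)
qed

text \<open>For \<open>n = 2\<close> the boundary does not change under the action and its label is
  independent of the base; above that, equivariance of the boundary reduces the claim to
  \<open>lbl_act\<close>.\<close>

lemma lbl_bd_act: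
  assumes n: "2 \<le> n" and g: "g \<in> carrier G" and c: "c \<in> carrier (grp F n)" and u: "u \<in> carrier P"
  shows "lbl (n - 1) (g \<otimes> phi F u) (bd F n (act1 F n c u)) = lbl (n - 1) g (bd F n c)"
proof (cases "n = 2")
  case True
  then have c2: "c \<in> carrier (grp F 2)" using c by simp
  then obtain m where "bd F 2 c = z [^]\<^bsub>P\<^esub> (int r * m)" by (rule bd2_pow)
  then show ?thesis using u c2 True by (simp add: bd2_act lbl1_pow_mult One_nat_def[symmetric])
next
  case False
  then have "bd F n c \<in> carrier (grp F (n - 1))" using bd_hom[of n] n c by (auto simp: hom_def)
  then show ?thesis using lbl_act[of "n - 1" g "bd F n c" u] False n g c u by (simp add: bd_act)
qed

text \<open>The telescoping identity \<open>bd_norm\<close> with exponent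
  \<open>(- idx g) mod r\<close>, for which the power of \<open>t\<close> is
  \<open>inv g\<close>.\<close>

lemma bd_val_even:
  assumes n: "2 \<le> n" "even n" and g: "g \<in> carrier G"
  shows "bd F (n + 1) (val n g) = inv\<^bsub>grp F n\<^esub> (x n) \<otimes>\<^bsub>grp F n\<^esub> bas n (inv g)"
proof -
  interpret M: comm_group "grp F n" by (rule comm_group_grp[OF n(1)])
  have "t [^] ((- idx g) mod int r) = inv g"
    using g int_pow_neg[OF t_closed, of "idx g"] pow_eq_iff[of "(- idx g) mod int r" "- idx g"] by simp
  then show ?thesis using n bd_norm[OF n] by (simp add: val_def M.m_comm)
qed

text \<open>For \<open>n = 2\<close>, \<open>z^r\<close> is one full turn. For larger
  \<open>n\<close>, the boundary sums the translates of \<open>x (n - 1)\<close> by all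
  \<open>t^m\<close>, and \<open>lbl\<close> sends such a translate to \<open>x n\<close> exactly
  when \<open>g \<otimes> inv (t^m)\<close> equals \<open>t\<close>, which happens for a single
  \<open>m < r\<close>.\<close>

lemma lbl_bd_x_even:
  assumes n: "2 \<le> n" "even n" and g: "g \<in> carrier G"
  shows "lbl (n - 1) g (bd F n (x n)) = x n"
proof (cases "n = 2")
  case True
  interpret M: group "grp F 2" by (rule group_grp) simp
  show ?thesis using lbl1_pow_mult[of g 1] by (simp add: True bd_x2 One_nat_def[symmetric])
next
  case False
  then have n1: "3 \<le> n - 1" "2 \<le> n - 1" "odd (n - 1)" "n - 1 + 1 = n" using n by presburger+
  interpret M: group "grp F n" by (rule group_grp) (use n in simp)
  let ?L = "lin G (grp F (n - 1)) (bas (n - 1))"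
  have h: "lbl (n - 1) g \<in> hom (grp F (n - 1)) (grp F n)"
    using lbl_spec(1)[OF n1(2) g] n1 by simp
  \<comment> \<open>Partial sums: \<open>x n\<close> has been collected once \<open>m\<close>
    exceeds that one exponent, \<open>(idx g - 1) mod r\<close>. The bound on \<open>m\<close> keeps
    the exponents distinct modulo \<open>r\<close>.\<close>
  have "m \<le> r \<Longrightarrow> lbl (n - 1) g (?L (norm_elt G t m)) = (if (idx g - 1) mod int r < int m then x n else \<one>\<^bsub>grp F n\<^esub>)" for m
  proof (induction m)
    case 0
    have "lbl (n - 1) g \<one>\<^bsub>grp F (n - 1)\<^esub> = \<one>\<^bsub>grp F n\<^esub>"
      by (rule hom_one[OF h group_grp M.is_group]) (use n1 in simp)
    moreover have "\<not> (idx g - 1) mod int r < int 0"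
      using pos_mod_sign[of "int r" "idx g - 1"] r_pos by linarith
    ultimately show ?case using n1 by (simp only: lin_bas_norm_0 norm_elt_0 if_False)
  next
    case (Suc m)
    have "g \<otimes> inv (t [^] int m) = t \<longleftrightarrow> (idx g - 1) mod int r = int m"
    proof -
      have "g \<otimes> inv (t [^] int m) = t [^] (idx g - int m)"
        using g by (simp add: int_pow_diff)
      then have "g \<otimes> inv (t [^] int m) = t \<longleftrightarrow> (idx g - int m) mod int r = 1 mod int r"
        using pow_eq_iff[of "idx g - int m" 1] by simp
      also have "\<dots> \<longleftrightarrow> (idx g - 1) mod int r = int m mod int r"
        by (simp add: mod_eq_dvd_iff algebra_simps)
      finally show ?thesis using Suc.prems by simp
    qed
    then have "lbl (n - 1) g (bas (n - 1) (t [^] int m)) = (if (idx g - 1) mod int r = int m then x n else \<one>\<^bsub>grp F n\<^esub>)"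
      using lbl_spec(2)[OF n1(2) g, of "t [^] int m"] n1 by (simp add: val_def)
    then show ?case
      using Suc n1 n hom_mult[OF h, of "?L (norm_elt G t m)" "bas (n - 1) (t [^] int m)"]
      by (auto simp: lin_bas_norm_Suc)
  qed
  from this[of r] show ?thesis using bd_x_even[OF n1(1,3)] n1(4) r_pos by simp
qed

text \<open>Write \<open>W m\<close> for \<open>x n\<close> times \<open>N(m)\<close> and
  \<open>a\<close> for the exponent of \<open>inv g\<close>. Applying \<open>lbl\<close> to the
  boundary of \<open>x n\<close> gives \<open>W((a + 1) mod r) - W(a)\<close>. If
  \<open>a + 1 < r\<close>, this is the translate by \<open>inv g\<close>, so the right side
  vanishes, as does \<open>val n g\<close>. If \<open>a + 1 = r\<close>, that is
  \<open>g = t\<close>, the index wraps to 0 and the right side becomes \<open>W(r)\<close>, the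
  boundary of \<open>x (n + 1)\<close>.\<close>

lemma bd_val_odd:
  assumes n: "3 \<le> n" "odd n" and g: "g \<in> carrier G"
  shows "bd F (n + 1) (val n g) = inv\<^bsub>grp F n\<^esub> (lbl (n - 1) g (bd F n (x n))) \<otimes>\<^bsub>grp F n\<^esub> bas n (inv g)"
proof -
  have n1: "2 \<le> n - 1" "even (n - 1)" "n - 1 + 1 = n" using n by presburger+
  interpret M: comm_group "grp F n" by (rule comm_group_grp) (use n in simp)
  interpret l: group_hom "grp F (n - 1)" "grp F n" "lbl (n - 1) g"
    using lbl_spec(1)[OF n1(1) g] n1 group_grp[of "n - 1"] M.is_group
    by (simp add: group_hom_def group_hom_axioms_def)
  define W where "W m = lin G (grp F n) (bas n) (norm_elt G t m)" for m
  have W: "W m \<in> carrier (grp F n)" for m using n by (simp add: W_def)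
  have W0: "W 0 = \<one>\<^bsub>grp F n\<^esub>" using n by (simp add: W_def lin_bas_norm_0)
  have v: "val (n - 1) h = W (nat ((- idx h) mod int r))" for h
    using n1 by (simp add: val_def W_def)
  define a where "a = nat ((- idx g) mod int r)"
  have a: "int a = (- idx g) mod int r" "a < r" using r_pos by (simp_all add: a_def nat_less_iff)
  have ta: "t [^] int a = inv g"
    using g int_pow_neg[OF t_closed, of "idx g"] pow_eq_iff[of "int a" "- idx g"] a(1) by simp
  have WS: "W (Suc a) = W a \<otimes>\<^bsub>grp F n\<^esub> bas n (inv g)"
    using n by (simp add: W_def lin_bas_norm_Suc ta)
  have "bd F n (x n) = bas (n - 1) t \<otimes>\<^bsub>grp F (n - 1)\<^esub> inv\<^bsub>grp F (n - 1)\<^esub> (bas (n - 1) \<one>)"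
    using bd_x_odd[OF n1(1,2)] n1 by (simp add: bas_one)
  then have "lbl (n - 1) g (bd F n (x n)) = val (n - 1) (g \<otimes> inv t) \<otimes>\<^bsub>grp F n\<^esub> inv\<^bsub>grp F n\<^esub> (W a)"
    using n1 g lbl_spec(2)[OF n1(1) g] by (simp add: v a_def)
  also have "val (n - 1) (g \<otimes> inv t) = W (Suc a mod r)"
  proof -
    have "g \<otimes> inv t = t [^] (idx g - 1)" using g by (simp add: int_pow_diff)
    then have "(- idx (g \<otimes> inv t)) mod int r = (1 - idx g) mod int r" by (simp add: mod_simps)
    also have "\<dots> = int (Suc a mod r)" by (simp add: zmod_int a(1) mod_simps)
    finally show ?thesis by (simp add: v)
  qed
  finally have l: "lbl (n - 1) g (bd F n (x n)) = W (Suc a mod r) \<otimes>\<^bsub>grp F n\<^esub> inv\<^bsub>grp F n\<^esub> (W a)" .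
  have gt: "g = t \<longleftrightarrow> Suc a = r"
  proof -
    have "g = t \<longleftrightarrow> inv g = inv t" using g by (metis inv_inv t_closed)
    also have "\<dots> \<longleftrightarrow> t [^] int a = t [^] (- 1 :: int)" using ta by (simp add: int_pow_neg)
    also have "\<dots> \<longleftrightarrow> int r dvd int (Suc a)" by (simp add: pow_eq_iff mod_eq_dvd_iff add.commute)
    also have "\<dots> \<longleftrightarrow> Suc a = r" using a(2) by (simp only: int_dvd_int_iff) (auto dest: dvd_imp_le)
    finally show ?thesis .
  qed
  show ?thesis
  proof (cases "Suc a = r")
    case True
    then have bd: "bd F (n + 1) (val n g) = W (Suc a)"
      using gt n bd_x_even[of n] by (simp add: val_def W_def)
    have "Suc a mod r = 0" using True by simp
    then show ?thesis using W n by (simp add: bd l W0 WS)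
  next
    case False
    have h: "bd F (n + 1) \<in> hom (grp F (n + 1)) (grp F n)" using bd_hom[of "n + 1"] n by simp
    have "bd F (n + 1) (val n g) = \<one>\<^bsub>grp F n\<^esub>"
      using gt False n hom_one[OF h group_grp M.is_group] by (simp add: val_def)
    moreover have "W (Suc a) \<otimes>\<^bsub>grp F n\<^esub> inv\<^bsub>grp F n\<^esub> (W a) = bas n (inv g)"
      using W n by (simp add: WS M.m_comm[of "W a"] M.m_assoc)
    ultimately show ?thesis using False a(2) n by (simp add: l)
  qed
qed

text \<open>Both sides are homomorphisms in \<open>c\<close>, the right one because
  \<open>grp F n\<close> is commutative, so basis elements suffice. Invariance moves these back to
  \<open>x n\<close>, where the parity of \<open>n\<close> selects one of the two preceding
  computations.\<close>

lemma bd_lbl: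
  assumes n: "2 \<le> n" and g: "g \<in> carrier G" and c: "c \<in> carrier (grp F n)"
  shows "bd F (n + 1) (lbl n g c) =
    inv\<^bsub>grp F n\<^esub> (lbl (n - 1) g (bd F n c)) \<otimes>\<^bsub>grp F n\<^esub> act1 F n c (z [^]\<^bsub>P\<^esub> (- idx g))"
proof -
  interpret M: comm_group "grp F n" by (rule comm_group_grp[OF n])
  let ?l = "\<lambda>c. lbl (n - 1) g (bd F n c)" and ?a = "\<lambda>c. act1 F n c (z [^]\<^bsub>P\<^esub> (- idx g))"
  interpret l: group_hom "grp F n" "grp F n" ?l by unfold_locales (rule lbl_bd_hom[OF n g])
  interpret a: group_hom "grp F n" "grp F n" ?a by unfold_locales (rule act1_hom[OF n], simp)
  have h: "bd F (n + 1) \<in> hom (grp F (n + 1)) (grp F n)" using bd_hom[of "n + 1"] n by simp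
  have "(bd F (n + 1) \<circ> lbl n g) c = inv\<^bsub>grp F n\<^esub> (?l c) \<otimes>\<^bsub>grp F n\<^esub> ?a c"
  proof (rule basis_hom_ext[OF basis[OF n] fin M.is_group Group.hom_compose[OF lbl_spec(1)[OF n g] h] _ _ c])
    show "(\<lambda>c. inv\<^bsub>grp F n\<^esub> (?l c) \<otimes>\<^bsub>grp F n\<^esub> ?a c) \<in> hom (grp F n) (grp F n)"
      by (rule homI) (simp_all add: M.inv_mult M.m_ac)
  next
    fix g' assume g': "g' \<in> carrier G"
    \<comment> \<open>\<open>?e\<close> is the source of the arrow labelled \<open>?u\<close> that
      ends at \<open>g\<close>; acting along it carries \<open>x n\<close> over \<open>?e\<close> to
      \<open>bas n g'\<close> over \<open>g\<close>.\<close>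
    let ?e = "g \<otimes> inv g'" and ?u = "z [^]\<^bsub>P\<^esub> idx g'"
    have e: "?e \<in> carrier G" "?e \<otimes> phi F ?u = g" using g g' by (simp_all add: m_assoc)
    have "?l (bas n g') = lbl (n - 1) ?e (bd F n (x n))"
      using lbl_bd_act[OF n e(1), of "x n" ?u, unfolded e(2)] n by (simp add: bas_def)
    moreover have "?a (bas n g') = bas n (inv ?e)"
    proof -
      have "t [^] (- idx g) = inv g" using g by (simp add: int_pow_neg)
      then show ?thesis using n g g' by (simp add: act1_bas inv_mult_group)
    qed
    moreover have "bd F (n + 1) (val n ?e) = inv\<^bsub>grp F n\<^esub> (lbl (n - 1) ?e (bd F n (x n))) \<otimes>\<^bsub>grp F n\<^esub> bas n (inv ?e)"
    proof (cases "even n")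
      case True
      then show ?thesis using bd_val_even[OF n _ e(1)] lbl_bd_x_even[OF n _ e(1)] by simp
    next
      case False
      then have "3 \<le> n" using n by presburger
      then show ?thesis using bd_val_odd[OF _ False e(1)] by simp
    qed
    ultimately show "(bd F (n + 1) \<circ> lbl n g) (bas n g') =
        inv\<^bsub>grp F n\<^esub> (?l (bas n g')) \<otimes>\<^bsub>grp F n\<^esub> ?a (bas n g')"
      using lbl_spec(2)[OF n g g'] by simp
  qed
  then show ?thesis by simp
qed

section \<open>Assembly on the universal cover and comparison with the prescribed values\<close>

definition h0 :: "'g \<Rightarrow> 'g \<times> 'a" where "h0 g = (g, z [^]\<^bsub>P\<^esub> (- idx g))"

definition hty :: "nat \<Rightarrow> 'g \<times> 'a \<Rightarrow> 'g \<times> 'a" where "hty n c = (\<one>, lbl n (fst c) (snd c))"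

lemma cov_grp_simps [simp]:
  "carrier (cov_grp F n g) = {g} \<times> carrier (grp F n)"
  "c \<otimes>\<^bsub>cov_grp F n g\<^esub> d = (g, snd c \<otimes>\<^bsub>grp F n\<^esub> snd d)"
  "\<one>\<^bsub>cov_grp F n g\<^esub> = (g, \<one>\<^bsub>grp F n\<^esub>)"
  by (simp_all add: cov_grp_def)

lemma group_cov_grp: "1 \<le> n \<Longrightarrow> group (cov_grp F n g)"
proof -
  assume "1 \<le> n"
  then interpret M: group "grp F n" by (rule group_grp)
  show ?thesis
  proof (rule groupI)
    fix c assume "c \<in> carrier (cov_grp F n g)"
    then show "\<exists>d\<in>carrier (cov_grp F n g). d \<otimes>\<^bsub>cov_grp F n g\<^esub> c = \<one>\<^bsub>cov_grp F n g\<^esub>"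
      by (intro bexI[of _ "(g, inv\<^bsub>grp F n\<^esub> (snd c))"]) auto
  qed (auto simp: M.m_assoc)
qed

lemma inv_cov_grp [simp]:
  assumes "1 \<le> n" "c \<in> carrier (grp F n)"
  shows "inv\<^bsub>cov_grp F n g\<^esub> (g, c) = (g, inv\<^bsub>grp F n\<^esub> c)"
proof -
  interpret M: group "grp F n" by (rule group_grp) fact
  show ?thesis by (rule group.inv_equality[OF group_cov_grp]) (use assms in simp_all)
qed

lemma contracting: "contracting_homotopy G F h0 hty"
  unfolding contracting_homotopy_def
proof (intro conjI ballI allI impI)
  fix g assume g: "g \<in> carrier G"
  show "h0 g \<in> cov_arrows G F" "cov_src (h0 g) = g" "cov_tgt G F (h0 g) = \<one>"
    using g by (simp_all add: h0_def cov_arrows_def cov_src_def cov_tgt_def int_pow_neg)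
next
  fix a assume "a \<in> cov_arrows G F"
  show "hty 1 a \<in> carrier (cov_grp F 2 \<one>)" by (simp add: hty_def)
next
  fix a b assume "a \<in> cov_arrows G F" "b \<in> cov_arrows G F" "cov_tgt G F a = cov_src b"
  then show "hty 1 (cov_comp F a b) = hty 1 a \<otimes>\<^bsub>cov_grp F 2 \<one>\<^esub> hty 1 b"
    by (auto simp: hty_def cov_arrows_def cov_comp_def cov_src_def cov_tgt_def lbl1_mult)
next
  fix n :: nat and g assume "2 \<le> n" "g \<in> carrier G"
  then show "hty n \<in> hom (cov_grp F n g) (cov_grp F (n + 1) \<one>)"
    using hom_mult[OF lbl_spec(1)] by (intro homI) (auto simp: hty_def)
next
  fix n :: nat and a c
  assume "2 \<le> n" "a \<in> cov_arrows G F" "c \<in> carrier (cov_grp F n (cov_src a))"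
  then show "hty n (cov_act G F n c a) = hty n c"
    by (auto simp: hty_def cov_arrows_def cov_act_def cov_src_def lbl_act)
next
  fix a assume "a \<in> cov_arrows G F"
  then obtain g k where a: "a = (g, z [^]\<^bsub>P\<^esub> (k :: int))" "g \<in> carrier G"
    unfolding cov_arrows_def by (auto elim: pres.P.powE)
  obtain j where j: "g = t [^] (j :: int)" using a(2) by (rule powE)
  have idx: "idx (g \<otimes> t [^] k) = (idx g + k) mod int r"
    by (simp add: j int_pow_mult[symmetric] mod_simps)
  \<comment> \<open>The arrow closed up by \<open>h0\<close> has exponent \<open>s - s mod r\<close>
    with \<open>s = idx g + k\<close>, which is \<open>r\<close> times the quotient counted by
    \<open>lbl 1\<close>.\<close>
  have "inv\<^bsub>P\<^esub> (z [^]\<^bsub>P\<^esub> (- idx g)) \<otimes>\<^bsub>P\<^esub> z [^]\<^bsub>P\<^esub> k \<otimes>\<^bsub>P\<^esub> z [^]\<^bsub>P\<^esub> (- idx (g \<otimes> t [^] k)) =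
      z [^]\<^bsub>P\<^esub> (idx g + k - (idx g + k) mod int r)"
    by (simp add: idx pres.P.int_pow_neg[symmetric] pres.P.int_pow_mult[symmetric])
  also have "\<dots> = bd F 2 (lbl 1 g (z [^]\<^bsub>P\<^esub> k))"
    by (simp add: bd_lbl1 minus_mod_eq_mult_div)
  finally show "cov_bd F 2 (hty 1 a) =
      cov_comp F (cov_comp F (cov_inv G F (h0 (cov_src a))) a) (h0 (cov_tgt G F a))"
    using a by (simp add: hty_def h0_def cov_bd_def cov_comp_def cov_inv_def cov_src_def cov_tgt_def int_pow_neg)
next
  fix n :: nat and g c
  assume n: "2 \<le> n" and g: "g \<in> carrier G" and "c \<in> carrier (cov_grp F n g)"
  then obtain d where c: "c = (g, d)" "d \<in> carrier (grp F n)" by auto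
  have "lbl (n - 1) g (bd F n d) \<in> carrier (grp F n)"
    using lbl_bd_hom[OF n g] c(2) by (auto simp: hom_def)
  then show "cov_bd F (n + 1) (hty n c) =
        inv\<^bsub>cov_grp F n \<one>\<^esub> (hty (n - 1) (cov_bd F n c)) \<otimes>\<^bsub>cov_grp F n \<one>\<^esub> cov_act G F n c (h0 g)"
    using n g c bd_lbl[OF n g c(2)] by (simp add: hty_def h0_def cov_bd_def cov_act_def)
qed

lemma lbl_x: "2 \<le> n \<Longrightarrow> g \<in> carrier G \<Longrightarrow> lbl n g (x n) = val n g"
  using lbl_spec(2)[of n g \<one>] by (simp add: bas_one)

lemma homotopy_values: "cyclic_homotopy_values G t r F x h0 hty"
  unfolding cyclic_homotopy_values_def
proof (intro conjI allI impI)
  fix i assume "i < r"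
  then show "h0 (t [^] i) = (t [^] i, x 1 [^]\<^bsub>grp F 1\<^esub> (- int i))"
    using idx_pow[of "int i"] by (simp add: h0_def int_pow_int)
next
  fix n i :: nat assume n: "1 \<le> n" and i: "i < r"
  interpret M: group "grp F (n + 1)" by (rule group_grp) simp
  have idx: "idx (t [^] i) = int i" using idx_pow[of "int i"] i by (simp add: int_pow_int)
  \<comment> \<open>Comparing exponents modulo \<open>r\<close> includes \<open>r = 1\<close>, where
    \<open>t\<close> is the identity and \<open>i = 0\<close> is the exceptional index.\<close>
  have it: "t [^] i = t \<longleftrightarrow> i mod r = 1 mod r"
    using pow_eq_iff[of "int i" 1] by (simp add: int_pow_int zmod_int[symmetric]) (metis of_nat_1 of_nat_eq_iff zmod_int)
  consider "n = 1" | "2 \<le> n" "odd n" | "2 \<le> n" "even n" "i = 0" | "2 \<le> n" "even n" "0 < i" using n by linarith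
  then show "hty n (t [^] i, x n) =
        (\<one>\<^bsub>G\<^esub>,
         if n = 1 then (if i = r - 1 then x 2 else \<one>\<^bsub>grp F 2\<^esub>)
         else if even n then
           (if i = 0 then \<one>\<^bsub>grp F (n + 1)\<^esub>
            else dot F (n + 1) (x (n + 1)) (norm_elt G t (r - i)))
         else (if i mod r = 1 mod r then x (n + 1) else \<one>\<^bsub>grp F (n + 1)\<^esub>))"
  proof cases
    case 1
    interpret M2: group "grp F 2" by (rule group_grp) simp
    have "lbl 1 (t [^] i) (x 1) = x 2 [^]\<^bsub>grp F 2\<^esub> ((int i + 1) div int r)"
      using lbl1_pow[of "t [^] i" 1] by (simp add: idx)
    moreover have "(int i + 1) div int r = (if i = r - 1 then 1 else 0)" using i by auto
    ultimately show ?thesis using 1 by (simp add: hty_def)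
  next
    case 2
    then show ?thesis by (auto simp: hty_def lbl_x val_def it)
  next
    case 3
    then show ?thesis using idx by (simp add: hty_def lbl_x val_def lin_bas_norm_0)
  next
    case 4
    have "(- int i) mod int r = int (r - i)"
      using i 4(3) by (simp add: zmod_zminus1_eq_if of_nat_diff)
    then show ?thesis using 4 by (auto simp: hty_def lbl_x val_def idx dot_eq_lin)
  qed
qed

section \<open>Uniqueness of the homotopy with the given values\<close>

lemma unique:
  assumes k: "contracting_homotopy G F k0 k" and v: "cyclic_homotopy_values G t r F x k0 k"
  shows "g \<in> carrier G \<Longrightarrow> k0 g = h0 g"
    and "1 \<le> n \<Longrightarrow> g \<in> carrier G \<Longrightarrow> c \<in> carrier (grp F n) \<Longrightarrow> k n (g, c) = hty n (g, c)"
proof -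
  have gen: "k n (g, x n) = hty n (g, x n)" if "1 \<le> n" "g \<in> carrier G" for n g
    using v homotopy_values that by (elim pow_natE) (simp add: cyclic_homotopy_values_def)
  show "k0 g = h0 g" if "g \<in> carrier G" for g
    using v homotopy_values that by (elim pow_natE) (simp add: cyclic_homotopy_values_def)
  show "k n (g, c) = hty n (g, c)" if n: "1 \<le> n" and g: "g \<in> carrier G" and c: "c \<in> carrier (grp F n)"
  proof (cases "n = 1")
    case False
    then have n2: "2 \<le> n" using n by simp
    have kh: "k n \<in> hom (cov_grp F n g) (cov_grp F (n + 1) \<one>)" if "g \<in> carrier G" for g
      using k n2 that by (simp add: contracting_homotopy_def)
    have kc: "k n (g, d) \<in> {\<one>} \<times> carrier (grp F (n + 1))" if "g \<in> carrier G" "d \<in> carrier (grp F n)" for g d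
      using kh[OF that(1)] that(2) by (auto simp: hom_def Pi_iff)
    have "(\<lambda>d. snd (k n (g, d))) c = lbl n g c"
    proof (rule basis_hom_ext[OF basis[OF n2] fin group_grp _ lbl_spec(1)[OF n2 g] _ c])
      show "(\<lambda>d. snd (k n (g, d))) \<in> hom (grp F n) (grp F (n + 1))"
      proof (rule homI)
        fix d d' assume "d \<in> carrier (grp F n)" "d' \<in> carrier (grp F n)"
        then show "snd (k n (g, d \<otimes>\<^bsub>grp F n\<^esub> d')) = snd (k n (g, d)) \<otimes>\<^bsub>grp F (n + 1)\<^esub> snd (k n (g, d'))"
          using hom_mult[OF kh[OF g], of "(g, d)" "(g, d')"] by simp
      qed (use kc[OF g] in \<open>auto simp: mem_Times_iff\<close>)
      fix g' assume g': "g' \<in> carrier G"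
      let ?e = "g \<otimes> inv g'" and ?u = "z [^]\<^bsub>P\<^esub> idx g'"
      have e: "?e \<in> carrier G" "?e \<otimes> g' = g" using g g' by (simp_all add: m_assoc)
      \<comment> \<open>Invariance is what reduces the value on a translate over \<open>g\<close> to
        the prescribed value on \<open>x n\<close> over \<open>?e\<close>.\<close>
      have "k n (cov_act G F n (?e, x n) (?e, ?u)) = k n (?e, x n)"
        using k n2 n e(1) by (auto simp: contracting_homotopy_def cov_arrows_def cov_src_def)
      moreover have "cov_act G F n (?e, x n) (?e, ?u) = (g, bas n g')"
        using g' e(2) by (simp add: cov_act_def bas_def)
      ultimately show "snd (k n (g, bas n g')) = lbl n g (bas n g')"
        using gen[OF n e(1)] lbl_spec(2)[OF n2 g g'] n2 e(1) by (simp add: hty_def lbl_x)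
    qed simp
    then show ?thesis using kc[OF g c] by (auto simp: hty_def mem_Times_iff prod_eq_iff)
  next
    case True
    interpret M: group "grp F 2" by (rule group_grp) simp
    have step: "f 1 (h, z [^]\<^bsub>P\<^esub> (m + 1)) = f 1 (h, z [^]\<^bsub>P\<^esub> m) \<otimes>\<^bsub>cov_grp F 2 \<one>\<^esub> f 1 (h \<otimes> t [^] m, z)"
      "f 1 (h, z [^]\<^bsub>P\<^esub> m) \<in> carrier (cov_grp F 2 \<one>)"
      if "contracting_homotopy G F f0 f" "h \<in> carrier G" for f0 f h and m :: int
    proof -
      have "cov_comp F (h, z [^]\<^bsub>P\<^esub> m) (h \<otimes> t [^] m, z) = (h, z [^]\<^bsub>P\<^esub> (m + 1))"
        by (simp add: cov_comp_def pres.P.int_pow_mult)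
      moreover have "(h, z [^]\<^bsub>P\<^esub> m) \<in> cov_arrows G F" "(h \<otimes> t [^] m, z) \<in> cov_arrows G F"
        "cov_tgt G F (h, z [^]\<^bsub>P\<^esub> m) = cov_src (h \<otimes> t [^] m, z)"
        using that(2) by (simp_all add: cov_arrows_def cov_tgt_def cov_src_def)
      ultimately show "f 1 (h, z [^]\<^bsub>P\<^esub> (m + 1)) = f 1 (h, z [^]\<^bsub>P\<^esub> m) \<otimes>\<^bsub>cov_grp F 2 \<one>\<^esub> f 1 (h \<otimes> t [^] m, z)"
        "f 1 (h, z [^]\<^bsub>P\<^esub> m) \<in> carrier (cov_grp F 2 \<one>)"
        using that(1) unfolding contracting_homotopy_def by metis+
    qed
    interpret C: group "cov_grp F 2 \<one>" by (rule group_cov_grp) simp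
    \<comment> \<open>An equivalence, obtained by cancelling the known value on the last edge, so
      that agreement propagates to larger and to smaller exponents.\<close>
    have iff: "k 1 (g, z [^]\<^bsub>P\<^esub> (m + 1)) = hty 1 (g, z [^]\<^bsub>P\<^esub> (m + 1)) \<longleftrightarrow>
        k 1 (g, z [^]\<^bsub>P\<^esub> m) = hty 1 (g, z [^]\<^bsub>P\<^esub> m)" for m :: int
    proof -
      have gm: "g \<otimes> t [^] m \<in> carrier G" using g by simp
      have "k 1 (g \<otimes> t [^] m, z) = hty 1 (g \<otimes> t [^] m, z)" using gen[of 1] gm by simp
      moreover have "hty 1 (g \<otimes> t [^] m, z) \<in> carrier (cov_grp F 2 \<one>)" by (simp add: hty_def)
      ultimately show ?thesis
        using C.r_cancel_one step[OF k g, of m] step[OF contracting g, of m] C.right_cancel by metis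
    qed
    have "k 1 (g, z [^]\<^bsub>P\<^esub> m) = hty 1 (g, z [^]\<^bsub>P\<^esub> m)" for m :: int
    \<comment> \<open>The induction starts at 1 because the prescribed values concern
      \<open>z\<close> itself.\<close>
    proof (induction m rule: int_induct[where k = 1])
      case base
      then show ?case using gen[of 1 g] g by simp
    next
      case (step1 i)
      then show ?case using iff[of i] by simp
    next
      case (step2 i)
      then show ?case using iff[of "i - 1"] by simp
    qed
    moreover obtain m :: int where "c = z [^]\<^bsub>P\<^esub> m"
      using c True by (auto elim: pres.P.powE)
    ultimately show ?thesis using True by simp
  qed
qed

end

section \<open>Existence of the resolution\<close>

context finite_cyclic
begin

section \<open>Multiplication by \<open>N(r)\<close> and by \<open>t - 1\<close> on the group
  ring\<close>

lemma lookup_norm_elt: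
  assumes "h \<in> carrier G"
  shows "Poly_Mapping.lookup (norm_elt G t r) h = 1"
proof -
  have "t [^] k = h \<longleftrightarrow> k = nat (idx h)" if "k < r" for k :: nat
  proof -
    have "t [^] k = h \<longleftrightarrow> t [^] int k = t [^] idx h" using assms by (simp add: int_pow_int)
    also have "\<dots> \<longleftrightarrow> k = nat (idx h)" using that by (subst pow_eq_iff) (auto simp: nat_eq_iff2)
    finally show ?thesis .
  qed
  then have "Poly_Mapping.lookup (norm_elt G t r) h = (\<Sum>k<r. if k = nat (idx h) then 1 else 0)"
    using assms unfolding norm_elt_def lookup_sum by (intro sum.cong) (auto simp: lookup_single when_def)
  also have "\<dots> = 1" by (simp add: nat_less_iff)
  finally show ?thesis .
qed

text \<open>Multiplication by \<open>N(r)\<close>: as \<open>N(r)\<close> absorbs group elements,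
  \<open>p\<close> acts on it through its augmentation.\<close>

definition norm_mult :: "('g \<Rightarrow>\<^sub>0 int) \<Rightarrow> ('g \<Rightarrow>\<^sub>0 int)" where
  "norm_mult p = norm_elt G t r [^]\<^bsub>gring G\<^esub> aug G p"

lemma norm_mult_closed [simp]: "norm_mult p \<in> carrier (gring G)"
  by (simp add: norm_mult_def)

lemma lookup_norm_mult: "h \<in> carrier G \<Longrightarrow> Poly_Mapping.lookup (norm_mult p) h = aug G p"
  by (simp add: norm_mult_def lookup_gring_pow lookup_norm_elt)

lemma norm_mult_hom: "norm_mult \<in> hom (gring G) (gring G)"
  by (rule homI, simp, rule gring_eqI[of _ G]) (simp_all add: lookup_norm_mult lookup_add aug_add)

lemma norm_mult_shift [simp]: "u \<in> carrier G \<Longrightarrow> norm_mult (shift G p u) = norm_mult p"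
  by (simp add: norm_mult_def)

lemma shift_norm_mult [simp]: "u \<in> carrier G \<Longrightarrow> shift G (norm_mult p) u = norm_mult p"
  by (rule gring_eqI[of _ G]) (simp_all add: lookup_shift lookup_norm_mult)

lemma norm_mult_e: "norm_mult e = norm_elt G t r"
  by (rule gring_eqI[of _ G]) (simp_all add: lookup_norm_mult lookup_norm_elt)

lemma norm_mult_eq_0_iff: "norm_mult p = 0 \<longleftrightarrow> aug G p = 0"
proof
  assume "norm_mult p = 0"
  then show "aug G p = 0" using lookup_norm_mult[OF one_closed, of p] by simp
next
  assume "aug G p = 0"
  then show "norm_mult p = 0" by (intro gring_eqI[of _ G]) (simp_all add: lookup_norm_mult)
qed

text \<open>Multiplication by \<open>t - 1\<close>.\<close>

definition diff_mult :: "('g \<Rightarrow>\<^sub>0 int) \<Rightarrow> ('g \<Rightarrow>\<^sub>0 int)" where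
  "diff_mult p = shift G p t - p"

lemma diff_mult_closed [simp]: "p \<in> carrier (gring G) \<Longrightarrow> diff_mult p \<in> carrier (gring G)"
  by (simp add: diff_mult_def)

lemma diff_mult_add: "diff_mult (p + q) = diff_mult p + diff_mult q"
  by (simp add: diff_mult_def shift_add)

lemma diff_mult_hom: "diff_mult \<in> hom (gring G) (gring G)"
  by (rule homI) (simp_all add: diff_mult_add)

lemma diff_mult_shift:
  assumes "u \<in> carrier G"
  shows "diff_mult (shift G p u) = shift G (diff_mult p) u"
proof -
  have "shift G p (u \<otimes> t) = shift G (shift G p t) u" using assms by (simp add: shift_shift comm[of u t])
  moreover have "shift G (a - b) u = shift G a u - shift G b u" for a b
    by (rule poly_mapping_eqI) (simp add: lookup_shift lookup_minus)
  ultimately show ?thesis using assms by (simp add: diff_mult_def shift_shift)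
qed

lemma diff_mult_norm_elt: "diff_mult (norm_elt G t m) = Poly_Mapping.single (t [^] m) 1 - e"
proof (induction m)
  case 0
  have "diff_mult 0 = 0" using diff_mult_add[of 0 0] by simp
  then show ?case by simp
next
  case (Suc m)
  then show ?case by (simp add: norm_elt_Suc diff_mult_add) (simp add: diff_mult_def)
qed

lemma aug_diff_mult [simp]: "aug G (diff_mult p) = 0"
proof -
  have "aug G (shift G p t) = aug G (diff_mult p) + aug G p"
    by (simp add: aug_add[symmetric] diff_mult_def)
  then show ?thesis by simp
qed

lemma diff_mult_norm_mult [simp]: "diff_mult (norm_mult p) = 0"
  by (simp add: diff_mult_def)

text \<open>Since \<open>(t - 1) N(i) = t\<^sup>i - 1\<close>, every \<open>p\<close> agrees with its augmentation up to a multiple of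
  \<open>t - 1\<close>.\<close>

lemma image_diff_mult: "diff_mult ` carrier (gring G) = {p \<in> carrier (gring G). aug G p = 0}"
proof (intro equalityI subsetI)
  fix p assume p: "p \<in> {p \<in> carrier (gring G). aug G p = 0}"
  \<comment> \<open>The linear map sending \<open>g = t^i\<close> with \<open>0 \<le> i < r\<close>
    to \<open>N(i)\<close>. Following it by \<open>diff_mult\<close> sends \<open>g\<close> to
    \<open>g - 1\<close>, hence \<open>p\<close> to \<open>p\<close> minus its augmentation, so
    \<open>q p\<close> is a preimage when the augmentation vanishes.\<close>
  define q where "q = lin G (gring G) (\<lambda>g. norm_elt G t (nat (idx g)))"
  have qh: "q \<in> hom (gring G) (gring G)" unfolding q_def by (rule lin_hom[OF comm_group_gring]) simp
  have "(diff_mult \<circ> q) p = (\<lambda>p. p - Poly_Mapping.single \<one> (aug G p)) p"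
  proof (rule gring_hom_ext[OF gring.is_group Group.hom_compose[OF qh diff_mult_hom]])
    show "(\<lambda>p. p - Poly_Mapping.single \<one> (aug G p)) \<in> hom (gring G) (gring G)"
      by (rule homI) (simp_all add: aug_add single_add)
    fix g assume g: "g \<in> carrier G"
    then have "q (Poly_Mapping.single g 1) = norm_elt G t (nat (idx g))"
      unfolding q_def by (intro lin_single[OF comm_group_gring fin]) simp_all
    moreover have "t [^] nat (idx g) = g" using pow_idx[OF g] int_pow_int[of G t "nat (idx g)"] by simp
    ultimately show "(diff_mult \<circ> q) (Poly_Mapping.single g 1) =
        Poly_Mapping.single g 1 - Poly_Mapping.single \<one> (aug G (Poly_Mapping.single g 1))"
      using g by (simp add: diff_mult_norm_elt)
  qed (use p in simp)
  then have "p = diff_mult (q p)" using p by simp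
  then show "p \<in> diff_mult ` carrier (gring G)" using qh p by (auto simp: hom_def)
qed auto

text \<open>Invariance under \<open>t\<close> makes the coefficients constant along powers of
  \<open>t\<close>, hence on all of \<open>G\<close>, so \<open>p\<close> is an integer multiple of
  \<open>N(r)\<close>.\<close>

lemma image_norm_mult: "norm_mult ` carrier (gring G) = {p \<in> carrier (gring G). diff_mult p = 0}"
proof (intro equalityI subsetI)
  fix p assume p: "p \<in> {p \<in> carrier (gring G). diff_mult p = 0}"
  then have inv: "shift G p t = p" by (simp add: diff_mult_def)
  have const: "Poly_Mapping.lookup p (t [^] k) = Poly_Mapping.lookup p \<one>" for k :: nat
  proof (induction k)
    case (Suc k)
    have "Poly_Mapping.lookup (shift G p t) (t [^] Suc k) = Poly_Mapping.lookup p (t [^] k)"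
      by (simp add: lookup_shift m_assoc)
    then show ?case using Suc by (simp add: inv)
  qed simp
  have "p = norm_mult (Poly_Mapping.single \<one> (Poly_Mapping.lookup p \<one>))"
  proof (rule gring_eqI[of _ G])
    fix h assume "h \<in> carrier G"
    then show "Poly_Mapping.lookup p h =
        Poly_Mapping.lookup (norm_mult (Poly_Mapping.single \<one> (Poly_Mapping.lookup p \<one>))) h"
      by (subst lookup_norm_mult) (auto simp: const elim: pow_natE)
  qed (use p in simp_all)
  then show "p \<in> norm_mult ` carrier (gring G)" by (rule image_eqI) simp
qed auto

section \<open>The group ring as a free module on one generator\<close>

lemma gring_ring_act:
  assumes "p \<in> carrier (gring G)"
  shows "ring_act (gring G) (shift G) e p = p"
proof -
  have "ring_act (gring G) (shift G) e p = lin G (gring G) (shift G e) p"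
    by (rule ring_act_eq_lin[OF comm_group_gring fin]) (use assms in simp_all)
  also have "\<dots> = id p"
  proof (rule gring_hom_ext[OF gring.is_group lin_hom[OF comm_group_gring] _ _ assms])
    show "id \<in> hom (gring G) (gring G)" by (simp add: hom_def)
    fix g assume "g \<in> carrier G"
    then show "lin G (gring G) (shift G e) (Poly_Mapping.single g 1) = id (Poly_Mapping.single g 1)"
      using lin_single[OF comm_group_gring fin, where b = "shift G e" and g = g] by simp
  qed simp
  finally show ?thesis by simp
qed

text \<open>A coefficient family on \<open>{e}\<close> is determined by its entry at
  \<open>e\<close>, and \<open>e\<close> times that entry is the entry itself.\<close>

lemma gring_free_module: "free_G_module_on G (gring G) (shift G) {e}"
  unfolding free_G_module_on_def
proof (intro conjI ballI)
  show "G_module G (gring G) (shift G)"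
    by (auto simp: G_module_def right_action_def is_group comm_group_gring shift_add shift_one shift_shift)
  show "{e} \<subseteq> carrier (gring G)" by simp
  fix m assume m: "m \<in> carrier (gring G)"
  let ?s = "\<lambda>a :: ('g \<Rightarrow>\<^sub>0 int) \<Rightarrow>\<^sub>0 ('g \<Rightarrow>\<^sub>0 int). finprod (gring G)
      (\<lambda>x. ring_act (gring G) (shift G) x (Poly_Mapping.lookup a x)) (Poly_Mapping.keys a)"
  have s: "?s a = Poly_Mapping.lookup a e" "Poly_Mapping.single e (Poly_Mapping.lookup a e) = a"
    if a: "Poly_Mapping.keys a \<subseteq> {e}" "Poly_Mapping.lookup a e \<in> carrier (gring G)" for a
  proof -
    show "Poly_Mapping.single e (Poly_Mapping.lookup a e) = a"
    proof (rule poly_mapping_eqI)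
      fix y
      show "Poly_Mapping.lookup (Poly_Mapping.single e (Poly_Mapping.lookup a e)) y = Poly_Mapping.lookup a y"
      proof (cases "y = e")
        case False
        then have "y \<notin> Poly_Mapping.keys a" using a(1) by auto
        then show ?thesis using False by (simp add: in_keys_iff lookup_single)
      qed simp
    qed
    show "?s a = Poly_Mapping.lookup a e"
    proof (cases "e \<in> Poly_Mapping.keys a")
      case True
      then have "Poly_Mapping.keys a = {e}" using a(1) by auto
      then show ?thesis using a(2) by (simp add: gring_ring_act)
    next
      case False
      then have "Poly_Mapping.keys a = {}" using a(1) by blast
      then show ?thesis using False by (simp add: in_keys_iff)
    qed
  qed
  show "\<exists>!a. Poly_Mapping.keys a \<subseteq> {e} \<and>
      (\<forall>x. Poly_Mapping.keys (Poly_Mapping.lookup a x) \<subseteq> carrier G) \<and> m = ?s a"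
  proof (rule ex1I[of _ "Poly_Mapping.single e m"])
    have "Poly_Mapping.keys (Poly_Mapping.single e m) \<subseteq> {e}" by simp
    then show "Poly_Mapping.keys (Poly_Mapping.single e m) \<subseteq> {e} \<and>
        (\<forall>x. Poly_Mapping.keys (Poly_Mapping.lookup (Poly_Mapping.single e m) x) \<subseteq> carrier G) \<and>
        m = ?s (Poly_Mapping.single e m)"
      using s(1)[of "Poly_Mapping.single e m"] m by (simp add: lookup_single when_def gring_def)
  next
    fix a assume a: "Poly_Mapping.keys a \<subseteq> {e} \<and>
        (\<forall>x. Poly_Mapping.keys (Poly_Mapping.lookup a x) \<subseteq> carrier G) \<and> m = ?s a"
    then have "Poly_Mapping.lookup a e \<in> carrier (gring G)" by (simp add: gring_def)
    then show "a = Poly_Mapping.single e m" using s[of a] a by simp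
  qed
qed

section \<open>The model resolution and its exactness\<close>

text \<open>The integers, encoded as multiples of the identity in the group ring because all
  dimensions of \<open>crossed_data\<close> share one element type.\<close>

definition zgrp :: "('g \<Rightarrow>\<^sub>0 int) monoid" where
  "zgrp = \<lparr>carrier = range (Poly_Mapping.single \<one>), mult = (+), one = 0\<rparr>"

definition zphi :: "('g \<Rightarrow>\<^sub>0 int) \<Rightarrow> 'g" where
  "zphi p = t [^] Poly_Mapping.lookup p \<one>"

lemma zgrp_simps [simp]:
  "carrier zgrp = range (Poly_Mapping.single \<one>)" "p \<otimes>\<^bsub>zgrp\<^esub> q = p + q" "\<one>\<^bsub>zgrp\<^esub> = 0"
  by (simp_all add: zgrp_def)

lemma group_zgrp: "group zgrp"
proof (rule groupI)
  fix p assume "p \<in> carrier zgrp"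
  then obtain k :: int where "p = Poly_Mapping.single \<one> k" by auto
  then show "\<exists>q\<in>carrier zgrp. q \<otimes>\<^bsub>zgrp\<^esub> p = \<one>\<^bsub>zgrp\<^esub>"
    by (intro bexI[of _ "Poly_Mapping.single \<one> (- k)"]) (simp_all add: single_add[symmetric])
next
  fix p q assume "p \<in> carrier zgrp" "q \<in> carrier zgrp"
  then show "p \<otimes>\<^bsub>zgrp\<^esub> q \<in> carrier zgrp" by (auto simp: single_add[symmetric])
next
  show "\<one>\<^bsub>zgrp\<^esub> \<in> carrier zgrp" using rangeI[of "Poly_Mapping.single \<one>" "0 :: int"] by simp
qed (simp_all add: add.assoc)

lemma zgrp_pow [simp]: "e [^]\<^bsub>zgrp\<^esub> (k :: int) = Poly_Mapping.single \<one> k"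
proof -
  have "Poly_Mapping.single \<one> \<in> hom integer_group zgrp"
    by (rule homI) (simp_all add: single_add)
  from hom_int_pow[OF this _ group_integer_group group_zgrp, of 1 k] show ?thesis by simp
qed

lemma zgrp_presentation: "cyclic_presentation G t r zgrp e zphi"
proof -
  interpret Z: group zgrp by (rule group_zgrp)
  have "infinite_cyclic zgrp e"
  proof
    show "k = l" if "e [^]\<^bsub>zgrp\<^esub> (k :: int) = e [^]\<^bsub>zgrp\<^esub> (l :: int)" for k l
      using that by (metis lookup_single_eq zgrp_pow)
  qed (auto simp: image_iff)
  moreover have "zphi \<in> hom zgrp G"
    by (rule homI) (auto simp: zphi_def lookup_add int_pow_mult)
  moreover have "zphi e = t" by (simp add: zphi_def)
  ultimately show ?thesis
    by (intro cyclic_presentation.intro cyclic_presentation_axioms.intro finite_cyclic_axioms)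
qed

interpretation Zp: cyclic_presentation G t r zgrp e zphi
  by (rule zgrp_presentation)

definition model :: "('g, 'g \<Rightarrow>\<^sub>0 int) crossed_data" where
  "model = \<lparr>grp = \<lambda>n. if n = 1 then zgrp else gring G, phi = zphi,
     bd = \<lambda>n. if n = 2 then Zp.mu else if odd n then diff_mult else norm_mult,
     cact = Zp.gact, mact = \<lambda>n. shift G\<rparr>"

lemma model_simps [simp]:
  "grp model 1 = zgrp" "n \<noteq> 1 \<Longrightarrow> grp model n = gring G" "phi model = zphi"
  "bd model 2 = Zp.mu" "n \<noteq> 2 \<Longrightarrow> odd n \<Longrightarrow> bd model n = diff_mult"
  "n \<noteq> 2 \<Longrightarrow> even n \<Longrightarrow> bd model n = norm_mult" "cact model = Zp.gact" "mact model n = shift G"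
  "act1 model n c u = shift G c (zphi u)"
  by (auto simp: model_def act1_def Zp.gact_def)

lemma mu_eq: "Zp.mu p = Poly_Mapping.single \<one> (int r * aug G p)"
  by (simp add: Zp.mu_def)

lemma kernel_zphi: "Zp.mu ` carrier (gring G) = kernel zgrp G zphi"
proof (intro equalityI subsetI)
  fix p assume "p \<in> Zp.mu ` carrier (gring G)"
  then obtain q where "p = Poly_Mapping.single \<one> (int r * aug G q)" by (auto simp: mu_eq)
  moreover have "t [^] (int r * aug G q) = t [^] (0 :: int)" by (simp only: pow_eq_iff) simp
  ultimately show "p \<in> kernel zgrp G zphi" by (simp add: kernel_def zphi_def)
next
  fix p assume "p \<in> kernel zgrp G zphi"
  then obtain k :: int where k: "p = Poly_Mapping.single \<one> k" "t [^] k = t [^] (0 :: int)"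
    by (auto simp: kernel_def zphi_def)
  then have "int r dvd k" by (simp only: pow_eq_iff) (simp add: dvd_eq_mod_eq_0)
  then obtain m where "k = int r * m" by (elim dvdE)
  then have "p = Zp.mu (Poly_Mapping.single \<one> m)" by (simp add: mu_eq k)
  then show "p \<in> Zp.mu ` carrier (gring G)" by (rule image_eqI) simp
qed

text \<open>\<open>mu\<close> is \<open>r\<close> times the augmentation with \<open>r > 0\<close>,
  so its kernel is the augmentation ideal, which consists of the multiples of
  \<open>t - 1\<close>.\<close>

lemma kernel_mu: "kernel (gring G) zgrp Zp.mu = diff_mult ` carrier (gring G)"
proof -
  have "Zp.mu p = 0 \<longleftrightarrow> aug G p = 0" for p
    using r_pos unfolding mu_eq by (metis less_irrefl lookup_single_eq lookup_zero mult_eq_0_iff of_nat_eq_0_iff single_zero)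
  then show ?thesis by (simp add: kernel_def image_diff_mult)
qed

text \<open>Above dimension 2 exactness alternates: the elements killed by \<open>t - 1\<close> are
  the multiples of \<open>N(r)\<close>, and those killed by \<open>N(r)\<close> have augmentation 0
  and are the multiples of \<open>t - 1\<close>.\<close>

lemma model_exact:
  assumes "2 \<le> n"
  shows "kernel (grp model n) (grp model (n - 1)) (bd model n) = bd model (n + 1) ` carrier (grp model (n + 1))"
proof -
  consider "n = 2" | "3 \<le> n" "odd n" | "3 \<le> n" "even n" using assms by linarith
  then show ?thesis
  proof cases
    case 1
    moreover have "(2 :: nat) - 1 = 1" by simp
    ultimately show ?thesis by (simp only:) (simp add: kernel_mu)
  next
    case 2
    then have "n \<noteq> 1" "n - 1 \<noteq> 1" "n + 1 \<noteq> 1" "n \<noteq> 2" "n + 1 \<noteq> 2" by linarith+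
    then show ?thesis using 2 by (simp add: kernel_def image_norm_mult)
  next
    case 3
    then have "n \<noteq> 1" "n - 1 \<noteq> 1" "n + 1 \<noteq> 1" "n \<noteq> 2" "n + 1 \<noteq> 2" by linarith+
    then show ?thesis using 3 by (simp add: kernel_def image_diff_mult norm_mult_eq_0_iff)
  qed
qed

lemma zphi_epi: "zphi \<in> epi zgrp G"
proof -
  have "g \<in> zphi ` carrier zgrp" if g: "g \<in> carrier G" for g
    using pow_idx[OF g] by (intro image_eqI[of _ _ "Poly_Mapping.single \<one> (idx g)"]) (simp_all add: zphi_def)
  then show ?thesis using Zp.\<phi>_hom by (auto simp: epi_def hom_def)
qed

lemma model_free: "free_crossed_resolution G model (\<lambda>n. {e})"
  unfolding free_crossed_resolution_def
proof (intro conjI allI ballI impI)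
  show "free_group_on (grp model 1) {e}" using Zp.P.free by simp
  show "phi model \<in> epi (grp model 1) G" using zphi_epi by simp
  show "free_crossed_module_on (grp model 2) (grp model 1) (bd model 2) (cact model) {e}"
    using Zp.gring_free_crossed by simp
  show "bd model 2 ` carrier (grp model 2) = kernel (grp model 1) G (phi model)"
    using kernel_zphi by simp
next
  fix n :: nat assume "3 \<le> n"
  then show "free_G_module_on G (grp model n) (mact model n) {e}"
    using gring_free_module by simp
next
  fix n :: nat assume n: "3 \<le> n"
  then have "n \<noteq> 1" "n \<noteq> 2" "n - 1 \<noteq> 1" by linarith+
  then show "bd model n \<in> hom (grp model n) (grp model (n - 1))"
    using diff_mult_hom norm_mult_hom by (cases "odd n") simp_all
  fix c u assume "c \<in> carrier (grp model n)" "u \<in> carrier (grp model 1)"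
  then show "bd model n (act1 model n c u) = act1 model (n - 1) (bd model n c) u"
    using \<open>n \<noteq> 2\<close> by (cases "odd n") (simp_all add: diff_mult_shift zphi_def)
next
  fix n :: nat assume "2 \<le> n"
  then show "kernel (grp model n) (grp model (n - 1)) (bd model n) = bd model (n + 1) ` carrier (grp model (n + 1))"
    by (rule model_exact)
qed

lemma model_resolution: "cyclic_resolution G t r model (\<lambda>n. e)"
  unfolding cyclic_resolution_def
proof (intro conjI allI impI)
  show "free_crossed_resolution G model (\<lambda>n. {e})" by (rule model_free)
  show "phi model e = t" by (simp add: zphi_def)
  fix n :: nat assume n: "2 \<le> n"
  have "n = 2 \<or> n = 3 \<or> 5 \<le> n \<and> odd n \<or> 4 \<le> n \<and> even n" using n by presburger
  then consider "n = 2" | "n = 3" | "5 \<le> n" "odd n" | "4 \<le> n" "even n" by blast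
  then show "bd model n e =
      (if n = 2 then e [^]\<^bsub>grp model 1\<^esub> r
       else if n = 3 then cact model e e \<otimes>\<^bsub>grp model 2\<^esub> inv\<^bsub>grp model 2\<^esub> e
       else if odd n then dot model (n - 1) e (Poly_Mapping.single t 1 - Poly_Mapping.single \<one> 1)
       else dot model (n - 1) e (norm_elt G t r))"
  proof cases
    case 1
    have "e [^]\<^bsub>zgrp\<^esub> r = Poly_Mapping.single \<one> (int r)"
      by (simp add: int_pow_int[symmetric])
    then show ?thesis by (simp add: 1 mu_eq)
  next
    case 2
    then show ?thesis by (simp add: Zp.gact_def diff_mult_def zphi_def)
  next
    case 3
    then have "n - 1 \<noteq> 1" "n \<noteq> 2" "n \<noteq> 3" by linarith+
    then show ?thesis using 3 by (simp add: gring_ring_act diff_mult_def)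
  next
    case 4
    then have "n - 1 \<noteq> 1" "n \<noteq> 2" "n \<noteq> 3" by linarith+
    then show ?thesis using 4 by (simp add: gring_ring_act norm_mult_e)
  qed
qed

end

theorem theorem10p2:
  fixes G :: "'g monoid" and t :: 'g and r :: nat
  assumes "group G" and "finite (carrier G)"
    and "t \<in> carrier G" and "generate G {t} = carrier G" and "order G = r"
  shows "(\<exists>(F :: ('g, 'g \<Rightarrow>\<^sub>0 int) crossed_data) x. cyclic_resolution G t r F x) \<and>
    (\<forall>(F :: ('g, 'a) crossed_data) x. cyclic_resolution G t r F x \<longrightarrow>
       (\<exists>h0 h. contracting_homotopy G F h0 h \<and> cyclic_homotopy_values G t r F x h0 h \<and>
          (\<forall>k0 k. contracting_homotopy G F k0 k \<and> cyclic_homotopy_values G t r F x k0 k \<longrightarrow>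
             (\<forall>g\<in>carrier G. k0 g = h0 g) \<and>
             (\<forall>n\<ge>1. \<forall>g\<in>carrier G. \<forall>c\<in>carrier (grp F n). k n (g, c) = h n (g, c)))))"
proof (intro conjI allI impI)
  interpret finite_cyclic G t r
    using assms by (simp add: finite_cyclic_def finite_cyclic_axioms_def)
  show "\<exists>(F :: ('g, 'g \<Rightarrow>\<^sub>0 int) crossed_data) x. cyclic_resolution G t r F x"
    using model_resolution by blast
  fix F :: "('g, 'a) crossed_data" and x
  assume "cyclic_resolution G t r F x"
  then interpret cyclic_crossed_resolution G t r F x
    by unfold_locales
  show "\<exists>h0 h. contracting_homotopy G F h0 h \<and> cyclic_homotopy_values G t r F x h0 h \<and>
          (\<forall>k0 k. contracting_homotopy G F k0 k \<and> cyclic_homotopy_values G t r F x k0 k \<longrightarrow>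
             (\<forall>g\<in>carrier G. k0 g = h0 g) \<and>
             (\<forall>n\<ge>1. \<forall>g\<in>carrier G. \<forall>c\<in>carrier (grp F n). k n (g, c) = h n (g, c)))"
    using contracting homotopy_values unique
    by (intro exI[of _ h0] exI[of _ hty]) blast
qed

end
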